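(* Let $\Delta$ be a connected profinite graph. Then its universal profinite covering graph $(\widetilde\Delta,p)$ exists and it is regular (that is, $p\colon\widetilde\Delta\to\Delta$ is a regular covering). Furthermore, if $(\Sigma,g)$ is any profinite covering graph of $\Delta$ and $h$ is a homomorphism of coverings from $(\widetilde\Delta,p)$ to $(\Sigma,g)$, then the pair $(\widetilde\Delta,h)$ is a regular profinite covering graph of $\Sigma$.
   Context: A graph $\Gamma$ is a set that is the disjoint union of a set $V(\Gamma)$ of vertices and a set $E(\Gamma)$ of edges, with maps $s,t\colon E(\Gamma)\to V(\Gamma)$ and an involution $e\mapsto\overline e$ of $E(\Gamma)$ such that $\overline e\ne e$, $s(\overline e)=t(e)$, $t(\overline e)=s(e)$. A map of graphs sends vertices to vertices and edges to edges and commutes with $s$, $t$ and $e\mapsto\overline e$. A map of graphs $f$ is locally bijective if for every vertex $v$ it restricts to a bijection from $\{e\mid s(e)=v\}$ onto $\{e'\mid s(e')=f(v)\}$. A graph is path connected if it is nonempty and any two vertices are joined by a finite edge path. A regular covering of finite path connected graphs is a locally bijective map $q\colon X\to Y$ of such graphs with $q_*\pi_1(X,x)$ normal in $\pi_1(Y,q(x))$ for a vertex $x$ (equivalently, the group of automorphisms of $X$ over $Y$ is transitive on each vertex fiber). An equivalence relation $R$ on a graph $\Gamma$ is compatible if no vertex is equivalent to an edge, if $(e_1,e_2)\in R$ for edges implies $(s(e_1),s(e_2)),(t(e_1),t(e_2)),(\overline{e_1},\overline{e_2})\in R$, and $(e,\overline e)\notin R$ for all edges $e$; thus the set $\Gamma/R$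 of classes is a graph. A cofinite graph is a graph with a Hausdorff uniformity in which every entourage contains a compatible cofinite entourage, i.e. an entourage that is a compatible equivalence relation with finitely many classes. A profinite graph is a compact cofinite graph (equivalently, an inverse limit of finite discrete graphs). It is connected if $\Gamma/R$ is path connected for every compatible cofinite entourage $R$. An inverse system of maps $(f_i\colon\Gamma_i\to\Delta_i,\phi_{ij},\psi_{ij})$ over a directed set $I$ consists of continuous maps of graphs $f_i$, and, for $j\ge i$, continuous maps of graphs $\phi_{ij}\colon\Gamma_j\to\Gamma_i$, $\psi_{ij}\colon\Delta_j\to\Delta_i$ forming inverse systems, with $f_i\phi_{ij}=\psi_{ij}f_j$. Its inverse limit is the induced continuous map $f\colon\varprojlim\Gamma_i\to\varprojlim\Delta_i$. A map of profinite graphs $f\colon\Gamma\to\Delta$ is a covering (respectively, a regular covering) if it is the inverse limit of an inverse system in which each $f_i$ is a locally bijective map of finite discrete graphs (respectively, a regular covering of path connected finite discrete graphs); then $(\Gamma,f)$ is called a profinite covering graph (respectively, a regular profinite covering graph) of $\Delta$, connected if $\Gamma$ is connected. A homomorphism from a profinite covering graph $(\Gamma_1,f_1)$ of $\Delta$ to another $(\Gamma_2,f_2)$ is a continuous map of graphs $h\colon\Gamma_1\to\Gamma_2$ with $f_2h=f_1$. For $\Delta$ connected, a connected profinite covering graph $(\widetilde\Delta,p)$ of $\Delta$ is a universal profinite covering graph of $\Delta$ if, whenever $(\Gamma,f)$ is a connected profinite covering graph of $\Delta$ and $c$, $a$ are vertices of $\widetilde\Delta$, $\Gamma$ with $p(c)=f(a)$,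 there exists a homomorphism of coverings $h$ from $(\widetilde\Delta,p)$ to $(\Gamma,f)$ with $h(c)=a$.
   Formalization: The last claim is proved for connected Σ (for disconnected Σ it is false, since the target of a regular covering is connected, e.g. Σ two copies of Δ); for arbitrary Σ it is proved that h is a regular covering of the subgraph h(Δ̃) of Σ. *)

theory Defs
  imports "HOL-Analysis.Analysis" "HOL-Algebra.Coset"
begin

section \<open>Graphs\<close>

text \<open>
  A graph is one set, the disjoint union of its vertices and edges, because equivalence relations
  and uniformities live on that union. All data are relative to the carrier \<open>points G\<close>;
  functions are unconstrained outside it.
\<close>

record 'a graph =
  verts :: "'a set"
  edges :: "'a set"
  source :: "'a \<Rightarrow> 'a"
  target :: "'a \<Rightarrow> 'a"
  opp :: "'a \<Rightarrow> 'a"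

definition points :: "('a, 'm) graph_scheme \<Rightarrow> 'a set" where
  "points G = verts G \<union> edges G"

definition is_graph :: "('a, 'm) graph_scheme \<Rightarrow> bool" where
  "is_graph G \<longleftrightarrow> verts G \<inter> edges G = {} \<and>
     (\<forall>e\<in>edges G. source G e \<in> verts G \<and> target G e \<in> verts G \<and> opp G e \<in> edges G \<and>
        opp G (opp G e) = e \<and> opp G e \<noteq> e \<and>
        source G (opp G e) = target G e \<and> target G (opp G e) = source G e)"

definition graph_map :: "('a, 'm) graph_scheme \<Rightarrow> ('b, 'n) graph_scheme \<Rightarrow> ('a \<Rightarrow> 'b) \<Rightarrow> bool" where
  "graph_map G H f \<longleftrightarrow> f ` verts G \<subseteq> verts H \<and> f ` edges G \<subseteq> edges H \<and>
     (\<forall>e\<in>edges G. f (source G e) = source H (f e) \<and> f (target G e) = target H (f e) \<and>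
        f (opp G e) = opp H (f e))"

definition graph_iso :: "('a, 'm) graph_scheme \<Rightarrow> ('b, 'n) graph_scheme \<Rightarrow> ('a \<Rightarrow> 'b) \<Rightarrow> bool" where
  "graph_iso G H f \<longleftrightarrow> graph_map G H f \<and> bij_betw f (verts G) (verts H) \<and> bij_betw f (edges G) (edges H)"

definition star :: "('a, 'm) graph_scheme \<Rightarrow> 'a \<Rightarrow> 'a set" where
  "star G v = {e \<in> edges G. source G e = v}"

definition locally_bijective ::
    "('a, 'm) graph_scheme \<Rightarrow> ('b, 'n) graph_scheme \<Rightarrow> ('a \<Rightarrow> 'b) \<Rightarrow> bool" where
  "locally_bijective G H f \<longleftrightarrow> graph_map G H f \<and> (\<forall>v\<in>verts G. bij_betw f (star G v) (star H (f v)))"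

fun edge_path :: "('a, 'm) graph_scheme \<Rightarrow> 'a \<Rightarrow> 'a list \<Rightarrow> 'a \<Rightarrow> bool" where
  "edge_path G u [] w \<longleftrightarrow> u \<in> verts G \<and> u = w"
| "edge_path G u (e # es) w \<longleftrightarrow> e \<in> edges G \<and> source G e = u \<and> edge_path G (target G e) es w"

definition path_connected_graph :: "('a, 'm) graph_scheme \<Rightarrow> bool" where
  "path_connected_graph G \<longleftrightarrow> verts G \<noteq> {} \<and> (\<forall>u\<in>verts G. \<forall>w\<in>verts G. \<exists>es. edge_path G u es w)"


section \<open>Fundamental group and finite regular coverings\<close>

definition loops :: "('a, 'm) graph_scheme \<Rightarrow> 'a \<Rightarrow> 'a list set" where
  "loops G x = {es. edge_path G x es x}"

definition backtrack :: "('a, 'm) graph_scheme \<Rightarrow> 'a \<Rightarrow> ('a list \<times> 'a list) set" where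
  "backtrack G x = {(p @ q, p @ [e, opp G e] @ q) | p e q.
     p @ q \<in> loops G x \<and> p @ [e, opp G e] @ q \<in> loops G x}"

definition loop_homotopy :: "('a, 'm) graph_scheme \<Rightarrow> 'a \<Rightarrow> ('a list \<times> 'a list) set" where
  "loop_homotopy G x = Restr ((backtrack G x \<union> (backtrack G x)\<inverse>)\<^sup>*) (loops G x)"

definition pi1 :: "('a, 'm) graph_scheme \<Rightarrow> 'a \<Rightarrow> 'a list set monoid" where
  "pi1 G x = \<lparr>carrier = loops G x // loop_homotopy G x,
     monoid.mult = (\<lambda>A B. \<Union>p\<in>A. \<Union>q\<in>B. loop_homotopy G x `` {p @ q}),
     one = loop_homotopy G x `` {[]}\<rparr>"

definition pi1_map ::
    "('b, 'n) graph_scheme \<Rightarrow> ('a \<Rightarrow> 'b) \<Rightarrow> 'a \<Rightarrow> 'a list set \<Rightarrow> 'b list set" where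
  "pi1_map H f x A = (\<Union>p\<in>A. loop_homotopy H (f x) `` {map f p})"

definition finite_covering ::
    "('a, 'm) graph_scheme \<Rightarrow> ('b, 'n) graph_scheme \<Rightarrow> ('a \<Rightarrow> 'b) \<Rightarrow> bool" where
  "finite_covering X Y q \<longleftrightarrow> is_graph X \<and> is_graph Y \<and> finite (points X) \<and> finite (points Y) \<and>
     locally_bijective X Y q"

definition finite_regular_covering ::
    "('a, 'm) graph_scheme \<Rightarrow> ('b, 'n) graph_scheme \<Rightarrow> ('a \<Rightarrow> 'b) \<Rightarrow> bool" where
  "finite_regular_covering X Y q \<longleftrightarrow> finite_covering X Y q \<and>
     path_connected_graph X \<and> path_connected_graph Y \<and>
     (\<exists>x\<in>verts X. normal (pi1_map Y q x ` carrier (pi1 X x)) (pi1 Y (q x)))"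


section \<open>Uniformities on a carrier\<close>

definition uniformity_on :: "'a set \<Rightarrow> ('a \<times> 'a) set set \<Rightarrow> bool" where
  "uniformity_on X U \<longleftrightarrow> U \<noteq> {} \<and>
     (\<forall>E\<in>U. Id_on X \<subseteq> E \<and> E \<subseteq> X \<times> X \<and> E\<inverse> \<in> U \<and> (\<exists>F\<in>U. F O F \<subseteq> E)) \<and>
     (\<forall>E\<in>U. \<forall>F\<in>U. E \<inter> F \<in> U) \<and>
     (\<forall>E\<in>U. \<forall>F. E \<subseteq> F \<and> F \<subseteq> X \<times> X \<longrightarrow> F \<in> U)"

definition uniform_topology :: "'a set \<Rightarrow> ('a \<times> 'a) set set \<Rightarrow> 'a topology" where
  "uniform_topology X U = topology (\<lambda>W. W \<subseteq> X \<and> (\<forall>x\<in>W. \<exists>E\<in>U. E `` {x} \<subseteq> W))"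

lemma openin_uniform_topology:
  assumes "uniformity_on X U"
  shows "openin (uniform_topology X U) W \<longleftrightarrow> W \<subseteq> X \<and> (\<forall>x\<in>W. \<exists>E\<in>U. E `` {x} \<subseteq> W)"
proof -
  have Int: "\<forall>E\<in>U. \<forall>F\<in>U. E \<inter> F \<in> U"
    using assms unfolding uniformity_on_def by (elim conjE)
  have "istopology (\<lambda>W. W \<subseteq> X \<and> (\<forall>x\<in>W. \<exists>E\<in>U. E `` {x} \<subseteq> W))" (is "istopology ?op")
    unfolding istopology_def
  proof (intro conjI allI impI)
    fix S T assume S: "?op S" and T: "?op T"
    show "S \<inter> T \<subseteq> X" using S by (elim conjE) (rule le_infI1)
    show "\<forall>x\<in>S \<inter> T. \<exists>E\<in>U. E `` {x} \<subseteq> S \<inter> T"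
    proof
      fix x assume "x \<in> S \<inter> T"
      then obtain E F where EF: "E \<in> U" "F \<in> U" "E `` {x} \<subseteq> S" "F `` {x} \<subseteq> T"
        using S T by (metis IntD1 IntD2)
      have "E \<inter> F \<in> U" using Int EF(1,2) by (elim ballE) auto
      moreover have "(E \<inter> F) `` {x} \<subseteq> S \<inter> T" using EF(3,4) by auto
      ultimately show "\<exists>E\<in>U. E `` {x} \<subseteq> S \<inter> T" by (rule rev_bexI)
    qed
  next
    fix \<K> assume K: "\<forall>K\<in>\<K>. ?op K"
    then show "\<Union>\<K> \<subseteq> X" by (meson Sup_least)
    show "\<forall>x\<in>\<Union>\<K>. \<exists>E\<in>U. E `` {x} \<subseteq> \<Union>\<K>"
    proof
      fix x assume "x \<in> \<Union>\<K>"
      then obtain K where "K \<in> \<K>" "x \<in> K" by (rule UnionE)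
      moreover from this obtain E where "E \<in> U" "E `` {x} \<subseteq> K" using K by metis
      ultimately show "\<exists>E\<in>U. E `` {x} \<subseteq> \<Union>\<K>" by (metis Union_upper subset_trans)
    qed
  qed
  then show ?thesis
    unfolding uniform_topology_def by (rule topology_inverse'[THEN fun_cong])
qed

lemma topspace_uniform_topology:
  assumes "uniformity_on X U"
  shows "topspace (uniform_topology X U) = X"
proof -
  have ne: "U \<noteq> {}"
    using assms unfolding uniformity_on_def by (elim conjE)
  have sub: "\<forall>E\<in>U. Id_on X \<subseteq> E \<and> E \<subseteq> X \<times> X \<and> E\<inverse> \<in> U \<and> (\<exists>F\<in>U. F O F \<subseteq> E)"
    using assms unfolding uniformity_on_def by (elim conjE)
  obtain E where E: "E \<in> U" "E \<subseteq> X \<times> X" using ne sub by (metis ex_in_conv)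
  from E(2) have "E `` {x} \<subseteq> X" for x by auto
  with E(1) have "openin (uniform_topology X U) X"
    unfolding openin_uniform_topology[OF assms] by (metis order_refl)
  moreover have "topspace (uniform_topology X U) \<subseteq> X"
    using openin_topspace[of "uniform_topology X U"]
    unfolding openin_uniform_topology[OF assms] by (rule conjunct1)
  ultimately show ?thesis by (metis openin_subset subset_antisym)
qed


section \<open>Cofinite and profinite graphs\<close>

record 'a ugraph = "'a graph" +
  entourages :: "('a \<times> 'a) set set"

definition gtop :: "('a, 'm) ugraph_scheme \<Rightarrow> 'a topology" where
  "gtop G = uniform_topology (points G) (entourages G)"

definition compatible :: "('a, 'm) graph_scheme \<Rightarrow> ('a \<times> 'a) set \<Rightarrow> bool" where
  "compatible G R \<longleftrightarrow> equiv (points G) R \<and>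
     (\<forall>v\<in>verts G. \<forall>e\<in>edges G. (v, e) \<notin> R) \<and>
     (\<forall>e1\<in>edges G. \<forall>e2\<in>edges G. (e1, e2) \<in> R \<longrightarrow>
        (source G e1, source G e2) \<in> R \<and> (target G e1, target G e2) \<in> R \<and>
        (opp G e1, opp G e2) \<in> R) \<and>
     (\<forall>e\<in>edges G. (e, opp G e) \<notin> R)"

definition compatible_cofinite_entourage ::
    "('a, 'm) ugraph_scheme \<Rightarrow> ('a \<times> 'a) set \<Rightarrow> bool" where
  "compatible_cofinite_entourage G R \<longleftrightarrow>
     R \<in> entourages G \<and> compatible G R \<and> finite (points G // R)"

text \<open>For a compatible \<open>R\<close> and a class \<open>A\<close> of edges, \<open>R `` (source G ` A)\<close> is the
  \<open>R\<close>-class of the source of any element of \<open>A\<close>; similarly for \<open>target\<close> and \<open>opp\<close>.\<close>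

definition quotient_graph :: "('a, 'm) graph_scheme \<Rightarrow> ('a \<times> 'a) set \<Rightarrow> 'a set graph" where
  "quotient_graph G R = \<lparr>verts = verts G // R, edges = edges G // R,
     source = (\<lambda>A. R `` (source G ` A)),
     target = (\<lambda>A. R `` (target G ` A)),
     opp = (\<lambda>A. R `` (opp G ` A))\<rparr>"

definition cofinite_graph :: "('a, 'm) ugraph_scheme \<Rightarrow> bool" where
  "cofinite_graph G \<longleftrightarrow> is_graph G \<and> uniformity_on (points G) (entourages G) \<and>
     \<Inter>(entourages G) = Id_on (points G) \<and>
     (\<forall>E\<in>entourages G. \<exists>R. R \<subseteq> E \<and> compatible_cofinite_entourage G R)"

definition profinite_graph :: "('a, 'm) ugraph_scheme \<Rightarrow> bool" where
  "profinite_graph G \<longleftrightarrow> cofinite_graph G \<and> compact_space (gtop G)"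

definition connected_ugraph :: "('a, 'm) ugraph_scheme \<Rightarrow> bool" where
  "connected_ugraph G \<longleftrightarrow>
     (\<forall>R. compatible_cofinite_entourage G R \<longrightarrow> path_connected_graph (quotient_graph G R))"

definition induced_subgraph :: "'a ugraph \<Rightarrow> 'a set \<Rightarrow> 'a ugraph" where
  "induced_subgraph G S = \<lparr>verts = verts G \<inter> S, edges = edges G \<inter> S,
     source = source G, target = target G, opp = opp G,
     entourages = (\<lambda>E. E \<inter> S \<times> S) ` entourages G\<rparr>"


section \<open>Inverse limits of finite discrete graphs\<close>

definition directed :: "'i set \<Rightarrow> ('i \<times> 'i) set \<Rightarrow> bool" where
  "directed I leq \<longleftrightarrow> I \<noteq> {} \<and> preorder_on I leq \<and> (\<forall>i\<in>I. \<forall>j\<in>I. \<exists>k\<in>I. (i, k) \<in> leq \<and> (j, k) \<in> leq)"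

text \<open>Bonding maps \<open>\<phi> i j\<close> go from index \<open>j\<close> down to \<open>i\<close>; continuity is automatic between
  discrete graphs.\<close>

definition inverse_system ::
    "'i set \<Rightarrow> ('i \<times> 'i) set \<Rightarrow> ('i \<Rightarrow> 'b graph) \<Rightarrow> ('i \<Rightarrow> 'i \<Rightarrow> 'b \<Rightarrow> 'b) \<Rightarrow> bool" where
  "inverse_system I leq G \<phi> \<longleftrightarrow> directed I leq \<and>
     (\<forall>i\<in>I. is_graph (G i) \<and> finite (points (G i))) \<and>
     (\<forall>(i, j)\<in>leq. graph_map (G j) (G i) (\<phi> i j)) \<and>
     (\<forall>i\<in>I. \<forall>x\<in>points (G i). \<phi> i i x = x) \<and>
     (\<forall>i j k. (i, j) \<in> leq \<and> (j, k) \<in> leq \<longrightarrow> (\<forall>x\<in>points (G k). \<phi> i j (\<phi> j k x) = \<phi> i k x))"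

definition inverse_limit ::
    "'i set \<Rightarrow> ('i \<times> 'i) set \<Rightarrow> ('i \<Rightarrow> 'b graph) \<Rightarrow> ('i \<Rightarrow> 'i \<Rightarrow> 'b \<Rightarrow> 'b) \<Rightarrow> ('i \<Rightarrow> 'b) graph" where
  "inverse_limit I leq G \<phi> =
     \<lparr>verts = {x \<in> Pi\<^sub>E I (\<lambda>i. verts (G i)). \<forall>(i, j)\<in>leq. \<phi> i j (x j) = x i},
      edges = {x \<in> Pi\<^sub>E I (\<lambda>i. edges (G i)). \<forall>(i, j)\<in>leq. \<phi> i j (x j) = x i},
      source = (\<lambda>x. \<lambda>i\<in>I. source (G i) (x i)),
      target = (\<lambda>x. \<lambda>i\<in>I. target (G i) (x i)),
      opp = (\<lambda>x. \<lambda>i\<in>I. opp (G i) (x i))\<rparr>"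

definition limit_topology ::
    "'i set \<Rightarrow> ('i \<times> 'i) set \<Rightarrow> ('i \<Rightarrow> 'b graph) \<Rightarrow> ('i \<Rightarrow> 'i \<Rightarrow> 'b \<Rightarrow> 'b) \<Rightarrow> ('i \<Rightarrow> 'b) topology" where
  "limit_topology I leq G \<phi> =
     subtopology (product_topology (\<lambda>i. discrete_topology (points (G i))) I)
       (points (inverse_limit I leq G \<phi>))"

text \<open>Isomorphism of a profinite graph with an inverse limit. The limit carries only its topology:
  it is compact Hausdorff, so a homeomorphism is a uniform isomorphism.\<close>

definition limit_iso ::
    "'a ugraph \<Rightarrow> 'i set \<Rightarrow> ('i \<times> 'i) set \<Rightarrow> ('i \<Rightarrow> 'b graph) \<Rightarrow> ('i \<Rightarrow> 'i \<Rightarrow> 'b \<Rightarrow> 'b) \<Rightarrow>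
     ('a \<Rightarrow> 'i \<Rightarrow> 'b) \<Rightarrow> bool" where
  "limit_iso \<Gamma> I leq G \<phi> \<alpha> \<longleftrightarrow>
     graph_iso \<Gamma> (inverse_limit I leq G \<phi>) \<alpha> \<and>
     homeomorphic_map (gtop \<Gamma>) (limit_topology I leq G \<phi>) \<alpha>"

definition inverse_system_of_maps ::
    "'i set \<Rightarrow> ('i \<times> 'i) set \<Rightarrow> ('i \<Rightarrow> 'b graph) \<Rightarrow> ('i \<Rightarrow> 'i \<Rightarrow> 'b \<Rightarrow> 'b) \<Rightarrow>
     ('i \<Rightarrow> 'c graph) \<Rightarrow> ('i \<Rightarrow> 'i \<Rightarrow> 'c \<Rightarrow> 'c) \<Rightarrow> ('i \<Rightarrow> 'b \<Rightarrow> 'c) \<Rightarrow> bool" where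
  "inverse_system_of_maps I leq G \<phi> D \<psi> q \<longleftrightarrow>
     inverse_system I leq G \<phi> \<and> inverse_system I leq D \<psi> \<and>
     (\<forall>i\<in>I. graph_map (G i) (D i) (q i)) \<and>
     (\<forall>(i, j)\<in>leq. \<forall>x\<in>points (G j). q i (\<phi> i j x) = \<psi> i j (q j x))"

text \<open>
  HOL cannot quantify over types inside a formula, so the finite graphs of an inverse system have
  their points in \<open>nat\<close>, and the indices are taken from a type depending on the types of the two
  profinite graphs. Neither choice loses generality. A system over an arbitrary directed set has a
  directed subsystem with the same limit map and at most
  \<open>\<aleph>\<^sub>0 + number of entourages of \<Gamma> and \<Delta>\<close> indices: choose enough indices to make the
  kernels of the projections cofinal, close up under upper bounds, and for each index \<open>i\<close> add some
  \<open>j\<close> above it such that the images of \<open>G j\<close> in \<open>G i\<close> and of \<open>D j\<close> in \<open>D i\<close> are those of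
  \<open>\<Gamma>\<close> and \<open>\<Delta>\<close> (it exists by compactness).
\<close>

type_synonym ('a, 'b) sys_index = "nat \<times> ('a \<times> 'a) set \<times> ('b \<times> 'b) set"

definition pro_map ::
    "(nat graph \<Rightarrow> nat graph \<Rightarrow> (nat \<Rightarrow> nat) \<Rightarrow> bool) \<Rightarrow> 'a ugraph \<Rightarrow> 'b ugraph \<Rightarrow> ('a \<Rightarrow> 'b) \<Rightarrow> bool" where
  "pro_map P \<Gamma> \<Delta> f \<longleftrightarrow> profinite_graph \<Gamma> \<and> profinite_graph \<Delta> \<and>
     (\<exists>(I :: ('a, 'b) sys_index set) leq G \<phi> D \<psi> q \<alpha> \<beta>.
        inverse_system_of_maps I leq G \<phi> D \<psi> q \<and> (\<forall>i\<in>I. P (G i) (D i) (q i)) \<and>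
        limit_iso \<Gamma> I leq G \<phi> \<alpha> \<and> limit_iso \<Delta> I leq D \<psi> \<beta> \<and>
        (\<forall>x\<in>points \<Gamma>. \<forall>i\<in>I. \<beta> (f x) i = q i (\<alpha> x i)) \<and> f ` points \<Gamma> \<subseteq> points \<Delta>)"

definition profinite_covering :: "'a ugraph \<Rightarrow> 'b ugraph \<Rightarrow> ('a \<Rightarrow> 'b) \<Rightarrow> bool" where
  "profinite_covering = pro_map finite_covering"

definition regular_profinite_covering :: "'a ugraph \<Rightarrow> 'b ugraph \<Rightarrow> ('a \<Rightarrow> 'b) \<Rightarrow> bool" where
  "regular_profinite_covering = pro_map finite_regular_covering"


section \<open>Universal profinite covering graphs\<close>

definition covering_hom ::
    "'a ugraph \<Rightarrow> ('a \<Rightarrow> 'd) \<Rightarrow> 'b ugraph \<Rightarrow> ('b \<Rightarrow> 'd) \<Rightarrow> ('a \<Rightarrow> 'b) \<Rightarrow> bool" where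
  "covering_hom \<Gamma>1 f1 \<Gamma>2 f2 h \<longleftrightarrow> graph_map \<Gamma>1 \<Gamma>2 h \<and> continuous_map (gtop \<Gamma>1) (gtop \<Gamma>2) h \<and>
     (\<forall>x\<in>points \<Gamma>1. f2 (h x) = f1 x)"

text \<open>The first argument is the type in which the test objects \<open>\<Gamma>\<close> have their points.\<close>

definition universal_profinite_covering ::
    "'t itself \<Rightarrow> 'u ugraph \<Rightarrow> 'a ugraph \<Rightarrow> ('u \<Rightarrow> 'a) \<Rightarrow> bool" where
  "universal_profinite_covering _ U \<Delta> p \<longleftrightarrow> profinite_covering U \<Delta> p \<and> connected_ugraph U \<and>
     (\<forall>(\<Gamma> :: 't ugraph) f. profinite_covering \<Gamma> \<Delta> f \<and> connected_ugraph \<Gamma> \<longrightarrow>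
        (\<forall>c\<in>verts U. \<forall>a\<in>verts \<Gamma>. p c = f a \<longrightarrow> (\<exists>h. covering_hom U p \<Gamma> f h \<and> h c = a)))"

text \<open>
  A type that contains an isomorphic copy of every connected profinite covering graph of a
  connected profinite graph with points in \<open>'a\<close>: families of points of pointed finite coverings
  \<open>q\<close>, from \<open>X\<close> with base vertex \<open>x\<close>, of the finite quotients \<open>quotient_graph \<Delta> R\<close>, indexed by
  \<open>(R, X, q, x)\<close>. Every such covering graph is a continuous image of the inverse limit of the
  regular ones among these coverings, so its cardinality does not exceed that of this type.
\<close>

type_synonym 'a cover_point = "('a \<times> 'a) set \<times> nat graph \<times> (nat \<Rightarrow> 'a set) \<times> nat \<Rightarrow> nat"

end

(* Consider all pointed finite coverings of the finite quotients of \<Delta>. The universal covering is the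
   connected component of the base point in their fibre product over \<Delta>: a point over x is a family of
   points, one in each covering, every finite part of which lies over x in the component of the finite
   fibre product. The set of base points of such a finite component decreases when the quotient of \<Delta>
   is refined, so it is eventually constant; by compactness the universal covering then maps onto the
   finite component. All base points over v0 are allowed, so deck transformations permute coordinates
   and these components are Galois; hence p is a limit of finite regular coverings. A finite covering
   of \<Delta> receives a map from the universal covering because it is one of the coordinates. A homomorphism
   to another covering factors at the finite levels through quotients of these Galois coverings, which
   gives the second part. *)

theory Submission
  imports Defs
begin

section \<open>Graphs, paths and coverings\<close>

text \<open>Normality of a subgroup of the fundamental group is awkward to check on constructed
  graphs, so regularity is proved through deck transformations (\<open>galois\<close>) and
  translated once. A presentation as an inverse limit demands finite graphs on natural numbers; the
  notion \<open>level\<close> therefore allows finite graphs of any type, and only the kernels of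
  the two maps to them enter the index set. The obstacle at the finite levels is that the pull-back
  of a connected finite covering to a finer quotient of \<Delta> can fall apart, and then the
  component at the coarse level may be larger than the image of the limit. The point of \<Delta> is
  not stored in a point of the universal covering; it is read off from the coordinates of the
  trivial coverings of the quotients. Since test graphs range over one type only, an arbitrary
  universal covering is compared with the constructed one and inherits its levels and its lifting
  property for all types. A homomorphism into a disconnected covering graph reaches only a part of
  it, so its covering property is about the image.\<close>

lemma graph_edge:
  assumes "is_graph G" "e \<in> edges G"
  shows "source G e \<in> verts G" "target G e \<in> verts G" "opp G e \<in> edges G"
    "opp G (opp G e) = e" "opp G e \<noteq> e" "source G (opp G e) = target G e" "target G (opp G e) = source G e"
  using assms unfolding is_graph_def by auto

lemma graph_disjoint: "is_graph G \<Longrightarrow> x \<in> verts G \<Longrightarrow> x \<in> edges G \<Longrightarrow> False"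
  unfolding is_graph_def by auto

lemma in_points_iff: "x \<in> points G \<longleftrightarrow> x \<in> verts G \<or> x \<in> edges G"
  unfolding points_def by auto

lemma graph_map_on:
  assumes "graph_map G H f"
  shows "x \<in> verts G \<Longrightarrow> f x \<in> verts H" "x \<in> edges G \<Longrightarrow> f x \<in> edges H"
    "x \<in> points G \<Longrightarrow> f x \<in> points H"
    "x \<in> edges G \<Longrightarrow> f (source G x) = source H (f x)"
    "x \<in> edges G \<Longrightarrow> f (target G x) = target H (f x)"
    "x \<in> edges G \<Longrightarrow> f (opp G x) = opp H (f x)"
  using assms unfolding graph_map_def points_def by auto

lemma graph_mapI:
  assumes "\<And>x. x \<in> verts G \<Longrightarrow> f x \<in> verts H" "\<And>x. x \<in> edges G \<Longrightarrow> f x \<in> edges H"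
    "\<And>x. x \<in> edges G \<Longrightarrow> f (source G x) = source H (f x)"
    "\<And>x. x \<in> edges G \<Longrightarrow> f (target G x) = target H (f x)"
    "\<And>x. x \<in> edges G \<Longrightarrow> f (opp G x) = opp H (f x)"
  shows "graph_map G H f"
  using assms unfolding graph_map_def by auto

lemma graph_map_comp:
  assumes "graph_map G H f" "graph_map H K g"
  shows "graph_map G K (\<lambda>x. g (f x))"
  by (intro graph_mapI) (auto simp: graph_map_on[OF assms(1)] graph_map_on[OF assms(2)])

lemma graph_map_cong:
  assumes "is_graph G" "graph_map G H f" "\<And>x. x \<in> points G \<Longrightarrow> g x = f x"
  shows "graph_map G H g"
  using assms(2) graph_edge[OF assms(1)] assms(3)
  by (intro graph_mapI) (auto simp: in_points_iff graph_map_on)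

text \<open>A point that is not a vertex is an edge and goes to an edge, which is not a vertex of
  \<open>H\<close>; hence graph maps reflect the kind of a point.\<close>

lemma graph_map_vertex:
  assumes "graph_map G H f" "is_graph H" "x \<in> points G" "f x \<in> verts H"
  shows "x \<in> verts G"
  using assms graph_disjoint graph_map_on(2) in_points_iff by metis

lemma graph_map_edge:
  assumes "graph_map G H f" "is_graph H" "x \<in> points G" "f x \<in> edges H"
  shows "x \<in> edges G"
  using assms graph_disjoint graph_map_on(1) in_points_iff by metis

definition graph_onto :: "('a, 'm) graph_scheme \<Rightarrow> ('b, 'n) graph_scheme \<Rightarrow> ('a \<Rightarrow> 'b) \<Rightarrow> bool" where
  "graph_onto G H f \<longleftrightarrow> graph_map G H f \<and> f ` verts G = verts H \<and> f ` edges G = edges H"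

lemma graph_onto_points: "graph_onto G H f \<Longrightarrow> f ` points G = points H"
  unfolding graph_onto_def points_def by auto

lemma graph_onto_map: "graph_onto G H f \<Longrightarrow> graph_map G H f"
  unfolding graph_onto_def by auto

lemma graph_ontoI:
  assumes "graph_map G H f" "\<And>y. y \<in> verts H \<Longrightarrow> \<exists>x\<in>verts G. y = f x" "\<And>y. y \<in> edges H \<Longrightarrow> \<exists>x\<in>edges G. y = f x"
  shows "graph_onto G H f"
  unfolding graph_onto_def
proof (intro conjI equalityI subsetI assms(1))
  show "y \<in> verts H" if "y \<in> f ` verts G" for y using that graph_map_on(1)[OF assms(1)] by auto
  show "y \<in> edges H" if "y \<in> f ` edges G" for y using that graph_map_on(2)[OF assms(1)] by auto
  show "y \<in> f ` verts G" if "y \<in> verts H" for y using assms(2)[OF that] by (metis imageI)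
  show "y \<in> f ` edges G" if "y \<in> edges H" for y using assms(3)[OF that] by (metis imageI)
qed

lemma graph_onto_vert: "graph_onto G H f \<Longrightarrow> y \<in> verts H \<Longrightarrow> \<exists>x\<in>verts G. y = f x"
  unfolding graph_onto_def by (metis imageE)

lemma graph_onto_edge: "graph_onto G H f \<Longrightarrow> y \<in> edges H \<Longrightarrow> \<exists>x\<in>edges G. y = f x"
  unfolding graph_onto_def by (metis imageE)

lemma graph_onto_point: "graph_onto G H f \<Longrightarrow> y \<in> points H \<Longrightarrow> \<exists>x\<in>points G. y = f x"
  using graph_onto_points[of G H f] by (metis imageE)

lemma graph_onto_comp:
  assumes "graph_onto G H f" "graph_onto H K g"
  shows "graph_onto G K (\<lambda>x. g (f x))"
  using assms graph_map_comp[of G H f K g] unfolding graph_onto_def by (metis image_image)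

text \<open>Every vertex and edge of \<open>H\<close> comes from one of the same kind in
  \<open>G\<close>, where the graph map \<open>k\<close> takes care of sources, targets and
  opposites. This makes maps out of quotients that are defined by choosing preimages into graph
  maps.\<close>

lemma graph_onto_factor:
  assumes f: "graph_onto G H f" and m: "\<And>x. x \<in> points G \<Longrightarrow> m (f x) = k x"
  and k: "graph_map G K k" and G: "is_graph G"
  shows "graph_map H K m"
proof (rule graph_mapI)
  note km = graph_map_on[OF k] and fm = graph_map_on[OF graph_onto_map[OF f]]
  show "m y \<in> verts K" if "y \<in> verts H" for y
    using graph_onto_vert[OF f that] km(1) m unfolding in_points_iff by auto
  fix y assume "y \<in> edges H"
  then obtain x where x: "x \<in> edges G" "y = f x" using graph_onto_edge[OF f] by auto
  note e = graph_edge[OF G x(1)]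
  show "m y \<in> edges K" using x km m unfolding in_points_iff by auto
  show "m (source H y) = source K (m y)" "m (target H y) = target K (m y)" "m (opp H y) = opp K (m y)"
    using x e km fm m[of x] m[of "source G x"] m[of "target G x"] m[of "opp G x"]
    unfolding in_points_iff by auto
qed

lemma graph_iso_imp_onto: "graph_iso G H f \<Longrightarrow> graph_onto G H f"
  unfolding graph_iso_def graph_onto_def by (auto simp: bij_betw_def)

text \<open>Injectivity on vertices and edges together also requires that no vertex and edge have
  the same image; this comes from the disjointness in \<open>H\<close>.\<close>

lemma graph_iso_inj:
  assumes "graph_iso G H f" "is_graph H"
  shows "inj_on f (points G)"
  unfolding points_def
proof (rule inj_on_Un[THEN iffD2, OF conjI], goal_cases)
  case 1 then show ?case using assms unfolding graph_iso_def bij_betw_def by auto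
next
  case 2
  have "f ` verts G \<subseteq> verts H" "f ` edges G \<subseteq> edges H"
    using assms unfolding graph_iso_def graph_map_def by auto
  moreover have "verts H \<inter> edges H = {}" using assms(2) unfolding is_graph_def by simp
  ultimately have "f ` verts G \<inter> f ` edges G = {}" by blast
  then show ?case using assms(1) unfolding graph_iso_def bij_betw_def by auto
qed

lemma graph_isoI:
  assumes "graph_onto G H f" "inj_on f (points G)"
  shows "graph_iso G H f"
  using assms unfolding graph_iso_def graph_onto_def points_def
  by (auto simp: bij_betw_def inj_on_Un)

lemma graph_iso_bij: "graph_iso G H f \<Longrightarrow> is_graph H \<Longrightarrow> bij_betw f (points G) (points H)"
  using graph_iso_inj graph_onto_points[OF graph_iso_imp_onto] unfolding bij_betw_def by metis

lemma graph_iso_inv: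
  assumes i: "graph_iso G H i" and G: "is_graph G" and H: "is_graph H"
  shows "graph_iso H G (inv_into (points G) i)"
proof (rule graph_isoI)
  note o = graph_iso_imp_onto[OF i] and inj = graph_iso_inj[OF i H]
  have m: "graph_map H G (inv_into (points G) i)"
    by (rule graph_onto_factor[OF o _ _ G, where k = "\<lambda>x. x"])
      (use inj in \<open>auto simp: graph_map_def\<close>)
  have *: "x = inv_into (points G) i (i x)" if "x \<in> points G" for x
    using inj that by auto
  show "graph_onto H G (inv_into (points G) i)"
    unfolding graph_onto_def
  proof (intro conjI m equalityI subsetI)
    fix x assume "x \<in> verts G"
    then show "x \<in> inv_into (points G) i ` verts H"
      using *[of x] graph_map_on(1)[OF graph_onto_map[OF o]] by (metis image_eqI in_points_iff)
  next
    fix x assume "x \<in> edges G"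
    then show "x \<in> inv_into (points G) i ` edges H"
      using *[of x] graph_map_on(2)[OF graph_onto_map[OF o]] by (metis image_eqI in_points_iff)
  qed (use m in \<open>auto simp: graph_map_def\<close>)
  show "inj_on (inv_into (points G) i) (points H)"
    using graph_onto_points[OF o] by (metis inj_on_inv_into order_refl)
qed

section \<open>Locally bijective maps\<close>

lemma star_image: "graph_map G H f \<Longrightarrow> v \<in> verts G \<Longrightarrow> f ` star G v \<subseteq> star H (f v)"
  unfolding star_def by (auto simp: graph_map_on)

lemma locally_bijective_iso:
  assumes i: "graph_iso G H f" and G: "is_graph G" and H: "is_graph H"
  shows "locally_bijective G H f"
  unfolding locally_bijective_def
proof (intro conjI ballI)
  have m: "graph_map G H f" using i unfolding graph_iso_def by simp
  then show "graph_map G H f" .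
  fix v assume v: "v \<in> verts G"
  note inj = graph_iso_inj[OF i H]
  have "star G v \<subseteq> points G" unfolding star_def points_def by auto
  moreover have "star H (f v) \<subseteq> f ` star G v"
  proof
    fix e assume e: "e \<in> star H (f v)"
    then obtain e' where e': "e' \<in> edges G" "e = f e'"
      using graph_onto_edge[OF graph_iso_imp_onto[OF i]] unfolding star_def by auto
    have "f (source G e') = f v" using e e' m unfolding star_def by (simp add: graph_map_on)
    then have "source G e' = v"
      using inj v graph_edge(1)[OF G e'(1)] unfolding points_def inj_on_def by auto
    then show "e \<in> f ` star G v" using e' unfolding star_def by auto
  qed
  ultimately show "bij_betw f (star G v) (star H (f v))"
    using star_image[OF m v] inj_on_subset[OF inj] unfolding bij_betw_def by auto
qed

lemma locally_bijective_comp: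
  assumes "locally_bijective G H f" "locally_bijective H K g"
  shows "locally_bijective G K (\<lambda>x. g (f x))"
  unfolding locally_bijective_def
proof (intro conjI ballI)
  show "graph_map G K (\<lambda>x. g (f x))"
    using assms graph_map_comp unfolding locally_bijective_def by blast
  fix v assume v: "v \<in> verts G"
  have "bij_betw f (star G v) (star H (f v))" "bij_betw g (star H (f v)) (star K (g (f v)))"
    using assms v unfolding locally_bijective_def by (auto simp: graph_map_on)
  from bij_betw_trans[OF this] show "bij_betw (\<lambda>x. g (f x)) (star G v) (star K (g (f v)))"
    by (simp add: comp_def)
qed

lemma locally_bijective_map: "locally_bijective G H f \<Longrightarrow> graph_map G H f"
  unfolding locally_bijective_def by simp

lemma locally_bijective_inj:
  assumes "locally_bijective G H f" "is_graph G"
    "e \<in> edges G" "e' \<in> edges G" "source G e = source G e'" "f e = f e'"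
  shows "e = e'"
proof -
  have "source G e' \<in> verts G" using graph_edge(1)[OF assms(2,4)] .
  then have "inj_on f (star G (source G e'))" using assms(1)
    unfolding locally_bijective_def bij_betw_def by auto
  then show ?thesis using assms unfolding inj_on_def star_def by auto
qed

lemma locally_bijective_ex:
  assumes "locally_bijective G H f" "v \<in> verts G" "e \<in> edges H" "source H e = f v"
  shows "\<exists>e'\<in>edges G. source G e' = v \<and> f e' = e"
proof -
  have "e \<in> f ` star G v" using assms unfolding locally_bijective_def bij_betw_def star_def by auto
  then show ?thesis unfolding star_def by auto
qed

lemma locally_bijectiveI:
  assumes "graph_map G H f"
    "\<And>e e'. e \<in> edges G \<Longrightarrow> e' \<in> edges G \<Longrightarrow> source G e = source G e' \<Longrightarrow> f e = f e' \<Longrightarrow> e = e'"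
    "\<And>v e. v \<in> verts G \<Longrightarrow> e \<in> edges H \<Longrightarrow> source H e = f v \<Longrightarrow> \<exists>e'\<in>edges G. source G e' = v \<and> f e' = e"
  shows "locally_bijective G H f"
  unfolding locally_bijective_def bij_betw_def
proof (intro conjI ballI)
  fix v assume v: "v \<in> verts G"
  show "inj_on f (star G v)" using assms(2) unfolding inj_on_def star_def by auto
  show "f ` star G v = star H (f v)"
    using star_image[OF assms(1) v] assms(3)[OF v] unfolding star_def by fastforce
qed (fact assms)

text \<open>Both \<open>q\<close> and \<open>r\<close> match stars with stars of \<open>Y\<close>,
  so \<open>h\<close> matches the stars of \<open>X\<close> with those of \<open>Z\<close>: an edge
  of \<open>Z\<close> is pushed to \<open>Y\<close>, lifted to \<open>X\<close>, and recognised by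
  injectivity of \<open>r\<close> on stars.\<close>

lemma locally_bijective_factor:
  assumes h: "graph_map X Z h" and q: "locally_bijective X Y q" and r: "locally_bijective Z Y r"
    and rh: "\<And>x. x \<in> points X \<Longrightarrow> r (h x) = q x" and X: "is_graph X" and Z: "is_graph Z"
  shows "locally_bijective X Z h"
proof (rule locally_bijectiveI[OF h])
  fix e e' assume "e \<in> edges X" "e' \<in> edges X" "source X e = source X e'" "h e = h e'"
  then show "e = e'" using locally_bijective_inj[OF q X] rh unfolding in_points_iff by metis
next
  fix v e assume v: "v \<in> verts X" and e: "e \<in> edges Z" "source Z e = h v"
  have "source Y (r e) = r (h v)" using e graph_map_on(4)[OF locally_bijective_map[OF r]] by metis
  then have "source Y (r e) = q v" using rh v unfolding in_points_iff by auto
  then obtain e' where e': "e' \<in> edges X" "source X e' = v" "q e' = r e"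
    using locally_bijective_ex[OF q v] graph_map_on(2)[OF locally_bijective_map[OF r] e(1)] by metis
  have "source Z (h e') = source Z e" using graph_map_on(4)[OF h e'(1)] e' e by simp
  moreover have "r (h e') = r e" using rh[of e'] e' by (simp add: in_points_iff)
  ultimately have "h e' = e"
    using locally_bijective_inj[OF r Z graph_map_on(2)[OF h e'(1)] e(1)] by simp
  then show "\<exists>e'\<in>edges X. source X e' = v \<and> h e' = e" using e' by auto
qed

section \<open>Edge paths and unique path lifting\<close>

lemma edge_path_edges: "edge_path G u es w \<Longrightarrow> set es \<subseteq> edges G"
  by (induction es arbitrary: u) auto

lemma edge_path_verts:
  assumes "is_graph G" "edge_path G u es w"
  shows "u \<in> verts G" "w \<in> verts G"
  using assms(2) by (induction es arbitrary: u) (auto simp: graph_edge[OF assms(1)])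

lemma edge_path_append:
  assumes "is_graph G"
  shows "edge_path G u (p @ q) w \<longleftrightarrow> (\<exists>v. edge_path G u p v \<and> edge_path G v q w)"
  by (induction p arbitrary: u) (auto dest: edge_path_verts[OF assms])

definition inv_path :: "('a, 'm) graph_scheme \<Rightarrow> 'a list \<Rightarrow> 'a list" where
  "inv_path G es = rev (map (opp G) es)"

lemma inv_path_simps [simp]:
  "inv_path G [] = []" "inv_path G (e # es) = inv_path G es @ [opp G e]"
  "inv_path G (p @ q) = inv_path G q @ inv_path G p"
  by (auto simp: inv_path_def)

lemma edge_path_inv:
  assumes "is_graph G" "edge_path G u es w"
  shows "edge_path G w (inv_path G es) u"
  using assms(2)
  by (induction es arbitrary: u) (auto simp: edge_path_append[OF assms(1)] graph_edge[OF assms(1)])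

lemma inv_path_inv_path: "is_graph G \<Longrightarrow> set es \<subseteq> edges G \<Longrightarrow> inv_path G (inv_path G es) = es"
  by (induction es) (auto simp: graph_edge)

lemma map_inv_path: "graph_map G H f \<Longrightarrow> set es \<subseteq> edges G \<Longrightarrow> map f (inv_path G es) = inv_path H (map f es)"
  by (induction es) (auto simp: graph_map_on)

lemma edge_path_map:
  assumes "graph_map G H f" "edge_path G u es w"
  shows "edge_path H (f u) (map f es) (f w)"
  using assms(2)
proof (induction es arbitrary: u)
  case (Cons e es)
  then have "edge_path H (f (target G e)) (map f es) (f w)" by auto
  then show ?case using Cons.prems graph_map_on[OF assms(1), of e] by auto
qed (auto simp: graph_map_on[OF assms(1)])

lemma edge_path_lift:
  assumes q: "locally_bijective X Y q" and X: "is_graph X" and x: "x \<in> verts X"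
    and p: "edge_path Y (q x) es y"
  shows "\<exists>es' x'. edge_path X x es' x' \<and> map q es' = es \<and> q x' = y"
  using x p
proof (induction es arbitrary: x)
  case Nil
  then show ?case by (intro exI[of _ "[]"] exI[of _ x]) auto
next
  case (Cons e es)
  then obtain e' where e': "e' \<in> edges X" "source X e' = x" "q e' = e"
    using locally_bijective_ex[OF q] by (metis edge_path.simps(2))
  then have "edge_path Y (q (target X e')) es y"
    using Cons.prems(2) graph_map_on(5)[OF locally_bijective_map[OF q]] by auto
  from Cons.IH[OF graph_edge(2)[OF X e'(1)] this]
  obtain es' x' where "edge_path X (target X e') es' x'" "map q es' = es" "q x' = y" by blast
  then show ?case using e' by (intro exI[of _ "e' # es'"] exI[of _ x']) auto
qed

lemma edge_path_lift_unique:
  assumes q: "locally_bijective X Y q" and X: "is_graph X"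
    and "edge_path X x es x1" "edge_path X x es' x2" "map q es = map q es'"
  shows "es = es' \<and> x1 = x2"
  using assms(3-)
proof (induction es arbitrary: x es')
  case Nil then show ?case by auto
next
  case (Cons e es)
  then obtain f fs where fs: "es' = f # fs" by auto
  then have "e = f" using Cons.prems locally_bijective_inj[OF q X, of e f] by auto
  then show ?case using Cons fs by auto
qed

text \<open>Reversal turns the common end into a common start, where lifts are unique.\<close>

lemma edge_path_lift_unique_end:
  assumes q: "locally_bijective X Y q" and X: "is_graph X"
    and 1: "edge_path X x1 es x" and 2: "edge_path X x2 es' x" and eq: "map q es = map q es'"
  shows "x1 = x2"
proof -
  have "map q (inv_path X es) = map q (inv_path X es')"
    using eq map_inv_path[OF locally_bijective_map[OF q]] edge_path_edges 1 2 by metis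
  then show ?thesis
    using edge_path_lift_unique[OF q X edge_path_inv[OF X 1] edge_path_inv[OF X 2]] by auto
qed

section \<open>Reachability, uniqueness of lifts and path components\<close>

definition reach :: "('a, 'm) graph_scheme \<Rightarrow> 'a \<Rightarrow> 'a \<Rightarrow> bool" where
  "reach G u w \<longleftrightarrow> (\<exists>es. edge_path G u es w)"

lemma reach_refl: "u \<in> verts G \<Longrightarrow> reach G u u"
  unfolding reach_def by (rule exI[of _ "[]"]) auto

lemma reach_trans: "is_graph G \<Longrightarrow> reach G u v \<Longrightarrow> reach G v w \<Longrightarrow> reach G u w"
  unfolding reach_def using edge_path_append by metis

lemma reach_sym: "is_graph G \<Longrightarrow> reach G u v \<Longrightarrow> reach G v u"
  unfolding reach_def using edge_path_inv by metis

lemma reach_map: "graph_map G H f \<Longrightarrow> reach G u v \<Longrightarrow> reach H (f u) (f v)"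
  unfolding reach_def using edge_path_map by metis

lemma reach_verts: "is_graph G \<Longrightarrow> reach G u v \<Longrightarrow> u \<in> verts G" "is_graph G \<Longrightarrow> reach G u v \<Longrightarrow> v \<in> verts G"
  unfolding reach_def using edge_path_verts by metis+

lemma reach_edge: "is_graph G \<Longrightarrow> e \<in> edges G \<Longrightarrow> reach G (source G e) (target G e)"
  unfolding reach_def by (rule exI[of _ "[e]"]) (auto simp: graph_edge)

lemma reach_invariant:
  assumes "reach G u w" "P u" "\<And>e. e \<in> edges G \<Longrightarrow> P (source G e) \<Longrightarrow> P (target G e)"
  shows "P w"
proof -
  obtain es where "edge_path G u es w" using assms(1) unfolding reach_def by auto
  then show ?thesis using assms(2) by (induction es arbitrary: u) (auto intro: assms(3))
qed

lemma reach_lift: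
  assumes "locally_bijective X Y q" "is_graph X" "x \<in> verts X" "reach Y (q x) y"
  shows "\<exists>x'. reach X x x' \<and> q x' = y"
  using assms(4) edge_path_lift[OF assms(1-3)] unfolding reach_def by metis

lemma path_connected_reach:
  "path_connected_graph G \<Longrightarrow> u \<in> verts G \<Longrightarrow> w \<in> verts G \<Longrightarrow> reach G u w"
  unfolding path_connected_graph_def reach_def by auto

lemma path_connectedI:
  assumes "is_graph G" "u \<in> verts G" "\<And>w. w \<in> verts G \<Longrightarrow> reach G u w"
  shows "path_connected_graph G"
  unfolding path_connected_graph_def
  using assms reach_trans[OF assms(1)] reach_sym[OF assms(1)] reach_def by (metis empty_iff)

lemma path_connected_onto:
  assumes "graph_onto G H f" "path_connected_graph G" "is_graph G"
  shows "path_connected_graph H"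
  unfolding path_connected_graph_def
proof (intro conjI ballI)
  show "verts H \<noteq> {}" using assms unfolding path_connected_graph_def graph_onto_def by auto
  fix u w assume "u \<in> verts H" "w \<in> verts H"
  then obtain u' w' where *: "u' \<in> verts G" "w' \<in> verts G" "u = f u'" "w = f w'"
    using graph_onto_vert[OF assms(1)] by metis
  then show "\<exists>es. edge_path H u es w"
    using reach_map[OF graph_onto_map[OF assms(1)] path_connected_reach[OF assms(2)]]
    unfolding reach_def by auto
qed

text \<open>Agreement spreads from \<open>u\<close>: at a vertex where \<open>f\<close> and
  \<open>g\<close> agree, the images of an outgoing edge lie in the same star of \<open>Z\<close>
  and have the same image under \<open>r\<close>, so they are equal, and so are the images of its
  target.\<close>

lemma lifts_agree:
  assumes f: "graph_map X Z f" and g: "graph_map X Z g" and r: "locally_bijective Z Y r" and Z: "is_graph Z"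
    and eq: "\<And>x. x \<in> points X \<Longrightarrow> r (f x) = r (g x)" and u: "f u = g u" and X: "is_graph X" "path_connected_graph X"
    and uX: "u \<in> verts X" and x: "x \<in> points X"
  shows "f x = g x"
proof -
  have edge: "f e = g e" if "e \<in> edges X" "f (source X e) = g (source X e)" for e
  proof (rule locally_bijective_inj[OF r Z])
    show "source Z (f e) = source Z (g e)"
      using that graph_map_on(4)[OF f that(1)] graph_map_on(4)[OF g that(1)] by simp
  qed (use that graph_map_on(2)[OF f] graph_map_on(2)[OF g] eq in \<open>auto simp: in_points_iff\<close>)
  have vert: "f w = g w" if "w \<in> verts X" for w
  proof (rule reach_invariant[of X u w "\<lambda>w. f w = g w"])
    fix e assume e: "e \<in> edges X" "f (source X e) = g (source X e)"
    then show "f (target X e) = g (target X e)"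
      using edge[OF e] graph_map_on(5)[OF f e(1)] graph_map_on(5)[OF g e(1)] by simp
  qed (use u uX that path_connected_reach[OF X(2)] in auto)
  show ?thesis using x vert edge graph_edge[OF X(1)] unfolding in_points_iff by auto
qed

text \<open>The operations are those of \<open>G\<close> itself, so that graph maps and paths of
  \<open>G\<close> restrict without change.\<close>

definition component :: "('a, 'm) graph_scheme \<Rightarrow> 'a \<Rightarrow> 'a graph" where
  "component G u = \<lparr>verts = {w. reach G u w}, edges = {e \<in> edges G. reach G u (source G e)},
     source = source G, target = target G, opp = opp G\<rparr>"

lemma component_simps [simp]:
  "verts (component G u) = {w. reach G u w}" "edges (component G u) = {e \<in> edges G. reach G u (source G e)}"
  "source (component G u) = source G" "target (component G u) = target G" "opp (component G u) = opp G"
  by (auto simp: component_def)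

lemma component_subset:
  assumes "is_graph G"
  shows "verts (component G u) \<subseteq> verts G" "edges (component G u) \<subseteq> edges G" "points (component G u) \<subseteq> points G"
  using reach_verts[OF assms] unfolding points_def by auto

lemma is_graph_component:
  assumes "is_graph G"
  shows "is_graph (component G u)"
proof -
  have t: "reach G u (target G e)" if "e \<in> edges G" "reach G u (source G e)" for e
    using reach_trans[OF assms that(2) reach_edge[OF assms that(1)]] .
  show ?thesis
    unfolding is_graph_def using t reach_verts(2)[OF assms] graph_disjoint[OF assms]
    by (auto simp: graph_edge[OF assms])
qed

lemma path_connected_component:
  assumes "is_graph G" "u \<in> verts G"
  shows "path_connected_graph (component G u)"
proof (rule path_connectedI[OF is_graph_component[OF assms(1)]])
  show "u \<in> verts (component G u)" using reach_refl[OF assms(2)] by simp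
  \<comment> \<open>A path that starts in the component never leaves it, so it is a path of the
    component.\<close>
  have *: "edge_path (component G u) v es w" if "edge_path G v es w" "reach G u v" for v es w
    using that
  proof (induction es arbitrary: v)
    case (Cons e es)
    then have "reach G u (target G e)"
      using reach_trans[OF assms(1) Cons.prems(2)] reach_edge[OF assms(1)] by auto
    then show ?case using Cons by auto
  qed auto
  fix w assume "w \<in> verts (component G u)"
  then show "reach (component G u) u w"
    using *[OF _ reach_refl[OF assms(2)]] by (auto simp: reach_def)
qed

lemma graph_map_component:
  assumes "graph_map G H f"
  shows "graph_map (component G u) (component H (f u)) f"
  using assms reach_map[OF assms] graph_map_on[OF assms]
  by (intro graph_mapI) (auto, metis)

lemma locally_bijective_component:
  assumes q: "locally_bijective X Y q" and X: "is_graph X"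
  shows "locally_bijective (component X u) Y q"
proof (rule locally_bijectiveI)
  note m = graph_map_on[OF locally_bijective_map[OF q]] and e = graph_edge[OF X]
  show "graph_map (component X u) Y q"
    using reach_verts[OF X] m by (intro graph_mapI) auto
  show "e = e'" if "e \<in> edges (component X u)" "e' \<in> edges (component X u)"
    "source (component X u) e = source (component X u) e'" "q e = q e'" for e e'
    using that locally_bijective_inj[OF q X] by auto
  fix v e assume *: "v \<in> verts (component X u)" "e \<in> edges Y" "source Y e = q v"
  then have "v \<in> verts X" using reach_verts[OF X] by auto
  from locally_bijective_ex[OF q this *(2,3)] *(1)
  show "\<exists>e'\<in>edges (component X u). source (component X u) e' = v \<and> q e' = e" by auto
qed

text \<open>Path lifting from \<open>u\<close> reaches every vertex of the component below, and
  local bijectivity at the lifted source supplies the edges.\<close>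

lemma component_lift:
  assumes q: "locally_bijective X Y q" and X: "is_graph X" and Y: "is_graph Y" and u: "u \<in> verts X"
    and w: "w \<in> points (component Y (q u))"
  shows "\<exists>z\<in>points (component X u). q z = w"
proof (cases "w \<in> verts (component Y (q u))")
  case True
  then obtain z where "reach X u z" "q z = w" using reach_lift[OF q X u] by auto
  then show ?thesis unfolding points_def by auto
next
  case False
  then have w: "w \<in> edges Y" "reach Y (q u) (source Y w)" using w unfolding points_def by auto
  then obtain v where v: "reach X u v" "q v = source Y w" using reach_lift[OF q X u] by blast
  then obtain e where "e \<in> edges X" "source X e = v" "q e = w"
    using locally_bijective_ex[OF q _ w(1)] reach_verts[OF X] by metis
  then show ?thesis using v unfolding points_def by auto
qed

lemma covering_onto:
  assumes q: "locally_bijective X Y q" and X: "is_graph X" "verts X \<noteq> {}" and Y: "is_graph Y" "path_connected_graph Y"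
  shows "graph_onto X Y q"
proof -
  obtain u where u: "u \<in> verts X" using X by auto
  note m = locally_bijective_map[OF q]
  have v: "w \<in> q ` verts X" if "w \<in> verts Y" for w
    using reach_lift[OF q X(1) u path_connected_reach[OF Y(2) graph_map_on(1)[OF m u] that]]
      reach_verts[OF X(1)] by force
  have "e \<in> q ` edges X" if e: "e \<in> edges Y" for e
  proof -
    obtain w where "w \<in> verts X" "source Y e = q w" using v[OF graph_edge(1)[OF Y(1) e]] by (metis imageE)
    then show ?thesis using locally_bijective_ex[OF q _ e] by auto
  qed
  then show ?thesis using m v unfolding graph_onto_def graph_map_def by auto
qed

section \<open>The fundamental group of a Galois covering\<close>

lemma loops_iff: "p \<in> loops Y y \<longleftrightarrow> edge_path Y y p y"
  by (simp add: loops_def)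

lemma loops_append: "is_graph Y \<Longrightarrow> p \<in> loops Y y \<Longrightarrow> q \<in> loops Y y \<Longrightarrow> p @ q \<in> loops Y y"
  by (auto simp: loops_iff edge_path_append)

lemma loops_inv_path: "is_graph Y \<Longrightarrow> p \<in> loops Y y \<Longrightarrow> inv_path Y p \<in> loops Y y"
  by (simp add: loops_iff edge_path_inv)

lemma loops_map: "graph_map X Y q \<Longrightarrow> p \<in> loops X x \<Longrightarrow> map q p \<in> loops Y (q x)"
  by (simp add: loops_iff edge_path_map)

abbreviation "elementary Y y \<equiv> backtrack Y y \<union> (backtrack Y y)\<inverse>"

lemma backtrack_loops: "(p, q) \<in> backtrack Y y \<Longrightarrow> p \<in> loops Y y \<and> q \<in> loops Y y"
  unfolding backtrack_def by auto

lemma backtrackI: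
  assumes "p @ q \<in> loops Y y" "p @ [e, opp Y e] @ q \<in> loops Y y"
  shows "(p @ q, p @ [e, opp Y e] @ q) \<in> backtrack Y y"
  using assms unfolding backtrack_def by blast

lemma elementary_rtrancl_loops: "(p, q) \<in> (elementary Y y)\<^sup>* \<Longrightarrow> p \<in> loops Y y \<Longrightarrow> q \<in> loops Y y"
  by (induction rule: rtrancl_induct) (auto dest: backtrack_loops)

lemma loop_homotopy_iff:
  "(p, q) \<in> loop_homotopy Y y \<longleftrightarrow> p \<in> loops Y y \<and> (p, q) \<in> (elementary Y y)\<^sup>*"
  unfolding loop_homotopy_def using elementary_rtrancl_loops by auto

lemma equiv_loop_homotopy: "equiv (loops Y y) (loop_homotopy Y y)"
proof (rule equivI)
  show "refl_on (loops Y y) (loop_homotopy Y y)"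
    by (auto simp: refl_on_def loop_homotopy_iff)
  show "loop_homotopy Y y \<subseteq> loops Y y \<times> loops Y y" unfolding loop_homotopy_def by auto
  have "sym ((elementary Y y)\<^sup>*)" by (rule sym_rtrancl) (auto simp: sym_def)
  then show "sym (loop_homotopy Y y)"
    by (auto simp: sym_def loop_homotopy_iff intro: elementary_rtrancl_loops)
  show "trans (loop_homotopy Y y)"
    by (auto simp: trans_def loop_homotopy_iff intro: rtrancl_trans)
qed

text \<open>An operation that turns one insertion of a backtrack into another respects homotopy, by
  induction over the chain of moves. It serves for concatenation on either side and for images under
  graph maps.\<close>

lemma loop_homotopy_mapI:
  assumes pq: "(p, q) \<in> loop_homotopy X x" and p: "f p \<in> loops Y y"
    and b: "\<And>a b. (a, b) \<in> backtrack X x \<Longrightarrow> (f a, f b) \<in> backtrack Y y"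
  shows "(f p, f q) \<in> loop_homotopy Y y"
proof -
  have "(p, q) \<in> (elementary X x)\<^sup>*" using pq unfolding loop_homotopy_iff by simp
  then have "(f p, f q) \<in> (elementary Y y)\<^sup>*"
  proof (induction rule: rtrancl_induct)
    case (step a c)
    then have "(f a, f c) \<in> elementary Y y" using b by blast
    with step show ?case by (meson rtrancl.rtrancl_into_rtrancl)
  qed auto
  with p show ?thesis unfolding loop_homotopy_iff by simp
qed

lemma loop_homotopy_append:
  assumes Y: "is_graph Y" and p: "(p, p') \<in> loop_homotopy Y y" and q: "(q, q') \<in> loop_homotopy Y y"
  shows "(p @ q, p' @ q') \<in> loop_homotopy Y y"
proof -
  have l: "p \<in> loops Y y" "p' \<in> loops Y y" "q \<in> loops Y y" "q' \<in> loops Y y"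
    using p q unfolding loop_homotopy_def by auto
  have "(p @ q, p' @ q) \<in> loop_homotopy Y y"
  proof (rule loop_homotopy_mapI[OF p, of "\<lambda>p. p @ q"])
    fix a b assume ab: "(a, b) \<in> backtrack Y y"
    then obtain r e s where "a = r @ s" "b = r @ [e, opp Y e] @ s" unfolding backtrack_def by auto
    moreover have "a @ q \<in> loops Y y" "b @ q \<in> loops Y y"
      using backtrack_loops[OF ab] l(3) by (simp_all add: loops_append[OF Y])
    ultimately show "(a @ q, b @ q) \<in> backtrack Y y" using backtrackI[of r "s @ q"] by simp
  qed (use l loops_append[OF Y] in blast)
  moreover have "(p' @ q, p' @ q') \<in> loop_homotopy Y y"
  proof (rule loop_homotopy_mapI[OF q, of "\<lambda>q. p' @ q"])
    fix a b assume ab: "(a, b) \<in> backtrack Y y"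
    then obtain r e s where "a = r @ s" "b = r @ [e, opp Y e] @ s" unfolding backtrack_def by auto
    moreover have "p' @ a \<in> loops Y y" "p' @ b \<in> loops Y y"
      using backtrack_loops[OF ab] l(2) by (simp_all add: loops_append[OF Y])
    ultimately show "(p' @ a, p' @ b) \<in> backtrack Y y" using backtrackI[of "p' @ r" s] by simp
  qed (use l loops_append[OF Y] in blast)
  ultimately show ?thesis using equiv_loop_homotopy[of Y y] unfolding equiv_def trans_def by blast
qed

text \<open>The path \<open>p\<close> and its inverse are inserted from the outside in: the pair
  \<open>e\<close>, \<open>opp Y e\<close> for the leading edge goes between \<open>a\<close> and
  \<open>b\<close> and is then absorbed into them, which is why \<open>a\<close> and
  \<open>b\<close> vary in the induction.\<close>

lemma loop_homotopy_cancel: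
  assumes Y: "is_graph Y" and "edge_path Y u p w" "edge_path Y y a u" "edge_path Y u b y"
  shows "(a @ b, a @ p @ inv_path Y p @ b) \<in> loop_homotopy Y y"
  using assms(2-)
proof (induction p arbitrary: u a b)
  case Nil
  then have "a @ b \<in> loops Y y" by (auto simp: loops_iff edge_path_append[OF Y])
  then show ?case unfolding loop_homotopy_iff by simp
next
  case (Cons e p)
  let ?t = "target Y e"
  have e: "e \<in> edges Y" "source Y e = u" "edge_path Y ?t p w" using Cons.prems by auto
  note ee = graph_edge[OF Y e(1)]
  have "edge_path Y u [e] ?t" "edge_path Y ?t [opp Y e] u" using e ee by auto
  then have 1: "edge_path Y y (a @ [e]) ?t" "edge_path Y ?t ([opp Y e] @ b) y"
    "edge_path Y u ([e, opp Y e]) u"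
    using Cons.prems e ee by (auto simp: edge_path_append[OF Y])
  have "a @ b \<in> loops Y y" "a @ [e, opp Y e] @ b \<in> loops Y y"
    using Cons.prems 1(3) unfolding loops_iff edge_path_append[OF Y] by blast+
  then have "(a @ b, a @ [e, opp Y e] @ b) \<in> loop_homotopy Y y"
    using r_into_rtrancl[of _ "elementary Y y"] backtrackI[of a b Y y e] by (simp add: loop_homotopy_iff)
  moreover have "((a @ [e]) @ [opp Y e] @ b, (a @ [e]) @ p @ inv_path Y p @ [opp Y e] @ b) \<in> loop_homotopy Y y"
    by (rule Cons.IH[OF e(3) 1(1,2)])
  ultimately show ?case using equiv_loop_homotopy[of Y y] unfolding equiv_def trans_def by simp
qed

section \<open>The group of homotopy classes of loops\<close>

abbreviation "loop_class Y y p \<equiv> loop_homotopy Y y `` {p}"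

lemma loop_class_eq: "(p, q) \<in> loop_homotopy Y y \<Longrightarrow> loop_class Y y p = loop_class Y y q"
  by (rule equiv_class_eq[OF equiv_loop_homotopy])

lemma carrier_pi1: "carrier (pi1 Y y) = loop_class Y y ` loops Y y"
  unfolding pi1_def quotient_def by auto

lemma one_pi1: "\<one>\<^bsub>pi1 Y y\<^esub> = loop_class Y y []"
  unfolding pi1_def by simp

lemma mult_pi1:
  assumes "is_graph Y" "p \<in> loops Y y" "q \<in> loops Y y"
  shows "loop_class Y y p \<otimes>\<^bsub>pi1 Y y\<^esub> loop_class Y y q = loop_class Y y (p @ q)"
proof -
  have "congruent2 (loop_homotopy Y y) (loop_homotopy Y y) (\<lambda>p q. loop_class Y y (p @ q))"
    using loop_homotopy_append[OF assms(1)] loop_class_eq unfolding congruent2_def by fastforce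
  from UN_equiv_class2[OF equiv_loop_homotopy equiv_loop_homotopy this assms(2,3)]
  show ?thesis unfolding pi1_def by simp
qed

lemma loop_class_inverse:
  assumes Y: "is_graph Y" and p: "p \<in> loops Y y"
  shows "loop_class Y y (inv_path Y p) \<otimes>\<^bsub>pi1 Y y\<^esub> loop_class Y y p = \<one>\<^bsub>pi1 Y y\<^esub>"
proof -
  note i = loops_inv_path[OF Y p]
  have "edge_path Y y [] y" using edge_path_verts[OF Y] p unfolding loops_iff by auto
  then have "([], inv_path Y p @ p) \<in> loop_homotopy Y y"
    using loop_homotopy_cancel[OF Y, of y "inv_path Y p" y y "[]" "[]"] i
      inv_path_inv_path[OF Y edge_path_edges] p unfolding loops_def by auto
  from loop_class_eq[OF this] show ?thesis using mult_pi1[OF Y i p] one_pi1 by metis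
qed

lemma group_pi1:
  assumes Y: "is_graph Y" and y: "y \<in> verts Y"
  shows "group (pi1 Y y)"
proof (rule groupI)
  have nil: "[] \<in> loops Y y" using y unfolding loops_def by simp
  note app = loops_append[OF Y] and mult = mult_pi1[OF Y]
  show "\<one>\<^bsub>pi1 Y y\<^esub> \<in> carrier (pi1 Y y)" using nil unfolding one_pi1 carrier_pi1 by blast
  fix A assume "A \<in> carrier (pi1 Y y)"
  then obtain p where p: "p \<in> loops Y y" "A = loop_class Y y p" unfolding carrier_pi1 by auto
  show "\<one>\<^bsub>pi1 Y y\<^esub> \<otimes>\<^bsub>pi1 Y y\<^esub> A = A" using mult[OF nil p(1)] p unfolding one_pi1 by simp
  show "\<exists>B\<in>carrier (pi1 Y y). B \<otimes>\<^bsub>pi1 Y y\<^esub> A = \<one>\<^bsub>pi1 Y y\<^esub>"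
    using loop_class_inverse[OF Y p(1)] loops_inv_path[OF Y p(1)] p(2) unfolding carrier_pi1 by blast
  fix B assume "B \<in> carrier (pi1 Y y)"
  then obtain q where q: "q \<in> loops Y y" "B = loop_class Y y q" unfolding carrier_pi1 by auto
  show "A \<otimes>\<^bsub>pi1 Y y\<^esub> B \<in> carrier (pi1 Y y)" using mult[OF p(1) q(1)] app[OF p(1) q(1)] p q unfolding carrier_pi1 by simp
  fix C assume "C \<in> carrier (pi1 Y y)"
  then obtain r where r: "r \<in> loops Y y" "C = loop_class Y y r" unfolding carrier_pi1 by auto
  show "A \<otimes>\<^bsub>pi1 Y y\<^esub> B \<otimes>\<^bsub>pi1 Y y\<^esub> C = A \<otimes>\<^bsub>pi1 Y y\<^esub> (B \<otimes>\<^bsub>pi1 Y y\<^esub> C)"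
    using mult[OF p(1) q(1)] mult[OF q(1) r(1)] mult[OF p(1) app[OF q(1) r(1)]]
      mult[OF app[OF p(1) q(1)] r(1)] p q r by simp
qed

lemma inv_pi1:
  assumes Y: "is_graph Y" and y: "y \<in> verts Y" and p: "p \<in> loops Y y"
  shows "inv\<^bsub>pi1 Y y\<^esub> (loop_class Y y p) = loop_class Y y (inv_path Y p)"
  using p loops_inv_path[OF Y p] loop_class_inverse[OF Y p]
  by (intro group.inv_equality[OF group_pi1[OF Y y]]) (auto simp: carrier_pi1)

text \<open>The class is independent of the representative because mapping a loop commutes with
  inserting a backtrack: all edges of a loop lie in the graph, where \<open>q\<close> commutes with
  \<open>opp\<close>.\<close>

lemma pi1_map_class:
  assumes q: "graph_map X Y q" and p: "p \<in> loops X x"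
  shows "pi1_map Y q x (loop_class X x p) = loop_class Y (q x) (map q p)"
proof -
  have "(map q a, map q b) \<in> loop_homotopy Y (q x)" if ab: "(a, b) \<in> loop_homotopy X x" for a b
  proof (rule loop_homotopy_mapI[OF ab])
    show "map q a \<in> loops Y (q x)" using ab loops_map[OF q] unfolding loop_homotopy_iff by blast
    fix a b assume ab: "(a, b) \<in> backtrack X x"
    then obtain r e s where rs: "a = r @ s" "b = r @ [e, opp X e] @ s" unfolding backtrack_def by auto
    have l: "a \<in> loops X x" "b \<in> loops X x" using backtrack_loops[OF ab] by auto
    then have "set b \<subseteq> edges X" unfolding loops_iff by (simp add: edge_path_edges)
    then have "q (opp X e) = opp Y (q e)" using graph_map_on(6)[OF q] rs by simp
    then show "(map q a, map q b) \<in> backtrack Y (q x)"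
      using l[THEN loops_map[OF q]] rs backtrackI[of "map q r" "map q s"] by simp
  qed
  then have "congruent (loop_homotopy X x) (\<lambda>p. loop_class Y (q x) (map q p))"
    using loop_class_eq unfolding congruent_def by fastforce
  from UN_equiv_class[OF equiv_loop_homotopy this p] show ?thesis unfolding pi1_map_def .
qed

section \<open>Deck transformations and normality\<close>

text \<open>Regularity in terms of deck transformations: they move one vertex \<open>x\<close> to
  all vertices of its fibre. This form passes to components of products, to isomorphic copies and to
  intermediate quotients more easily than normality of a subgroup of \<open>pi1\<close>.\<close>

definition galois :: "('a, 'm) graph_scheme \<Rightarrow> ('b, 'n) graph_scheme \<Rightarrow> ('a \<Rightarrow> 'b) \<Rightarrow> bool" where
  "galois X Y q \<longleftrightarrow> finite_covering X Y q \<and> path_connected_graph X \<and> path_connected_graph Y \<and>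
     (\<exists>x\<in>verts X. \<forall>x'\<in>verts X. q x' = q x \<longrightarrow>
        (\<exists>\<tau>. graph_map X X \<tau> \<and> (\<forall>z\<in>points X. q (\<tau> z) = q z) \<and> \<tau> x = x'))"

text \<open>A loop \<open>s\<close> in \<open>Y\<close> lifts to a path \<open>s'\<close> from
  \<open>x\<close> to some \<open>x'\<close> in the same fibre. With the deck transformation
  \<open>\<tau>\<close> taking \<open>x\<close> to \<open>x'\<close>, the path \<open>s'\<close>,
  the image of the loop \<open>p\<close> under \<open>\<tau>\<close> and the reverse of
  \<open>s'\<close> form a loop at \<open>x\<close> lying over the conjugate by \<open>s\<close> of
  the image of \<open>p\<close>.\<close>

lemma galois_imp_regular:
  assumes "galois X Y q"
  shows "finite_regular_covering X Y q"
proof -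
  have fc: "finite_covering X Y q" and pc: "path_connected_graph X" "path_connected_graph Y"
    using assms unfolding galois_def by auto
  have X: "is_graph X" and Y: "is_graph Y" and lb: "locally_bijective X Y q"
    using fc unfolding finite_covering_def by auto
  note m = locally_bijective_map[OF lb]
  obtain x where x: "x \<in> verts X" and deck: "\<And>x'. x' \<in> verts X \<Longrightarrow> q x' = q x \<Longrightarrow>
      \<exists>\<tau>. graph_map X X \<tau> \<and> (\<forall>z\<in>points X. q (\<tau> z) = q z) \<and> \<tau> x = x'"
    using assms unfolding galois_def by auto
  let ?G = "pi1 Y (q x)" and ?c = "\<lambda>p. loop_class Y (q x) (map q p)"
  let ?N = "pi1_map Y q x ` carrier (pi1 X x)"
  have y: "q x \<in> verts Y" using graph_map_on(1)[OF m x] .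
  interpret group ?G by (rule group_pi1[OF Y y])
  have N: "?N = ?c ` loops X x"
    unfolding carrier_pi1 image_image by (rule image_cong) (use pi1_map_class[OF m] in auto)
  note lm = loops_map[OF m]
  have edges: "set p \<subseteq> edges X" if "p \<in> loops X x" for p
    using that by (simp add: loops_iff edge_path_edges)
  have invc: "inv\<^bsub>?G\<^esub> (?c p) = ?c (inv_path X p)" if "p \<in> loops X x" for p
    using inv_pi1[OF Y y lm[OF that]] map_inv_path[OF m edges[OF that]] by simp
  have "subgroup ?N ?G"
  proof (rule subgroupI)
    show "?N \<subseteq> carrier ?G" unfolding N unfolding carrier_pi1 using lm by auto
    have "[] \<in> loops X x" using x unfolding loops_def by simp
    then show "?N \<noteq> {}" unfolding N by blast
  next
    fix a assume "a \<in> ?N"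
    then show "inv\<^bsub>?G\<^esub> a \<in> ?N" unfolding N using invc loops_inv_path[OF X] by force
  next
    fix a b assume "a \<in> ?N" "b \<in> ?N"
    then obtain p r where "a = ?c p" "b = ?c r" "p \<in> loops X x" "r \<in> loops X x" unfolding N by blast
    then show "a \<otimes>\<^bsub>?G\<^esub> b \<in> ?N"
      unfolding N using mult_pi1[OF Y lm lm] loops_append[OF X] by (intro image_eqI[of _ _ "p @ r"]) auto
  qed
  moreover have "g \<otimes>\<^bsub>?G\<^esub> h \<otimes>\<^bsub>?G\<^esub> inv\<^bsub>?G\<^esub> g \<in> ?N" if gh: "g \<in> carrier ?G" "h \<in> ?N" for g h
  proof -
    obtain s where s: "s \<in> loops Y (q x)" "g = loop_class Y (q x) s" using gh unfolding carrier_pi1 by blast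
    obtain p where p: "p \<in> loops X x" "h = ?c p" using gh unfolding N by blast
    have "edge_path Y (q x) s (q x)" using s unfolding loops_def by simp
    then obtain s' x' where s': "edge_path X x s' x'" "map q s' = s" "q x' = q x"
      using edge_path_lift[OF lb X x] by blast
    obtain \<tau> where \<tau>: "graph_map X X \<tau>" "\<And>z. z \<in> points X \<Longrightarrow> q (\<tau> z) = q z" "\<tau> x = x'"
      using deck[OF edge_path_verts(2)[OF X s'(1)] s'(3)] by blast
    let ?l = "s' @ map \<tau> p @ inv_path X s'"
    have "map \<tau> p \<in> loops X x'" using loops_map[OF \<tau>(1) p(1)] \<tau>(3) by simp
    then have l: "?l \<in> loops X x"
      using s'(1) edge_path_inv[OF X s'(1)] unfolding loops_iff edge_path_append[OF X] by blast
    have "map q (map \<tau> p) = map q p" using edges[OF p(1)] \<tau>(2) by (auto simp: in_points_iff)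
    moreover have "map q (inv_path X s') = inv_path Y s"
      using map_inv_path[OF m edge_path_edges[OF s'(1)]] s'(2) by simp
    ultimately have ml: "map q ?l = (s @ map q p) @ inv_path Y s" using s'(2) by simp
    have "g \<otimes>\<^bsub>?G\<^esub> h \<otimes>\<^bsub>?G\<^esub> inv\<^bsub>?G\<^esub> g = ?c ?l"
      unfolding ml s(2) p(2) inv_pi1[OF Y y s(1)] mult_pi1[OF Y s(1) lm[OF p(1)]]
      by (rule mult_pi1[OF Y loops_append[OF Y s(1) lm[OF p(1)]] loops_inv_path[OF Y s(1)]])
    then show ?thesis unfolding N using l by blast
  qed
  ultimately have "normal ?N ?G" unfolding normal_inv_iff by blast
  then show ?thesis using fc pc x unfolding finite_regular_covering_def by blast
qed

lemma galois_cong: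
  assumes g: "galois X Y q" and eq: "\<And>x. x \<in> points X \<Longrightarrow> q' x = q x"
  shows "galois X Y q'"
proof -
  have X: "is_graph X" and Y: "is_graph Y" and lb: "locally_bijective X Y q"
    using g unfolding galois_def finite_covering_def by auto
  have ev: "q' x = q x" if "x \<in> verts X" for x using eq that unfolding in_points_iff by auto
  have ee: "q' x = q x" if "x \<in> edges X" for x using eq that unfolding in_points_iff by auto
  have "locally_bijective X Y q'"
  proof (rule locally_bijectiveI)
    show "graph_map X Y q'" by (rule graph_map_cong[OF X locally_bijective_map[OF lb] eq])
    show "e = e'" if "e \<in> edges X" "e' \<in> edges X" "source X e = source X e'" "q' e = q' e'" for e e'
      using locally_bijective_inj[OF lb X that(1-3)] that ee by simp
    show "\<exists>e'\<in>edges X. source X e' = v \<and> q' e' = e"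
      if "v \<in> verts X" "e \<in> edges Y" "source Y e = q' v" for v e
      using locally_bijective_ex[OF lb that(1,2)] that ee ev by simp
  qed
  moreover have "\<tau> z \<in> points X" if "graph_map X X \<tau>" "z \<in> points X" for \<tau> z using graph_map_on(3)[OF that] .
  ultimately show ?thesis using g ev eq unfolding galois_def finite_covering_def by (metis (no_types, lifting))
qed

text \<open>Deck transformations are conjugated by \<open>i\<close>; the isomorphism
  \<open>j\<close> is injective and so does not merge fibres.\<close>

lemma galois_transport:
  assumes g: "galois X Y q" and i: "graph_iso X' X i" and j: "graph_iso Y Y' j"
    and X': "is_graph X'" and Y': "is_graph Y'"
  shows "galois X' Y' (\<lambda>x. j (q (i x)))"
proof -
  have fc: "finite_covering X Y q" and pc: "path_connected_graph X" "path_connected_graph Y"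
    using g unfolding galois_def by auto
  have X: "is_graph X" and Y: "is_graph Y" and lb: "locally_bijective X Y q" and
    fin: "finite (points X)" "finite (points Y)"
    using fc unfolding finite_covering_def by auto
  obtain x where x: "x \<in> verts X" and deck: "\<And>x'. x' \<in> verts X \<Longrightarrow> q x' = q x \<Longrightarrow>
      \<exists>\<tau>. graph_map X X \<tau> \<and> (\<forall>z\<in>points X. q (\<tau> z) = q z) \<and> \<tau> x = x'"
    using g unfolding galois_def by auto
  let ?i = "inv_into (points X') i"
  have i': "graph_iso X X' ?i" by (rule graph_iso_inv[OF i X' X])
  note im = graph_onto_map[OF graph_iso_imp_onto[OF i]] and im' = graph_onto_map[OF graph_iso_imp_onto[OF i']]
  note bi = graph_iso_bij[OF i X] and bj = graph_iso_bij[OF j Y']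
  have ii: "?i (i z) = z" if "z \<in> points X'" for z using bij_betw_inv_into_left[OF bi that] .
  have ii': "i (?i z) = z" if "z \<in> points X" for z using bij_betw_inv_into_right[OF bi that] .
  have lb': "locally_bijective X' Y' (\<lambda>x. j (q (i x)))"
    by (rule locally_bijective_comp[OF locally_bijective_comp[OF locally_bijective_iso[OF i X' X] lb]
          locally_bijective_iso[OF j Y Y']])
  have "finite_covering X' Y' (\<lambda>x. j (q (i x)))"
    using lb' X' Y' fin bij_betw_finite[OF bi] bij_betw_finite[OF bj] unfolding finite_covering_def by simp
  moreover have "path_connected_graph X'" using path_connected_onto[OF graph_iso_imp_onto[OF i'] pc(1) X] .
  moreover have "path_connected_graph Y'" using path_connected_onto[OF graph_iso_imp_onto[OF j] pc(2) Y] .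
  moreover have "\<exists>\<tau>'. graph_map X' X' \<tau>' \<and> (\<forall>z\<in>points X'. j (q (i (\<tau>' z))) = j (q (i z))) \<and> \<tau>' (?i x) = x'"
    if x': "x' \<in> verts X'" "j (q (i x')) = j (q (i (?i x)))" for x'
  proof -
    have xp: "x \<in> points X" "x' \<in> points X'" using x x' by (auto simp: in_points_iff)
    have "q (i x') = q x"
      using x' bij_betw_imp_inj_on[OF bj] graph_map_on(3)[OF locally_bijective_map[OF lb]] graph_map_on(3)[OF im] xp
      unfolding ii'[OF xp(1)] inj_on_def by metis
    then obtain \<tau> where \<tau>: "graph_map X X \<tau>" "\<And>z. z \<in> points X \<Longrightarrow> q (\<tau> z) = q z" "\<tau> x = i x'"
      using deck graph_map_on(1)[OF im x'(1)] by metis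
    let ?t = "\<lambda>z. ?i (\<tau> (i z))"
    have "graph_map X' X' ?t" by (rule graph_map_comp[OF graph_map_comp[OF im \<tau>(1)] im'])
    moreover have "q (i (?t z)) = q (i z)" if "z \<in> points X'" for z
      using ii' \<tau>(2) graph_map_on(3)[OF im that] graph_map_on(3)[OF \<tau>(1)] by simp
    moreover have "?t (?i x) = x'" using ii' ii \<tau>(3) xp by simp
    ultimately show ?thesis by (intro exI[of _ ?t]) simp
  qed
  moreover have "?i x \<in> verts X'" using graph_map_on(1)[OF im' x] .
  ultimately show ?thesis unfolding galois_def by blast
qed

section \<open>Kernels and push-forwards\<close>

text \<open>Finite quotients are handled as functions and compared by their kernels; this makes
  refinement an inclusion and lets the value type vary.\<close>

definition ker :: "('a, 'm) graph_scheme \<Rightarrow> ('a \<Rightarrow> 'c) \<Rightarrow> ('a \<times> 'a) set" where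
  "ker G f = {(x, y) \<in> points G \<times> points G. f x = f y}"

lemma ker_iff: "(x, y) \<in> ker G f \<longleftrightarrow> x \<in> points G \<and> y \<in> points G \<and> f x = f y"
  unfolding ker_def by auto

lemma equiv_ker: "equiv (points G) (ker G f)"
  by (rule equivI) (auto simp: ker_def refl_on_def sym_def trans_def)

text \<open>All conditions are pulled back from \<open>X\<close>: a vertex and an edge have
  different images there, and so do an edge and its opposite.\<close>

lemma compatible_ker:
  assumes "graph_map G X k" "is_graph G" "is_graph X"
  shows "compatible G (ker G k)"
proof -
  note m = graph_map_on[OF assms(1)] and e = graph_edge[OF assms(2)] and e' = graph_edge[OF assms(3)]
  have "(v, e) \<notin> ker G k" if "v \<in> verts G" "e \<in> edges G" for v e
    using m(1)[OF that(1)] m(2)[OF that(2)] graph_disjoint[OF assms(3)] by (auto simp: ker_iff)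
  moreover have "(e, opp G e) \<notin> ker G k" if "e \<in> edges G" for e
    using m(6)[OF that] e'(5)[OF m(2)[OF that]] by (simp add: ker_iff)
  ultimately show ?thesis
    unfolding compatible_def using equiv_ker e m by (auto simp: ker_iff in_points_iff)
qed

lemma equiv_class_ker: "x \<in> points G \<Longrightarrow> ker G k `` {x} = {y \<in> points G. k y = k x}"
  by (auto simp: ker_iff)

lemma finite_quotient_ker:
  assumes "finite (k ` points G)"
  shows "finite (points G // ker G k)"
proof (rule finite_subset)
  show "points G // ker G k \<subseteq> (\<lambda>c. {y \<in> points G. k y = c}) ` (k ` points G)"
    unfolding quotient_def image_image by (auto simp: equiv_class_ker)
qed (use assms in simp)

lemma compatibleD:
  assumes "compatible G R"
  shows "equiv (points G) R" "v \<in> verts G \<Longrightarrow> e \<in> edges G \<Longrightarrow> (v, e) \<notin> R"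
    "e \<in> edges G \<Longrightarrow> e' \<in> edges G \<Longrightarrow> (e, e') \<in> R \<Longrightarrow> (source G e, source G e') \<in> R"
    "e \<in> edges G \<Longrightarrow> e' \<in> edges G \<Longrightarrow> (e, e') \<in> R \<Longrightarrow> (target G e, target G e') \<in> R"
    "e \<in> edges G \<Longrightarrow> e' \<in> edges G \<Longrightarrow> (e, e') \<in> R \<Longrightarrow> (opp G e, opp G e') \<in> R"
    "e \<in> edges G \<Longrightarrow> (e, opp G e) \<notin> R"
  using assms unfolding compatible_def by auto

lemma compatible_ker_pair:
  assumes "compatible G (ker G f)" "compatible G (ker G g)"
  shows "compatible G (ker G (\<lambda>x. (f x, g x)))"
proof -
  have k: "(x, y) \<in> ker G (\<lambda>x. (f x, g x)) \<longleftrightarrow> (x, y) \<in> ker G f \<and> (x, y) \<in> ker G g" for x y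
    by (auto simp: ker_iff)
  show ?thesis
    unfolding compatible_def k
    using compatibleD(2-6)[OF assms(1)] compatibleD(3-5)[OF assms(2)] by (auto intro: equiv_ker)
qed

text \<open>The quotient by \<open>ker G k\<close>, realised on the values of \<open>k\<close>
  instead of on classes. Operations on a value are computed from a chosen edge with this value; the
  choice does not matter when the kernel is compatible.\<close>

definition push_graph :: "('a, 'm) graph_scheme \<Rightarrow> ('a \<Rightarrow> 'c) \<Rightarrow> 'c graph" where
  "push_graph G k = \<lparr>verts = k ` verts G, edges = k ` edges G,
     source = (\<lambda>c. k (source G (inv_into (edges G) k c))),
     target = (\<lambda>c. k (target G (inv_into (edges G) k c))),
     opp = (\<lambda>c. k (opp G (inv_into (edges G) k c)))\<rparr>"

lemma push_graph_verts: "verts (push_graph G k) = k ` verts G" "edges (push_graph G k) = k ` edges G"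
  "points (push_graph G k) = k ` points G"
  by (auto simp: push_graph_def points_def)

lemma push_graph_onto:
  assumes G: "is_graph G" and c: "compatible G (ker G k)"
  shows "graph_onto G (push_graph G k) k"
proof -
  have "k (source G x) = source (push_graph G k) (k x) \<and> k (target G x) = target (push_graph G k) (k x) \<and>
        k (opp G x) = opp (push_graph G k) (k x)" if x: "x \<in> edges G" for x
  proof -
    let ?y = "inv_into (edges G) k (k x)"
    have y: "?y \<in> edges G" "k ?y = k x" using x by (auto intro: inv_into_into f_inv_into_f)
    then have "(x, ?y) \<in> ker G k" using x by (auto simp: ker_iff in_points_iff)
    then show ?thesis
      using compatibleD(3-5)[OF c x y(1)] by (simp add: ker_iff push_graph_def)
  qed
  then show ?thesis
    unfolding graph_onto_def graph_map_def by (auto simp: push_graph_verts)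
qed

lemma is_graph_image:
  assumes G: "is_graph G" and o: "graph_onto G H k" and c: "compatible G (ker G k)"
  shows "is_graph H"
proof -
  note e = graph_edge[OF G] and m = graph_map_on[OF graph_onto_map[OF o]]
  have "k v \<noteq> k e" if "v \<in> verts G" "e \<in> edges G" for v e
    using compatibleD(2)[OF c that] that by (auto simp: ker_iff in_points_iff)
  then have "verts H \<inter> edges H = {}" using graph_onto_vert[OF o] graph_onto_edge[OF o] by (metis disjoint_iff)
  moreover have "source H (k e) \<in> verts H \<and> target H (k e) \<in> verts H \<and> opp H (k e) \<in> edges H \<and>
        opp H (opp H (k e)) = k e \<and> opp H (k e) \<noteq> k e \<and>
        source H (opp H (k e)) = target H (k e) \<and> target H (opp H (k e)) = source H (k e)"
    if x: "e \<in> edges G" for e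
  proof -
    have "k e \<noteq> k (opp G e)" using compatibleD(6)[OF c x] e x by (auto simp: ker_iff in_points_iff)
    then show ?thesis
      using e[OF x] m(1)[OF e(1)[OF x]] m(1)[OF e(2)[OF x]] m(4-6)[OF x] m(2,4-6)[OF e(3)[OF x]] by simp
  qed
  ultimately show ?thesis unfolding is_graph_def using graph_onto_edge[OF o] by metis
qed

lemma is_graph_push_graph:
  assumes "is_graph G" "compatible G (ker G k)"
  shows "is_graph (push_graph G k)"
  by (rule is_graph_image[OF assms(1) push_graph_onto[OF assms] assms(2)])

text \<open>The isomorphism theorem: a quotient is determined by its kernel, so a value of
  \<open>f\<close> is sent to the value under \<open>g\<close> of any of its preimages.\<close>

lemma graph_iso_of_same_ker:
  assumes f: "graph_onto G H f" and g: "graph_onto G K g" and G: "is_graph G"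
    and ker: "\<And>x y. x \<in> points G \<Longrightarrow> y \<in> points G \<Longrightarrow> f x = f y \<longleftrightarrow> g x = g y"
  shows "\<exists>i. graph_iso H K i \<and> (\<forall>x\<in>points G. i (f x) = g x)"
proof (intro exI conjI ballI)
  let ?i = "\<lambda>y. g (inv_into (points G) f y)"
  show eq: "?i (f x) = g x" if "x \<in> points G" for x
    using ker[of "inv_into (points G) f (f x)" x] that
    by (simp add: f_inv_into_f inv_into_into)
  have m: "graph_map H K ?i" by (rule graph_onto_factor[OF f eq graph_onto_map[OF g] G])
  have "verts K \<subseteq> ?i ` verts H"
  proof
    fix y assume "y \<in> verts K"
    then obtain x where "x \<in> verts G" "y = g x" using graph_onto_vert[OF g] by blast
    then show "y \<in> ?i ` verts H" using eq[of x] graph_map_on(1)[OF graph_onto_map[OF f]]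
      by (metis image_eqI in_points_iff)
  qed
  moreover have "edges K \<subseteq> ?i ` edges H"
  proof
    fix y assume "y \<in> edges K"
    then obtain x where "x \<in> edges G" "y = g x" using graph_onto_edge[OF g] by blast
    then show "y \<in> ?i ` edges H" using eq[of x] graph_map_on(2)[OF graph_onto_map[OF f]]
      by (metis image_eqI in_points_iff)
  qed
  ultimately have o: "graph_onto H K ?i" using m unfolding graph_onto_def graph_map_def by blast
  have "inj_on ?i (points H)"
  proof (rule inj_onI)
    fix y z assume "y \<in> points H" "z \<in> points H" "?i y = ?i z"
    moreover obtain a b where "a \<in> points G" "b \<in> points G" "y = f a" "z = f b"
      using graph_onto_point[OF f] calculation by meson
    ultimately show "y = z" using eq ker by metis
  qed
  from graph_isoI[OF o this] show "graph_iso H K ?i" .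
qed

lemma quotient_graph_simps [simp]:
  "verts (quotient_graph G R) = verts G // R" "edges (quotient_graph G R) = edges G // R"
  "points (quotient_graph G R) = points G // R"
  by (auto simp: quotient_graph_def points_def quotient_def)

lemma quotient_graph_onto:
  assumes G: "is_graph G" and c: "compatible G R"
  shows "graph_onto G (quotient_graph G R) (\<lambda>x. R `` {x})"
proof -
  note eq = compatibleD(1)[OF c]
  \<comment> \<open>The class of an edge contains edges only, so compatibility applies to all of its
    members.\<close>
  have edge: "y \<in> edges G" if "(x, y) \<in> R" "x \<in> edges G" for x y
  proof -
    have "y \<in> points G" using that equiv_type[OF eq] by auto
    moreover have "(y, x) \<in> R" using equivE[OF eq] symD[OF _ that(1)] by metis
    ultimately have "y \<in> points G" "(y, x) \<in> R" .
    then show ?thesis using compatibleD(2)[OF c] that(2) unfolding in_points_iff by blast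
  qed
  \<comment> \<open>Members of the class of \<open>x\<close> have related images under
    \<open>f\<close>, so the union of the classes of these images is a single class. This is why
    \<open>quotient_graph\<close> can define its operations on whole classes.\<close>
  have *: "R `` (f ` (R `` {x})) = R `` {f x}" if x: "x \<in> edges G"
    and f: "\<And>y. y \<in> edges G \<Longrightarrow> (x, y) \<in> R \<Longrightarrow> (f x, f y) \<in> R" for f x
  proof -
    have "(x, x) \<in> R" using eq_equiv_class_iff[OF eq, of x x] x by (simp add: in_points_iff)
    moreover have "R `` {f y} = R `` {f x}" if "(x, y) \<in> R" for y
      using equiv_class_eq[OF eq f[OF edge[OF that x] that]] by simp
    ultimately show ?thesis by blast
  qed
  have "graph_map G (quotient_graph G R) (\<lambda>x. R `` {x})"
    by (rule graph_mapI) (use * compatibleD(3-5)[OF c] in \<open>auto simp: quotient_graph_def quotientI\<close>)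
  then show ?thesis unfolding graph_onto_def by (auto simp: quotient_def)
qed

lemma equiv_class_eq_iff_rel: "equiv A R \<Longrightarrow> x \<in> A \<Longrightarrow> y \<in> A \<Longrightarrow> R `` {x} = R `` {y} \<longleftrightarrow> (x, y) \<in> R"
  by (simp add: eq_equiv_class_iff)

lemma ker_equiv_class:
  assumes "equiv (points G) R"
  shows "ker G (\<lambda>x. R `` {x}) = R"
  using equiv_class_eq_iff_rel[OF assms] equiv_type[OF assms] by (auto simp: ker_iff)

lemma is_graph_quotient:
  assumes "is_graph G" "compatible G R"
  shows "is_graph (quotient_graph G R)"
  by (rule is_graph_image[OF assms(1) quotient_graph_onto[OF assms]])
    (simp add: ker_equiv_class compatibleD(1)[OF assms(2)] assms(2))

section \<open>Profinite graphs\<close>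

lemma cofinite_graphD:
  assumes "cofinite_graph G"
  shows "is_graph G" "uniformity_on (points G) (entourages G)" "\<Inter>(entourages G) = Id_on (points G)"
    "E \<in> entourages G \<Longrightarrow> \<exists>R. R \<subseteq> E \<and> compatible_cofinite_entourage G R"
  using assms unfolding cofinite_graph_def by auto

lemma cofinite_entourage:
  assumes "cofinite_graph G"
  shows "entourages G \<noteq> {}" "E \<in> entourages G \<Longrightarrow> E \<subseteq> points G \<times> points G"
    "E \<in> entourages G \<Longrightarrow> x \<in> points G \<Longrightarrow> (x, x) \<in> E"
    "E \<in> entourages G \<Longrightarrow> F \<in> entourages G \<Longrightarrow> E \<inter> F \<in> entourages G"
    "E \<in> entourages G \<Longrightarrow> E \<subseteq> F \<Longrightarrow> F \<subseteq> points G \<times> points G \<Longrightarrow> F \<in> entourages G"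
proof -
  note u' = cofinite_graphD(2)[OF assms, unfolded uniformity_on_def]
  note u = u'[THEN conjunct1] u'[THEN conjunct2, THEN conjunct1]
    u'[THEN conjunct2, THEN conjunct2, THEN conjunct1] u'[THEN conjunct2, THEN conjunct2, THEN conjunct2]
  show "entourages G \<noteq> {}" using u(1) .
  show "E \<subseteq> points G \<times> points G" if "E \<in> entourages G" using u(2) that by simp
  show "(x, x) \<in> E" if "E \<in> entourages G" "x \<in> points G"
  proof -
    have "Id_on (points G) \<subseteq> E" using u(2) that by simp
    then show ?thesis using that by auto
  qed
  show "E \<inter> F \<in> entourages G" if "E \<in> entourages G" "F \<in> entourages G" using u(3) that by simp
  show "F \<in> entourages G" if "E \<in> entourages G" "E \<subseteq> F" "F \<subseteq> points G \<times> points G"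
    using u(4) that by metis
qed

lemma cceD:
  assumes "compatible_cofinite_entourage G R"
  shows "R \<in> entourages G" "compatible G R" "finite (points G // R)" "equiv (points G) R"
  using assms unfolding compatible_cofinite_entourage_def compatible_def by auto

lemma cofinite_separated:
  assumes "cofinite_graph G" "x \<in> points G" "\<And>R. compatible_cofinite_entourage G R \<Longrightarrow> (x, y) \<in> R"
  shows "x = y"
proof -
  have "(x, y) \<in> \<Inter>(entourages G)" using cofinite_graphD(4)[OF assms(1)] assms(3) by blast
  then show ?thesis using cofinite_graphD(3)[OF assms(1)] by auto
qed

lemma profinite_graphD:
  assumes "profinite_graph G"
  shows "cofinite_graph G" "is_graph G" "compact_space (gtop G)"
  using assms cofinite_graphD unfolding profinite_graph_def by auto

lemma openin_gtop:
  assumes "cofinite_graph G"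
  shows "openin (gtop G) W \<longleftrightarrow> W \<subseteq> points G \<and> (\<forall>x\<in>W. \<exists>E\<in>entourages G. E `` {x} \<subseteq> W)"
  unfolding gtop_def by (rule openin_uniform_topology[OF cofinite_graphD(2)[OF assms]])

lemma topspace_gtop: "cofinite_graph G \<Longrightarrow> topspace (gtop G) = points G"
  unfolding gtop_def by (rule topspace_uniform_topology[OF cofinite_graphD(2)])

lemma cofinite_ker_comp:
  assumes "cofinite_graph G" "ker G f \<in> entourages G"
    "\<And>x y. x \<in> points G \<Longrightarrow> y \<in> points G \<Longrightarrow> f x = f y \<Longrightarrow> g x = g y"
  shows "ker G g \<in> entourages G"
  by (rule cofinite_entourage(5)[OF assms(1,2)]) (use assms(3) in \<open>auto simp: ker_iff\<close>)

lemma cofinite_ker_pair: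
  assumes "cofinite_graph G" "ker G f \<in> entourages G" "ker G g \<in> entourages G"
  shows "ker G (\<lambda>x. (f x, g x)) \<in> entourages G"
proof -
  have "ker G (\<lambda>x. (f x, g x)) = ker G f \<inter> ker G g" by (auto simp: ker_iff)
  then show ?thesis using cofinite_entourage(4)[OF assms] by simp
qed

text \<open>A function whose kernel is an entourage is locally constant, so every condition on its
  value is open, and by complementation closed.\<close>

lemma openin_fibres:
  assumes "cofinite_graph G" "ker G f \<in> entourages G"
  shows "openin (gtop G) {x \<in> points G. P (f x)}"
  unfolding openin_gtop[OF assms(1)]
proof (intro conjI ballI bexI[of _ "ker G f"])
  fix x assume "x \<in> {x \<in> points G. P (f x)}"
  then show "ker G f `` {x} \<subseteq> {x \<in> points G. P (f x)}" by (auto simp: ker_iff)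
qed (use assms in auto)

lemma closedin_fibres:
  assumes "cofinite_graph G" "ker G f \<in> entourages G"
  shows "closedin (gtop G) {x \<in> points G. P (f x)}"
proof -
  have "points G - {x \<in> points G. P (f x)} = {x \<in> points G. \<not> P (f x)}" by auto
  then show ?thesis
    unfolding closedin_def topspace_gtop[OF assms(1)] using openin_fibres[OF assms, of "\<lambda>c. \<not> P c"] by auto
qed

section \<open>Compactness arguments\<close>

lemma profinite_cover:
  assumes G: "profinite_graph G" and N: "\<And>x. x \<in> points G \<Longrightarrow> openin (gtop G) (N x) \<and> x \<in> N x"
  shows "\<exists>F. finite F \<and> F \<subseteq> points G \<and> points G \<subseteq> (\<Union>x\<in>F. N x)"
proof -
  note c = profinite_graphD(1)[OF G]
  have "\<exists>\<F>. finite \<F> \<and> \<F> \<subseteq> N ` points G \<and> points G \<subseteq> \<Union>\<F>"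
    using profinite_graphD(3)[OF G] N unfolding compact_space_alt topspace_gtop[OF c]
    by (elim allE[of _ "N ` points G"]) blast
  then show ?thesis using finite_subset_image by metis
qed

text \<open>A Lebesgue number argument: around each \<open>x\<close> the function is constant on the
  class of \<open>x\<close> for some equivalence relation \<open>R x\<close>. Finitely many of these
  classes cover, and an entourage inside the finitely many relations cannot leave the class in which
  it starts.\<close>

lemma profinite_locally_constant:
  assumes G: "profinite_graph G"
    and f: "\<And>x. x \<in> points G \<Longrightarrow> \<exists>E\<in>entourages G. \<forall>y. (x, y) \<in> E \<longrightarrow> f y = f x"
  shows "ker G f \<in> entourages G"
proof -
  note c = profinite_graphD(1)[OF G]
  have "\<exists>R. compatible_cofinite_entourage G R \<and> (\<forall>y. (x, y) \<in> R \<longrightarrow> f y = f x)" if "x \<in> points G" for x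
    using f[OF that] cofinite_graphD(4)[OF c] by blast
  then obtain R where R: "\<And>x. x \<in> points G \<Longrightarrow> compatible_cofinite_entourage G (R x)"
    "\<And>x y. x \<in> points G \<Longrightarrow> (x, y) \<in> R x \<Longrightarrow> f y = f x" by metis
  have "openin (gtop G) (R x `` {x}) \<and> x \<in> R x `` {x}" if x: "x \<in> points G" for x
  proof
    note r = cceD[OF R(1)[OF x]]
    have k: "ker G (\<lambda>y. R x `` {y}) = R x" by (rule ker_equiv_class[OF r(4)])
    have "R x `` {x} = {y \<in> points G. R x `` {y} = R x `` {x}}"
    proof (intro equalityI subsetI)
      fix y assume "y \<in> R x `` {x}"
      then show "y \<in> {y \<in> points G. R x `` {y} = R x `` {x}}"
        using equiv_type[OF r(4)] equiv_class_eq[OF r(4), of x y] by auto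
    next
      fix y assume y: "y \<in> {y \<in> points G. R x `` {y} = R x `` {x}}"
      then show "y \<in> R x `` {x}" using equiv_class_self[OF r(4), of y] by auto
    qed
    then show "openin (gtop G) (R x `` {x})"
      using openin_fibres[OF c, of "\<lambda>y. R x `` {y}" "\<lambda>A. A = R x `` {x}"] k r(1) by simp
    show "x \<in> R x `` {x}" using equiv_class_self[OF r(4) x] .
  qed
  then obtain F where F: "finite F" "F \<subseteq> points G" "points G \<subseteq> (\<Union>x\<in>F. R x `` {x})"
    using profinite_cover[OF G, of "\<lambda>x. R x `` {x}"] by blast
  have "\<exists>E\<in>entourages G. \<forall>x\<in>F. E \<subseteq> R x" using F(1,2)
  proof (induction F)
    case empty
    then show ?case using cofinite_entourage(1)[OF c] by auto
  next
    case (insert x F)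
    then obtain E where "E \<in> entourages G" "\<forall>x\<in>F. E \<subseteq> R x" by auto
    then show ?case using cofinite_entourage(4)[OF c, of E "R x"] cceD(1)[OF R(1)] insert by (intro bexI[of _ "E \<inter> R x"]) auto
  qed
  then obtain E where E: "E \<in> entourages G" "\<forall>x\<in>F. E \<subseteq> R x" by blast
  have "E \<subseteq> ker G f"
  proof (rule subrelI)
    fix y z assume yz: "(y, z) \<in> E"
    then have p: "y \<in> points G" "z \<in> points G" using cofinite_entourage(2)[OF c E(1)] by auto
    then obtain x where x: "x \<in> F" "(x, y) \<in> R x" using F(3) by blast
    then have xp: "x \<in> points G" using F(2) by auto
    have "(y, z) \<in> R x" using E(2) x yz by auto
    then have "(x, z) \<in> R x" using cceD(4)[OF R(1)[OF xp]] x(2) by (meson equivE transD)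
    then show "(y, z) \<in> ker G f" using R(2)[OF xp] x p by (simp add: ker_iff)
  qed
  then show ?thesis using cofinite_entourage(5)[OF c E(1)] by (auto simp: ker_def)
qed

text \<open>Directedness puts some \<open>C k\<close> inside every finite intersection, so nonempty
  single sets suffice. In this form compactness produces points of limits from solutions at the
  finite levels.\<close>

lemma directed_fip:
  assumes X: "compact_space X" and I: "I \<noteq> {}" and C: "\<And>i. i \<in> I \<Longrightarrow> closedin X (C i)" "\<And>i. i \<in> I \<Longrightarrow> C i \<noteq> {}"
    and dir: "\<And>i j. i \<in> I \<Longrightarrow> j \<in> I \<Longrightarrow> \<exists>k\<in>I. C k \<subseteq> C i \<inter> C j"
  shows "\<exists>x. \<forall>i\<in>I. x \<in> C i"
proof -
  have fin: "\<exists>k\<in>I. C k \<subseteq> \<Inter>(C ` F)" if "finite F" "F \<subseteq> I" for F using that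
  proof (induction F)
    case empty then show ?case using I by auto
  next
    case (insert i F)
    then obtain k where k: "k \<in> I" "C k \<subseteq> \<Inter>(C ` F)" by auto
    obtain l where "l \<in> I" "C l \<subseteq> C i \<inter> C k" using dir[of i k] k insert.prems by auto
    then show ?case using k by (intro bexI[of _ l]) auto
  qed
  have "\<Inter>(C ` I) \<noteq> {}"
  proof (rule X[unfolded compact_space_fip, rule_format], intro conjI ballI allI impI)
    fix \<F> assume "finite \<F> \<and> \<F> \<subseteq> C ` I"
    then obtain F where "finite F" "F \<subseteq> I" "\<F> = C ` F" by (meson finite_subset_image)
    moreover from this obtain k where "k \<in> I" "C k \<subseteq> \<Inter>(C ` F)" using fin by metis
    ultimately show "\<Inter>\<F> \<noteq> {}" using C(2)[of k] by auto
  qed (use C(1) in auto)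
  then show ?thesis by blast
qed

text \<open>For an equivalence relation \<open>R\<close> inside \<open>E\<close>, the class of
  \<open>h x\<close> is a locally constant function of \<open>x\<close>; by compactness of
  \<open>U\<close> its kernel is an entourage.\<close>

lemma uniformly_continuous_gtop:
  assumes U: "profinite_graph U" and G: "cofinite_graph G" and h: "continuous_map (gtop U) (gtop G) h"
    and E: "E \<in> entourages G"
  shows "\<exists>S\<in>entourages U. \<forall>x y. (x, y) \<in> S \<longrightarrow> (h x, h y) \<in> E"
proof -
  note cU = profinite_graphD(1)[OF U]
  obtain R where R: "R \<subseteq> E" "compatible_cofinite_entourage G R" using cofinite_graphD(4)[OF G E] by blast
  note r = cceD[OF R(2)] and eq = equiv_class_eq_iff_rel[OF cceD(4)[OF R(2)]]
  have hp: "h x \<in> points G" if "x \<in> points U" for x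
    using continuous_map_image_subset_topspace[OF h] that unfolding topspace_gtop[OF cU] topspace_gtop[OF G] by auto
  have k: "ker G (\<lambda>y. R `` {y}) \<in> entourages G" using ker_equiv_class[OF r(4)] r(1) by simp
  have "ker U (\<lambda>x. R `` {h x}) \<in> entourages U"
  proof (rule profinite_locally_constant[OF U])
    fix x assume x: "x \<in> points U"
    have "openin (gtop U) {y \<in> points U. h y \<in> {z \<in> points G. R `` {z} = R `` {h x}}}"
      using h openin_fibres[OF G k, of "\<lambda>A. A = R `` {h x}"] unfolding continuous_map topspace_gtop[OF cU] by blast
    then obtain S where S: "S \<in> entourages U" "S `` {x} \<subseteq> {y \<in> points U. h y \<in> {z \<in> points G. R `` {z} = R `` {h x}}}"
      using x hp[OF x] unfolding openin_gtop[OF cU] by blast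
    then show "\<exists>S\<in>entourages U. \<forall>y. (x, y) \<in> S \<longrightarrow> R `` {h y} = R `` {h x}" by (intro bexI[of _ S]) auto
  qed
  then show ?thesis
    using R(1) hp by (intro bexI[of _ "ker U (\<lambda>x. R `` {h x})"]) (auto simp: ker_iff eq)
qed

lemma continuous_gtopI:
  assumes U: "cofinite_graph U" and G: "cofinite_graph G" and h: "\<And>x. x \<in> points U \<Longrightarrow> h x \<in> points G"
    and uc: "\<And>E. E \<in> entourages G \<Longrightarrow> \<exists>S\<in>entourages U. \<forall>x y. (x, y) \<in> S \<longrightarrow> (h x, h y) \<in> E"
  shows "continuous_map (gtop U) (gtop G) h"
  unfolding continuous_map topspace_gtop[OF U] topspace_gtop[OF G]
proof (intro conjI allI impI)
  show "h ` points U \<subseteq> points G" using h by auto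
  fix W assume W: "openin (gtop G) W"
  show "openin (gtop U) {x \<in> points U. h x \<in> W}"
    unfolding openin_gtop[OF U]
  proof (intro conjI ballI)
    fix x assume x: "x \<in> {x \<in> points U. h x \<in> W}"
    then obtain E where E: "E \<in> entourages G" "E `` {h x} \<subseteq> W" using W unfolding openin_gtop[OF G] by blast
    obtain S where S: "S \<in> entourages U" "\<And>x y. (x, y) \<in> S \<Longrightarrow> (h x, h y) \<in> E" using uc[OF E(1)] by blast
    have "S `` {x} \<subseteq> {x \<in> points U. h x \<in> W}"
      using S(2) E(2) cofinite_entourage(2)[OF U S(1)] by blast
    then show "\<exists>S\<in>entourages U. S `` {x} \<subseteq> {x \<in> points U. h x \<in> W}" using S(1) by blast
  qed auto
qed

lemma cofinite_ker_preimage: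
  assumes U: "cofinite_graph U" and h: "\<And>x. x \<in> points U \<Longrightarrow> h x \<in> points G"
    and uc: "\<exists>S\<in>entourages U. \<forall>x y. (x, y) \<in> S \<longrightarrow> (h x, h y) \<in> ker G f"
  shows "ker U (\<lambda>x. f (h x)) \<in> entourages U"
proof -
  obtain S where S: "S \<in> entourages U" "\<And>x y. (x, y) \<in> S \<Longrightarrow> (h x, h y) \<in> ker G f" using uc by blast
  show ?thesis
  proof (rule cofinite_entourage(5)[OF U S(1)])
    show "S \<subseteq> ker U (\<lambda>x. f (h x))"
      using S(2) cofinite_entourage(2)[OF U S(1)] by (fastforce simp: ker_iff)
  qed (auto simp: ker_def)
qed

section \<open>Connectedness and finite images\<close>

lemma cce_ker:
  assumes "graph_map G X k" "is_graph G" "is_graph X" "finite (points X)" "ker G k \<in> entourages G"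
  shows "compatible_cofinite_entourage G (ker G k)"
proof -
  have "finite (k ` points G)"
    by (rule finite_subset[OF _ assms(4)]) (use graph_map_on(3)[OF assms(1)] in auto)
  then show ?thesis
    unfolding compatible_cofinite_entourage_def
    using compatible_ker[OF assms(1-3)] finite_quotient_ker assms(5) by auto
qed

text \<open>\<open>X\<close> is a copy of the quotient by the kernel of \<open>k\<close>, and that
  quotient is one of those in the definition of connectedness.\<close>

lemma connected_imp_path_connected:
  assumes conn: "connected_ugraph G" and k: "graph_onto G X k" and G: "is_graph G" and X: "is_graph X" "finite (points X)"
    and ker: "ker G k \<in> entourages G"
  shows "path_connected_graph X"
proof -
  let ?R = "ker G k"
  have cce: "compatible_cofinite_entourage G ?R" by (rule cce_ker[OF graph_onto_map[OF k] G X ker])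
  note c = cceD[OF cce]
  have pc: "path_connected_graph (quotient_graph G ?R)" using conn cce unfolding connected_ugraph_def by blast
  have "\<exists>i. graph_iso (quotient_graph G ?R) X i \<and> (\<forall>x\<in>points G. i (?R `` {x}) = k x)"
    by (rule graph_iso_of_same_ker[OF quotient_graph_onto[OF G c(2)] k G])
      (simp add: equiv_class_eq_iff_rel[OF c(4)] ker_iff)
  then show ?thesis
    using path_connected_onto[OF graph_iso_imp_onto pc is_graph_quotient[OF G c(2)]] by blast
qed

text \<open>A path connected image with kernel inside \<open>R\<close> maps onto the quotient by
  \<open>R\<close>, so it suffices to have arbitrarily fine ones.\<close>

lemma connected_ugraphI:
  assumes G: "cofinite_graph G"
    and k: "\<And>R. R \<in> entourages G \<Longrightarrow> \<exists>k (X :: 'x graph). graph_onto G X k \<and> is_graph X \<and> path_connected_graph X \<and> ker G k \<subseteq> R"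
  shows "connected_ugraph G"
  unfolding connected_ugraph_def
proof (intro allI impI)
  fix R assume "compatible_cofinite_entourage G R"
  note R = cceD[OF this] and gG = cofinite_graphD(1)[OF G]
  obtain k and X :: "'x graph" where k: "graph_onto G X k" "is_graph X" "path_connected_graph X" "ker G k \<subseteq> R"
    using k[OF R(1)] by blast
  let ?Q = "quotient_graph G R" and ?m = "\<lambda>c. R `` {inv_into (points G) k c}"
  note o = quotient_graph_onto[OF gG R(2)]
  have eq: "?m (k x) = R `` {x}" if x: "x \<in> points G" for x
  proof -
    have "inv_into (points G) k (k x) \<in> points G" "k (inv_into (points G) k (k x)) = k x"
      using x by (auto intro: inv_into_into f_inv_into_f)
    then have "(inv_into (points G) k (k x), x) \<in> R" using k(4) x by (auto simp: ker_iff subset_iff)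
    then show ?thesis by (rule equiv_class_eq[OF R(4)])
  qed
  have "graph_map X ?Q ?m" by (rule graph_onto_factor[OF k(1) eq graph_onto_map[OF o] gG])
  moreover have "\<exists>y\<in>verts X. c = ?m y" if "c \<in> verts ?Q" for c
    using graph_onto_vert[OF o that] eq graph_map_on(1)[OF graph_onto_map[OF k(1)]] by (metis in_points_iff)
  moreover have "\<exists>y\<in>edges X. c = ?m y" if "c \<in> edges ?Q" for c
    using graph_onto_edge[OF o that] eq graph_map_on(2)[OF graph_onto_map[OF k(1)]] by (metis in_points_iff)
  ultimately have "graph_onto X ?Q ?m" by (rule graph_ontoI)
  then show "path_connected_graph ?Q" by (rule path_connected_onto[OF _ k(3,2)])
qed

text \<open>The image of \<open>U\<close> under the pair of \<open>f\<close> and \<open>g\<close> is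
  a finite graph, path connected because \<open>U\<close> is connected. Its two coordinate
  projections are lifts of the same map and agree at the image of \<open>u\<close>, so uniqueness
  for path connected graphs applies.\<close>

lemma profinite_lifts_agree:
  assumes U: "cofinite_graph U" "connected_ugraph U"
    and f: "graph_map U Z f" "ker U f \<in> entourages U" and g: "graph_map U Z g" "ker U g \<in> entourages U"
    and r: "locally_bijective Z Y r" and Z: "is_graph Z" "finite (points Z)"
    and eq: "\<And>x. x \<in> points U \<Longrightarrow> r (f x) = r (g x)" and u: "u \<in> verts U" "f u = g u" and x: "x \<in> points U"
  shows "f x = g x"
proof -
  let ?k = "\<lambda>x. (f x, g x)"
  let ?X = "push_graph U ?k"
  note gU = cofinite_graphD(1)[OF U(1)]
  have "compatible U (ker U ?k)"
    by (rule compatible_ker_pair[OF compatible_ker[OF f(1) gU Z(1)] compatible_ker[OF g(1) gU Z(1)]])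
  note X = push_graph_onto[OF gU this] is_graph_push_graph[OF gU this]
  have "?k ` points U \<subseteq> points Z \<times> points Z"
    using graph_map_on(3)[OF f(1)] graph_map_on(3)[OF g(1)] by auto
  then have fin: "finite (points ?X)" unfolding push_graph_verts using Z(2) finite_subset by blast
  have pc: "path_connected_graph ?X"
    by (rule connected_imp_path_connected[OF U(2) X(1) gU X(2) fin cofinite_ker_pair[OF U(1) f(2) g(2)]])
  have fst: "graph_map ?X Z fst" by (rule graph_onto_factor[OF X(1) _ f(1) gU]) simp
  have snd: "graph_map ?X Z snd" by (rule graph_onto_factor[OF X(1) _ g(1) gU]) simp
  have eq': "r (fst z) = r (snd z)" if "z \<in> points ?X" for z
    using that eq unfolding push_graph_verts by auto
  have "?k u \<in> verts ?X" "?k x \<in> points ?X"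
    unfolding push_graph_verts by (rule imageI[OF u(1)], rule imageI[OF x])
  from lifts_agree[OF fst snd r Z(1) eq' _ X(2) pc this] have "fst (?k x) = snd (?k x)"
    using u(2) by simp
  then show ?thesis by simp
qed

section \<open>Presentations as inverse limits\<close>

lemma directed_upper_bound:
  assumes d: "directed I leq" and F: "finite F" "F \<subseteq> I"
  shows "\<exists>k\<in>I. \<forall>i\<in>F. (i, k) \<in> leq"
  using F
proof (induction F)
  case empty then show ?case using d unfolding directed_def by auto
next
  case (insert i F)
  then obtain k where k: "k \<in> I" "\<forall>i\<in>F. (i, k) \<in> leq" by auto
  obtain l where l: "l \<in> I" "(i, l) \<in> leq" "(k, l) \<in> leq"
    using d k insert.prems unfolding directed_def by (metis insert_subset)
  have "trans leq" using d unfolding directed_def preorder_on_def by simp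
  then show ?case using k l by (intro bexI[of _ l]) (auto dest: transD)
qed

lemma inverse_limit_simps [simp]:
  "source (inverse_limit I leq G \<phi>) = (\<lambda>x. \<lambda>i\<in>I. source (G i) (x i))"
  "target (inverse_limit I leq G \<phi>) = (\<lambda>x. \<lambda>i\<in>I. target (G i) (x i))"
  "opp (inverse_limit I leq G \<phi>) = (\<lambda>x. \<lambda>i\<in>I. opp (G i) (x i))"
  by (auto simp: inverse_limit_def)

lemma inverse_limit_verts:
  "x \<in> verts (inverse_limit I leq G \<phi>) \<longleftrightarrow> x \<in> extensional I \<and> (\<forall>i\<in>I. x i \<in> verts (G i)) \<and> (\<forall>(i, j)\<in>leq. \<phi> i j (x j) = x i)"
  by (auto simp: inverse_limit_def PiE_def Pi_def)

lemma inverse_limit_edges: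
  "x \<in> edges (inverse_limit I leq G \<phi>) \<longleftrightarrow> x \<in> extensional I \<and> (\<forall>i\<in>I. x i \<in> edges (G i)) \<and> (\<forall>(i, j)\<in>leq. \<phi> i j (x j) = x i)"
  by (auto simp: inverse_limit_def PiE_def Pi_def)

lemma inverse_limit_points:
  assumes "x \<in> points (inverse_limit I leq G \<phi>)"
  shows "x \<in> extensional I" "i \<in> I \<Longrightarrow> x i \<in> points (G i)" "(i, j) \<in> leq \<Longrightarrow> \<phi> i j (x j) = x i"
  using assms unfolding in_points_iff inverse_limit_verts inverse_limit_edges by auto

section \<open>Projections of a given inverse limit and maps into it\<close>

context
  fixes \<Gamma> :: "'a ugraph" and I :: "'i set" and leq and G :: "'i \<Rightarrow> 'b graph" and \<phi> \<alpha>
  assumes pro: "profinite_graph \<Gamma>" and sys: "inverse_system I leq G \<phi>" and iso: "limit_iso \<Gamma> I leq G \<phi> \<alpha>"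
begin

lemma limit_directed: "directed I leq" and limit_level: "i \<in> I \<Longrightarrow> is_graph (G i)" "i \<in> I \<Longrightarrow> finite (points (G i))"
  using sys unfolding inverse_system_def by auto

lemma limit_graph_map: "graph_map \<Gamma> (inverse_limit I leq G \<phi>) \<alpha>"
  using iso unfolding limit_iso_def graph_iso_def by simp

lemma limit_map: "i \<in> I \<Longrightarrow> graph_map \<Gamma> (G i) (\<lambda>x. \<alpha> x i)"
  using graph_map_on[OF limit_graph_map] unfolding inverse_limit_verts inverse_limit_edges
  by (intro graph_mapI) auto

lemma limit_coherent: "x \<in> points \<Gamma> \<Longrightarrow> (i, j) \<in> leq \<Longrightarrow> \<phi> i j (\<alpha> x j) = \<alpha> x i"
  using graph_map_on(3)[OF limit_graph_map] inverse_limit_points by fast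

lemma limit_separated:
  assumes "x \<in> points \<Gamma>" "y \<in> points \<Gamma>" "\<And>i. i \<in> I \<Longrightarrow> \<alpha> x i = \<alpha> y i"
  shows "x = y"
proof -
  obtain i where i: "i \<in> I" using limit_directed unfolding directed_def by auto
  have e: "\<alpha> x \<in> extensional I" "\<alpha> y \<in> extensional I"
    using graph_map_on(3)[OF limit_graph_map] inverse_limit_points(1) assms by fast+
  then have "\<alpha> x = \<alpha> y" using assms(3) by (rule extensionalityI)
  \<comment> \<open>\<open>graph_iso\<close> gives injectivity on vertices and on edges separately;
    a single level decides that both points are of the same kind.\<close>
  moreover have "x \<in> verts \<Gamma> \<longleftrightarrow> y \<in> verts \<Gamma>"
    using graph_map_vertex[OF limit_map[OF i] limit_level(1)[OF i]] graph_map_on(1)[OF limit_map[OF i]] assms i by metis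
  moreover have "inj_on \<alpha> (verts \<Gamma>)" "inj_on \<alpha> (edges \<Gamma>)"
    using iso unfolding limit_iso_def graph_iso_def bij_betw_def by auto
  ultimately show ?thesis using assms(1,2) unfolding in_points_iff inj_on_def by blast
qed

text \<open>The projection to a finite discrete graph is continuous, hence locally constant, and
  compactness makes its kernel an entourage.\<close>

lemma limit_ker:
  assumes i: "i \<in> I"
  shows "ker \<Gamma> (\<lambda>x. \<alpha> x i) \<in> entourages \<Gamma>"
proof (rule profinite_locally_constant[OF pro])
  note c = profinite_graphD(1)[OF pro]
  have "continuous_map (gtop \<Gamma>) (limit_topology I leq G \<phi>) \<alpha>"
    using iso unfolding limit_iso_def by (simp add: homeomorphic_imp_continuous_map)
  then have "continuous_map (gtop \<Gamma>) (discrete_topology (points (G i))) (\<lambda>x. \<alpha> x i)"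
    using i unfolding limit_topology_def continuous_map_in_subtopology continuous_map_componentwise by simp
  moreover fix x assume x: "x \<in> points \<Gamma>"
  have "openin (discrete_topology (points (G i))) {\<alpha> x i}" using graph_map_on(3)[OF limit_map[OF i] x] by simp
  ultimately have "openin (gtop \<Gamma>) {y \<in> points \<Gamma>. \<alpha> y i \<in> {\<alpha> x i}}"
    unfolding continuous_map topspace_gtop[OF c] by blast
  then obtain E where "E \<in> entourages \<Gamma>" "E `` {x} \<subseteq> {y \<in> points \<Gamma>. \<alpha> y i \<in> {\<alpha> x i}}"
    using x unfolding openin_gtop[OF c] by auto
  then show "\<exists>E\<in>entourages \<Gamma>. \<forall>y. (x, y) \<in> E \<longrightarrow> \<alpha> y i = \<alpha> x i" by (intro bexI[of _ E]) auto
qed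

text \<open>Compactness is used twice. For a fixed \<open>x\<close>, some level separates it from
  all points outside its \<open>R\<close>-class; otherwise the points that agree with
  \<open>x\<close> at a level and lie outside the class would form a directed family of nonempty
  closed sets with a common point, which could only be \<open>x\<close>. Finitely many such
  neighbourhoods cover \<Gamma>, and an upper bound of their levels serves for all points.\<close>

lemma limit_cofinal:
  assumes E: "E \<in> entourages \<Gamma>"
  shows "\<exists>i\<in>I. ker \<Gamma> (\<lambda>x. \<alpha> x i) \<subseteq> E"
proof -
  note c = profinite_graphD(1)[OF pro]
  obtain R where R: "R \<subseteq> E" "compatible_cofinite_entourage \<Gamma> R" using cofinite_graphD(4)[OF c E] by blast
  note r = cceD[OF R(2)]
  have kR: "ker \<Gamma> (\<lambda>x. R `` {x}) = R" by (rule ker_equiv_class[OF r(4)])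
  have "\<exists>i\<in>I. \<forall>y\<in>points \<Gamma>. \<alpha> y i = \<alpha> x i \<longrightarrow> (x, y) \<in> R" if x: "x \<in> points \<Gamma>" for x
  proof (rule ccontr)
    assume neg: "\<not> ?thesis"
    define C where "C i = {y \<in> points \<Gamma>. \<alpha> y i = \<alpha> x i \<and> R `` {y} \<noteq> R `` {x}}" for i
    have "\<exists>y. \<forall>i\<in>I. y \<in> C i"
    proof (rule directed_fip[OF profinite_graphD(3)[OF pro]])
      show "I \<noteq> {}" using limit_directed unfolding directed_def by simp
      fix i assume i: "i \<in> I"
      show "closedin (gtop \<Gamma>) (C i)"
        using closedin_fibres[OF c cofinite_ker_pair[OF c limit_ker[OF i], of "\<lambda>x. R `` {x}"],
            of "\<lambda>(a, b). a = \<alpha> x i \<and> b \<noteq> R `` {x}"] r(1)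
        unfolding C_def kR by simp
      obtain y where y: "y \<in> points \<Gamma>" "\<alpha> y i = \<alpha> x i" "(x, y) \<notin> R" using neg i by blast
      then have "R `` {y} \<noteq> R `` {x}" using equiv_class_eq_iff_rel[OF r(4) x y(1)] by metis
      then have "y \<in> C i" unfolding C_def using y by simp
      then show "C i \<noteq> {}" by blast
      fix j assume j: "j \<in> I"
      obtain k where k: "k \<in> I" "(i, k) \<in> leq" "(j, k) \<in> leq" using limit_directed i j unfolding directed_def by blast
      have "C k \<subseteq> C i \<inter> C j" unfolding C_def
        using limit_coherent[OF x k(2)] limit_coherent[OF x k(3)] limit_coherent[OF _ k(2)] limit_coherent[OF _ k(3)]
        by auto metis+
      then show "\<exists>k\<in>I. C k \<subseteq> C i \<inter> C j" using k(1) by blast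
    qed
    then obtain y where y: "\<And>i. i \<in> I \<Longrightarrow> y \<in> C i" by blast
    obtain i where "i \<in> I" using limit_directed unfolding directed_def by auto
    then have "y \<in> points \<Gamma>" "R `` {y} \<noteq> R `` {x}" using y unfolding C_def by auto
    moreover have "y = x" using limit_separated[OF calculation(1) x] y unfolding C_def by auto
    ultimately show False by simp
  qed
  then obtain i where i: "\<And>x. x \<in> points \<Gamma> \<Longrightarrow> i x \<in> I"
    "\<And>x y. x \<in> points \<Gamma> \<Longrightarrow> y \<in> points \<Gamma> \<Longrightarrow> \<alpha> y (i x) = \<alpha> x (i x) \<Longrightarrow> (x, y) \<in> R" by metis
  have "openin (gtop \<Gamma>) {y \<in> points \<Gamma>. \<alpha> y (i x) = \<alpha> x (i x)} \<and> x \<in> {y \<in> points \<Gamma>. \<alpha> y (i x) = \<alpha> x (i x)}"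
    if "x \<in> points \<Gamma>" for x
    using openin_fibres[OF c limit_ker[OF i(1)[OF that]], of "\<lambda>a. a = \<alpha> x (i x)"] that by simp
  from profinite_cover[OF pro this] obtain F where
    F: "finite F" "F \<subseteq> points \<Gamma>" "points \<Gamma> \<subseteq> (\<Union>x\<in>F. {y \<in> points \<Gamma>. \<alpha> y (i x) = \<alpha> x (i x)})" by blast
  obtain k where k: "k \<in> I" "\<And>x. x \<in> F \<Longrightarrow> (i x, k) \<in> leq"
    using directed_upper_bound[OF limit_directed, of "i ` F"] F(1,2) i(1) by blast
  have "ker \<Gamma> (\<lambda>x. \<alpha> x k) \<subseteq> R"
  proof (rule subrelI)
    fix y z assume "(y, z) \<in> ker \<Gamma> (\<lambda>x. \<alpha> x k)"
    then have yz: "y \<in> points \<Gamma>" "z \<in> points \<Gamma>" "\<alpha> y k = \<alpha> z k" by (auto simp: ker_iff)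
    obtain x where x: "x \<in> F" "\<alpha> y (i x) = \<alpha> x (i x)" using F(3) yz(1) by blast
    then have xp: "x \<in> points \<Gamma>" using F(2) by blast
    have "\<alpha> y (i x) = \<alpha> z (i x)" using limit_coherent[OF _ k(2)[OF x(1)]] yz by metis
    then have "(x, y) \<in> R" "(x, z) \<in> R" using i(2)[OF xp] yz x(2) by auto
    then show "(y, z) \<in> R" using r(4) by (meson equivE symD transD)
  qed
  then show ?thesis using k(1) R(1) by blast
qed

text \<open>The universal property of the limit. Equations between points of \<Gamma> are checked in
  the coordinates, continuity through the cofinal kernels.\<close>

lemma limit_lift:
  assumes U: "cofinite_graph U"
    and h: "\<And>i. i \<in> I \<Longrightarrow> graph_map U (G i) (h i)" "\<And>i. i \<in> I \<Longrightarrow> ker U (h i) \<in> entourages U"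
    and co: "\<And>i j x. (i, j) \<in> leq \<Longrightarrow> x \<in> points U \<Longrightarrow> \<phi> i j (h j x) = h i x"
  shows "\<exists>k. graph_map U \<Gamma> k \<and> continuous_map (gtop U) (gtop \<Gamma>) k \<and> (\<forall>x\<in>points U. \<forall>i\<in>I. \<alpha> (k x) i = h i x)"
proof -
  note gU = cofinite_graphD(1)[OF U] and c = profinite_graphD(1)[OF pro] and gG = profinite_graphD(2)[OF pro]
  let ?L = "inverse_limit I leq G \<phi>" and ?h = "\<lambda>x. \<lambda>i\<in>I. h i x"
  have leqI: "i \<in> I \<and> j \<in> I" if "(i, j) \<in> leq" for i j
    using limit_directed that unfolding directed_def preorder_on_def by auto
  have v: "?h x \<in> verts ?L" if "x \<in> verts U" for x
    unfolding inverse_limit_verts using that graph_map_on(1)[OF h(1)] co leqI by (auto simp: in_points_iff)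
  have e: "?h x \<in> edges ?L" if "x \<in> edges U" for x
    unfolding inverse_limit_edges using that graph_map_on(2)[OF h(1)] co leqI by (auto simp: in_points_iff)
  have bij: "bij_betw \<alpha> (verts \<Gamma>) (verts ?L)" "bij_betw \<alpha> (edges \<Gamma>) (edges ?L)"
    using iso unfolding limit_iso_def graph_iso_def by auto
  have "\<exists>y\<in>verts \<Gamma>. \<alpha> y = ?h x" if "x \<in> verts U" for x
    using v[OF that] bij(1) unfolding bij_betw_def by (metis imageE)
  moreover have "\<exists>y\<in>edges \<Gamma>. \<alpha> y = ?h x" if "x \<in> edges U" for x
    using e[OF that] bij(2) unfolding bij_betw_def by (metis imageE)
  \<comment> \<open>Preimages under \<open>\<alpha>\<close> are chosen among vertices for vertices
    and among edges for edges, because \<open>\<alpha>\<close> is bijective on each kind.\<close>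
  ultimately have "\<exists>y. \<alpha> y = ?h x \<and> (x \<in> verts U \<longrightarrow> y \<in> verts \<Gamma>) \<and> (x \<in> edges U \<longrightarrow> y \<in> edges \<Gamma>)" if "x \<in> points U" for x
    using that graph_disjoint[OF gU] unfolding in_points_iff by metis
  then obtain k where k: "\<And>x. x \<in> points U \<Longrightarrow> \<alpha> (k x) = ?h x" "\<And>x. x \<in> verts U \<Longrightarrow> k x \<in> verts \<Gamma>"
    "\<And>x. x \<in> edges U \<Longrightarrow> k x \<in> edges \<Gamma>" unfolding in_points_iff by metis
  have kp: "k x \<in> points \<Gamma>" if "x \<in> points U" for x using that k(2,3) unfolding in_points_iff by blast
  have ki: "\<alpha> (k x) i = h i x" if "x \<in> points U" "i \<in> I" for x i using k(1) that by simp
  have "graph_map U \<Gamma> k"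
  proof (rule graph_mapI)
    fix x assume x: "x \<in> edges U"
    note ex = graph_edge[OF gU x] and ek = graph_edge[OF gG k(3)[OF x]]
    have p: "x \<in> points U" "source U x \<in> points U" "target U x \<in> points U" "opp U x \<in> points U"
      "source \<Gamma> (k x) \<in> points \<Gamma>" "target \<Gamma> (k x) \<in> points \<Gamma>" "opp \<Gamma> (k x) \<in> points \<Gamma>"
      using x ex ek by (auto simp: in_points_iff)
    show "k (source U x) = source \<Gamma> (k x)"
      using graph_map_on(4)[OF h(1) x] graph_map_on(4)[OF limit_map k(3)[OF x]] ki p
      by (intro limit_separated kp) auto
    show "k (target U x) = target \<Gamma> (k x)"
      using graph_map_on(5)[OF h(1) x] graph_map_on(5)[OF limit_map k(3)[OF x]] ki p
      by (intro limit_separated kp) auto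
    show "k (opp U x) = opp \<Gamma> (k x)"
      using graph_map_on(6)[OF h(1) x] graph_map_on(6)[OF limit_map k(3)[OF x]] ki p
      by (intro limit_separated kp) auto
  qed (use k in auto)
  moreover have "continuous_map (gtop U) (gtop \<Gamma>) k"
  proof (rule continuous_gtopI[OF U c kp])
    fix E assume "E \<in> entourages \<Gamma>"
    then obtain i where i: "i \<in> I" "ker \<Gamma> (\<lambda>x. \<alpha> x i) \<subseteq> E" using limit_cofinal by blast
    then show "\<exists>S\<in>entourages U. \<forall>x y. (x, y) \<in> S \<longrightarrow> (k x, k y) \<in> E"
      using h(2)[OF i(1)] ki kp by (intro bexI[of _ "ker U (h i)"]) (auto simp: ker_iff subset_iff)
  qed
  ultimately show ?thesis using ki by blast
qed

end

section \<open>Inverse limits from directed families of kernels\<close>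

text \<open>A converse to the preceding facts: the levels are the images under
  \<open>\<kappa> i\<close>, and the bonding maps do not depend on the chosen preimages because
  kernels shrink along \<open>leq\<close>. Cofinality gives injectivity, compactness surjectivity,
  and a continuous bijection from a compact space to a Hausdorff space is a homeomorphism.\<close>

lemma limit_iso_kernels:
  fixes \<Gamma> :: "'a ugraph" and \<kappa> :: "'i \<Rightarrow> 'a \<Rightarrow> 'b"
  assumes pro: "profinite_graph \<Gamma>" and dir: "directed I leq"
    and comp: "\<And>i. i \<in> I \<Longrightarrow> compatible \<Gamma> (ker \<Gamma> (\<kappa> i))" and ent: "\<And>i. i \<in> I \<Longrightarrow> ker \<Gamma> (\<kappa> i) \<in> entourages \<Gamma>"
    and fin: "\<And>i. i \<in> I \<Longrightarrow> finite (\<kappa> i ` points \<Gamma>)"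
    and mono: "\<And>i j. (i, j) \<in> leq \<Longrightarrow> ker \<Gamma> (\<kappa> j) \<subseteq> ker \<Gamma> (\<kappa> i)"
    and cofinal: "\<And>E. E \<in> entourages \<Gamma> \<Longrightarrow> \<exists>i\<in>I. ker \<Gamma> (\<kappa> i) \<subseteq> E"
  defines "G \<equiv> \<lambda>i. push_graph \<Gamma> (\<kappa> i)" and "\<phi> \<equiv> \<lambda>i j c. \<kappa> i (inv_into (points \<Gamma>) (\<kappa> j) c)"
  shows "inverse_system I leq G \<phi>" "limit_iso \<Gamma> I leq G \<phi> (\<lambda>x. \<lambda>i\<in>I. \<kappa> i x)"
    "\<And>i j x. (i, j) \<in> leq \<Longrightarrow> x \<in> points \<Gamma> \<Longrightarrow> \<phi> i j (\<kappa> j x) = \<kappa> i x"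
proof -
  note c = profinite_graphD(1)[OF pro] and g = profinite_graphD(2)[OF pro]
  have leqI: "i \<in> I \<and> j \<in> I" if "(i, j) \<in> leq" for i j
    using dir that unfolding directed_def preorder_on_def by auto
  have onto: "graph_onto \<Gamma> (G i) (\<kappa> i)" "is_graph (G i)" if "i \<in> I" for i
    using push_graph_onto[OF g comp] is_graph_push_graph[OF g comp] that unfolding G_def by auto
  note map = graph_map_on[OF graph_onto_map[OF onto(1)]]
  have pts: "points (G i) = \<kappa> i ` points \<Gamma>" for i unfolding G_def push_graph_verts ..
  show phi: "\<phi> i j (\<kappa> j x) = \<kappa> i x" if "(i, j) \<in> leq" "x \<in> points \<Gamma>" for i j x
  proof -
    have "inv_into (points \<Gamma>) (\<kappa> j) (\<kappa> j x) \<in> points \<Gamma>" "\<kappa> j (inv_into (points \<Gamma>) (\<kappa> j) (\<kappa> j x)) = \<kappa> j x"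
      using that by (auto intro: inv_into_into f_inv_into_f)
    then have "(inv_into (points \<Gamma>) (\<kappa> j) (\<kappa> j x), x) \<in> ker \<Gamma> (\<kappa> j)" using that by (simp add: ker_iff)
    then have "(inv_into (points \<Gamma>) (\<kappa> j) (\<kappa> j x), x) \<in> ker \<Gamma> (\<kappa> i)" using mono[OF that(1)] by auto
    then show ?thesis unfolding \<phi>_def by (simp add: ker_iff)
  qed
  have refl: "(i, i) \<in> leq" if "i \<in> I" for i using dir that unfolding directed_def preorder_on_def refl_on_def by auto
  have tr: "trans leq" using dir unfolding directed_def preorder_on_def by auto
  show "inverse_system I leq G \<phi>"
    unfolding inverse_system_def
  proof (intro conjI ballI allI impI dir, safe)
    fix i j assume ij: "(i, j) \<in> leq"
    show "graph_map (G j) (G i) (\<phi> i j)"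
      using leqI[OF ij] by (intro graph_onto_factor[OF onto(1) phi[OF ij] graph_onto_map[OF onto(1)] g]) auto
    fix k assume "(j, k) \<in> leq"
    moreover from this ij have "(i, k) \<in> leq" using tr by (meson transD)
    moreover fix x assume "x \<in> points (G k)"
    ultimately show "\<phi> i j (\<phi> j k x) = \<phi> i k x" unfolding pts using phi ij by auto
  next
    fix i x assume "i \<in> I" "x \<in> points (G i)"
    then show "\<phi> i i x = x" unfolding pts using phi[OF refl] by auto
  qed (use onto(2) fin pts in auto)
  let ?L = "inverse_limit I leq G \<phi>" and ?a = "\<lambda>x. \<lambda>i\<in>I. \<kappa> i x"
  have av: "?a x \<in> verts ?L" if "x \<in> verts \<Gamma>" for x
    unfolding inverse_limit_verts using that map(1) phi leqI by (auto simp: in_points_iff)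
  have ae: "?a x \<in> edges ?L" if "x \<in> edges \<Gamma>" for x
    unfolding inverse_limit_edges using that map(2) phi leqI by (auto simp: in_points_iff)
  have am: "graph_map \<Gamma> ?L ?a"
    by (rule graph_mapI) (use av ae map(4-6) in \<open>auto simp: restrict_def\<close>)
  \<comment> \<open>A coherent family \<open>z\<close> prescribes nonempty closed fibres
    \<open>C i\<close> that decrease along \<open>leq\<close>; a common point of them maps to
    \<open>z\<close>.\<close>
  have surj: "\<exists>x\<in>points \<Gamma>. ?a x = z" if z: "z \<in> points ?L" for z
  proof -
    define C where "C i = {x \<in> points \<Gamma>. \<kappa> i x = z i}" for i
    note zc = inverse_limit_points[OF z]
    have "\<exists>x. \<forall>i\<in>I. x \<in> C i"
    proof (rule directed_fip[OF profinite_graphD(3)[OF pro]])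
      show "I \<noteq> {}" using dir unfolding directed_def by simp
      fix i assume i: "i \<in> I"
      show "closedin (gtop \<Gamma>) (C i)"
        using closedin_fibres[OF c ent[OF i], of "\<lambda>a. a = z i"] unfolding C_def by simp
      show "C i \<noteq> {}" using zc(2)[OF i] unfolding C_def pts by auto
      fix j assume j: "j \<in> I"
      obtain k where k: "k \<in> I" "(i, k) \<in> leq" "(j, k) \<in> leq" using dir i j unfolding directed_def by blast
      have "C k \<subseteq> C i \<inter> C j" unfolding C_def
        using phi[OF k(2)] phi[OF k(3)] zc(3)[OF k(2)] zc(3)[OF k(3)] by auto metis+
      then show "\<exists>k\<in>I. C k \<subseteq> C i \<inter> C j" using k(1) by blast
    qed
    then obtain x where x: "\<And>i. i \<in> I \<Longrightarrow> x \<in> C i" by blast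
    obtain i where "i \<in> I" using dir unfolding directed_def by auto
    then have "x \<in> points \<Gamma>" using x unfolding C_def by auto
    moreover have "?a x = z"
      by (rule extensionalityI[OF _ zc(1)]) (use x in \<open>auto simp: C_def\<close>)
    ultimately show ?thesis by blast
  qed
  have inj: "inj_on ?a (points \<Gamma>)"
  proof (rule inj_onI)
    fix x y assume xy: "x \<in> points \<Gamma>" "y \<in> points \<Gamma>" "?a x = ?a y"
    show "x = y"
    proof (rule cofinite_separated[OF c xy(1)])
      fix R assume "compatible_cofinite_entourage \<Gamma> R"
      then obtain i where "i \<in> I" "ker \<Gamma> (\<kappa> i) \<subseteq> R" using cofinal cceD(1) by blast
      moreover have "\<kappa> i x = \<kappa> i y" if "i \<in> I" for i using xy(3) that by (metis restrict_apply')
      ultimately show "(x, y) \<in> R" using xy by (auto simp: ker_iff subset_iff)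
    qed
  qed
  obtain i0 where i0: "i0 \<in> I" using dir unfolding directed_def by auto
  \<comment> \<open>Whether a preimage is a vertex or an edge is already visible at the level
    \<open>i0\<close>.\<close>
  have "x \<in> verts \<Gamma>" if "x \<in> points \<Gamma>" "?a x \<in> verts ?L" for x
    using graph_map_vertex[OF graph_onto_map[OF onto(1)[OF i0]] onto(2)[OF i0] that(1)] that(2) i0
    unfolding inverse_limit_verts by auto
  moreover have "x \<in> edges \<Gamma>" if "x \<in> points \<Gamma>" "?a x \<in> edges ?L" for x
    using graph_map_edge[OF graph_onto_map[OF onto(1)[OF i0]] onto(2)[OF i0] that(1)] that(2) i0
    unfolding inverse_limit_edges by auto
  ultimately have "verts ?L \<subseteq> ?a ` verts \<Gamma>" "edges ?L \<subseteq> ?a ` edges \<Gamma>"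
    using surj unfolding in_points_iff[of _ ?L] by (auto simp: image_iff) metis+
  then have ao: "graph_onto \<Gamma> ?L ?a" using am av ae unfolding graph_onto_def by blast
  have "homeomorphic_map (gtop \<Gamma>) (limit_topology I leq G \<phi>) ?a"
  proof (rule continuous_imp_homeomorphic_map)
    have "points ?L \<subseteq> Pi\<^sub>E I (\<lambda>i. points (G i))"
    proof
      fix z assume "z \<in> points ?L"
      from inverse_limit_points[OF this] show "z \<in> Pi\<^sub>E I (\<lambda>i. points (G i))" by (simp add: PiE_iff)
    qed
    then have top: "topspace (limit_topology I leq G \<phi>) = points ?L"
      unfolding limit_topology_def by auto
    show "compact_space (gtop \<Gamma>)" by (rule profinite_graphD(3)[OF pro])
    show "Hausdorff_space (limit_topology I leq G \<phi>)"
      unfolding limit_topology_def by (intro Hausdorff_space_subtopology) (simp add: Hausdorff_space_product_topology)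
    show "?a ` topspace (gtop \<Gamma>) = topspace (limit_topology I leq G \<phi>)"
      unfolding topspace_gtop[OF c] top using graph_onto_points[OF ao] .
    show "inj_on ?a (topspace (gtop \<Gamma>))" using inj unfolding topspace_gtop[OF c] .
    have "continuous_map (gtop \<Gamma>) (discrete_topology (points (G i))) (\<lambda>x. ?a x i)" if i: "i \<in> I" for i
      unfolding continuous_map topspace_gtop[OF c]
      using i openin_fibres[OF c ent[OF i]] by (auto simp: pts)
    then show "continuous_map (gtop \<Gamma>) (limit_topology I leq G \<phi>) ?a"
      unfolding limit_topology_def continuous_map_in_subtopology continuous_map_componentwise topspace_gtop[OF c]
      using graph_map_on(3)[OF am] by auto
  qed
  then show "limit_iso \<Gamma> I leq G \<phi> ?a"
    unfolding limit_iso_def using graph_isoI[OF ao inj] by simp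
qed

section \<open>Profinite coverings\<close>

lemma regular_imp_profinite_covering:
  "regular_profinite_covering \<Gamma> \<Delta> f \<Longrightarrow> profinite_covering \<Gamma> \<Delta> f"
  unfolding regular_profinite_covering_def profinite_covering_def pro_map_def finite_regular_covering_def
  by metis

text \<open>
  A map with arbitrarily fine levels is the inverse limit of its levels, so it is a regular covering.
\<close>

definition level ::
    "'a ugraph \<Rightarrow> 'b ugraph \<Rightarrow> ('a \<Rightarrow> 'b) \<Rightarrow> ('a \<Rightarrow> 'x) \<Rightarrow> 'x graph \<Rightarrow> ('b \<Rightarrow> 'y) \<Rightarrow> 'y graph \<Rightarrow> ('x \<Rightarrow> 'y) \<Rightarrow> bool" where
  "level \<Gamma> \<Delta> f k X d Y r \<longleftrightarrow> galois X Y r \<and> graph_onto \<Gamma> X k \<and> graph_onto \<Delta> Y d \<and>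
     ker \<Gamma> k \<in> entourages \<Gamma> \<and> ker \<Delta> d \<in> entourages \<Delta> \<and> (\<forall>x\<in>points \<Gamma>. r (k x) = d (f x))"

lemma levelD:
  assumes "level \<Gamma> \<Delta> f k X d Y r"
  shows "galois X Y r" "graph_onto \<Gamma> X k" "graph_onto \<Delta> Y d" "ker \<Gamma> k \<in> entourages \<Gamma>"
    "ker \<Delta> d \<in> entourages \<Delta>" "x \<in> points \<Gamma> \<Longrightarrow> r (k x) = d (f x)"
  using assms unfolding level_def by auto

lemma galoisD:
  assumes "galois X Y r"
  shows "is_graph X" "is_graph Y" "finite (points X)" "finite (points Y)" "locally_bijective X Y r"
    "path_connected_graph X" "path_connected_graph Y"
  using assms unfolding galois_def finite_covering_def by auto

text \<open>The classes are numbered because the finite graphs in an inverse system for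
  \<open>pro_map\<close> have their points in \<open>nat\<close>.\<close>

definition label :: "('a, 'm) graph_scheme \<Rightarrow> ('a \<times> 'a) set \<Rightarrow> 'a \<Rightarrow> nat" where
  "label G R x = to_nat_on (points G // R) (R `` {x})"

lemma ker_label:
  assumes "compatible_cofinite_entourage G R"
  shows "ker G (label G R) = R"
proof -
  note r = cceD[OF assms]
  have "inj_on (to_nat_on (points G // R)) (points G // R)"
    by (rule inj_on_to_nat_on) (simp add: countable_finite r(3))
  then have "label G R x = label G R y \<longleftrightarrow> R `` {x} = R `` {y}" if "x \<in> points G" "y \<in> points G" for x y
    unfolding label_def inj_on_def using that quotientI by metis
  then have "(x, y) \<in> ker G (label G R) \<longleftrightarrow> (x, y) \<in> ker G (\<lambda>x. R `` {x})" for x y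
    unfolding ker_iff by blast
  then have "ker G (label G R) = ker G (\<lambda>x. R `` {x})" by (simp add: set_eq_iff)
  then show ?thesis using ker_equiv_class[OF r(4)] by simp
qed

lemma finite_label: "finite (points G // R) \<Longrightarrow> finite (label G R ` points G)"
proof (rule finite_subset)
  show "label G R ` points G \<subseteq> to_nat_on (points G // R) ` (points G // R)"
    unfolding label_def by (auto intro: quotientI)
qed simp

text \<open>The given levels live in arbitrary types and do not fit into the index type, so an index
  keeps only their kernels. At each index the graphs are rebuilt on numbered classes, and the Galois
  property is moved to them along the isomorphisms between quotients with equal kernels.\<close>

lemma regular_profinite_coveringI:
  fixes \<Gamma> :: "'a ugraph" and \<Delta> :: "'b ugraph"
  assumes \<Gamma>: "profinite_graph \<Gamma>" and \<Delta>: "profinite_graph \<Delta>" and f: "\<And>x. x \<in> points \<Gamma> \<Longrightarrow> f x \<in> points \<Delta>"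
    and levels: "\<And>S R. S \<in> entourages \<Gamma> \<Longrightarrow> R \<in> entourages \<Delta> \<Longrightarrow>
      \<exists>k (X :: 'x graph) d (Y :: 'y graph) r. level \<Gamma> \<Delta> f k X d Y r \<and> ker \<Gamma> k \<subseteq> S \<and> ker \<Delta> d \<subseteq> R"
  shows "regular_profinite_covering \<Gamma> \<Delta> f"
proof -
  note c = profinite_graphD(1)[OF \<Gamma>] profinite_graphD(1)[OF \<Delta>]
  note g = profinite_graphD(2)[OF \<Gamma>] profinite_graphD(2)[OF \<Delta>]
  \<comment> \<open>An index records the pair of kernels of one level, with the constant
    \<open>0\<close> as its \<open>nat\<close> entry.\<close>
  define I :: "('a, 'b) sys_index set" where
    "I = {(0, S, R) | S R. \<exists>k (X :: 'x graph) d (Y :: 'y graph) r. level \<Gamma> \<Delta> f k X d Y r \<and> S = ker \<Gamma> k \<and> R = ker \<Delta> d}"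
  define leq where "leq = {(i, j) \<in> I \<times> I. fst (snd j) \<subseteq> fst (snd i) \<and> snd (snd j) \<subseteq> snd (snd i)}"
  define \<kappa> where "\<kappa> i = label \<Gamma> (fst (snd i))" for i :: "('a, 'b) sys_index"
  define \<mu> where "\<mu> i = label \<Delta> (snd (snd i))" for i :: "('a, 'b) sys_index"
  have IE: "\<exists>k (X :: 'x graph) d (Y :: 'y graph) r. level \<Gamma> \<Delta> f k X d Y r \<and> fst (snd i) = ker \<Gamma> k \<and> snd (snd i) = ker \<Delta> d"
    if "i \<in> I" for i using that unfolding I_def by fastforce
  have cce: "compatible_cofinite_entourage \<Gamma> (fst (snd i)) \<and> compatible_cofinite_entourage \<Delta> (snd (snd i))" if i: "i \<in> I" for i
  proof -
    obtain k d r and X :: "'x graph" and Y :: "'y graph"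
      where l: "level \<Gamma> \<Delta> f k X d Y r" "fst (snd i) = ker \<Gamma> k" "snd (snd i) = ker \<Delta> d" using IE[OF i] by blast
    note gal = galoisD[OF levelD(1)[OF l(1)]]
    show ?thesis unfolding l(2,3)
      using cce_ker[OF graph_onto_map[OF levelD(2)[OF l(1)]] g(1) gal(1,3) levelD(4)[OF l(1)]]
        cce_ker[OF graph_onto_map[OF levelD(3)[OF l(1)]] g(2) gal(2,4) levelD(5)[OF l(1)]] by simp
  qed
  have k1: "ker \<Gamma> (\<kappa> i) = fst (snd i)" and k2: "ker \<Delta> (\<mu> i) = snd (snd i)" if "i \<in> I" for i
    unfolding \<kappa>_def \<mu>_def using ker_label cce[OF that] by auto
  have fin: "finite (\<kappa> i ` points \<Gamma>)" "finite (\<mu> i ` points \<Delta>)" if "i \<in> I" for i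
    unfolding \<kappa>_def \<mu>_def using cce[OF that] finite_label cceD(3) by auto
  \<comment> \<open>Pairs of kernels become arbitrarily fine on both sides at once; this gives upper
    bounds as well as cofinality in both graphs.\<close>
  have below: "\<exists>i\<in>I. fst (snd i) \<subseteq> S \<and> snd (snd i) \<subseteq> R" if SR: "S \<in> entourages \<Gamma>" "R \<in> entourages \<Delta>" for S R
  proof -
    obtain k d r and X :: "'x graph" and Y :: "'y graph"
      where l: "level \<Gamma> \<Delta> f k X d Y r" "ker \<Gamma> k \<subseteq> S" "ker \<Delta> d \<subseteq> R" using levels[OF SR] by blast
    have I: "(0, ker \<Gamma> k, ker \<Delta> d) \<in> I"
      unfolding I_def mem_Collect_eq using l(1) by (intro exI conjI) (rule refl, assumption, rule refl, rule refl)
    show ?thesis by (rule bexI[OF _ I]) (simp add: l(2,3))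
  qed
  obtain S0 R0 where SR0: "S0 \<in> entourages \<Gamma>" "R0 \<in> entourages \<Delta>"
    using cofinite_entourage(1)[OF c(1)] cofinite_entourage(1)[OF c(2)] by blast
  have dir: "directed I leq"
    unfolding directed_def
  proof (intro conjI ballI)
    show "I \<noteq> {}" using below[OF SR0] by blast
    show "preorder_on I leq" unfolding preorder_on_def leq_def by (auto simp: refl_on_def trans_def)
    fix i j assume ij: "i \<in> I" "j \<in> I"
    have "fst (snd i) \<inter> fst (snd j) \<in> entourages \<Gamma>" "snd (snd i) \<inter> snd (snd j) \<in> entourages \<Delta>"
      using cce[OF ij(1)] cce[OF ij(2)]
      by (auto intro!: cofinite_entourage(4)[OF c(1)] cofinite_entourage(4)[OF c(2)] dest: cceD(1))
    from below[OF this] obtain k where "k \<in> I" "fst (snd k) \<subseteq> fst (snd i) \<inter> fst (snd j)"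
      "snd (snd k) \<subseteq> snd (snd i) \<inter> snd (snd j)" by metis
    then show "\<exists>k\<in>I. (i, k) \<in> leq \<and> (j, k) \<in> leq" unfolding leq_def using ij by (intro bexI[of _ k]) auto
  qed
  have leqI: "i \<in> I" "j \<in> I" "fst (snd j) \<subseteq> fst (snd i)" "snd (snd j) \<subseteq> snd (snd i)" if "(i, j) \<in> leq" for i j
    using that unfolding leq_def by auto
  define G where "G i = push_graph \<Gamma> (\<kappa> i)" for i
  define D where "D i = push_graph \<Delta> (\<mu> i)" for i
  define \<phi> where "\<phi> i j x = \<kappa> i (inv_into (points \<Gamma>) (\<kappa> j) x)" for i j x
  define \<psi> where "\<psi> i j x = \<mu> i (inv_into (points \<Delta>) (\<mu> j) x)" for i j x
  define q where "q i x = \<mu> i (f (inv_into (points \<Gamma>) (\<kappa> i) x))" for i x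
  have comp: "compatible \<Gamma> (ker \<Gamma> (\<kappa> i))" "compatible \<Delta> (ker \<Delta> (\<mu> i))"
    "ker \<Gamma> (\<kappa> i) \<in> entourages \<Gamma>" "ker \<Delta> (\<mu> i) \<in> entourages \<Delta>" if "i \<in> I" for i
    using cce[OF that] k1[OF that] k2[OF that] cceD by auto
  have m1: "ker \<Gamma> (\<kappa> j) \<subseteq> ker \<Gamma> (\<kappa> i)" and m2: "ker \<Delta> (\<mu> j) \<subseteq> ker \<Delta> (\<mu> i)" if "(i, j) \<in> leq" for i j
    using leqI[OF that] k1 k2 by auto
  have cof: "E \<in> entourages \<Gamma> \<Longrightarrow> \<exists>i\<in>I. ker \<Gamma> (\<kappa> i) \<subseteq> E" "F \<in> entourages \<Delta> \<Longrightarrow> \<exists>i\<in>I. ker \<Delta> (\<mu> i) \<subseteq> F" for E F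
    using below[of E R0] below[of S0 F] SR0 k1 k2 by auto
  have GD: "G = (\<lambda>i. push_graph \<Gamma> (\<kappa> i))" "D = (\<lambda>i. push_graph \<Delta> (\<mu> i))"
    "\<phi> = (\<lambda>i j c. \<kappa> i (inv_into (points \<Gamma>) (\<kappa> j) c))" "\<psi> = (\<lambda>i j c. \<mu> i (inv_into (points \<Delta>) (\<mu> j) c))"
    by (auto simp: G_def D_def \<phi>_def \<psi>_def fun_eq_iff)
  have L1: "inverse_system I leq G \<phi>" "limit_iso \<Gamma> I leq G \<phi> (\<lambda>x. \<lambda>i\<in>I. \<kappa> i x)"
    "(i, j) \<in> leq \<Longrightarrow> x \<in> points \<Gamma> \<Longrightarrow> \<phi> i j (\<kappa> j x) = \<kappa> i x" for i j x
    unfolding GD by (rule limit_iso_kernels[OF \<Gamma> dir]; use comp(1,3) fin(1) m1 cof(1) in blast)+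
  have L2: "inverse_system I leq D \<psi>" "limit_iso \<Delta> I leq D \<psi> (\<lambda>x. \<lambda>i\<in>I. \<mu> i x)"
    "(i, j) \<in> leq \<Longrightarrow> x \<in> points \<Delta> \<Longrightarrow> \<psi> i j (\<mu> j x) = \<mu> i x" for i j x
    unfolding GD by (rule limit_iso_kernels[OF \<Delta> dir]; use comp(2,4) fin(2) m2 cof(2) in blast)+
  have onto: "graph_onto \<Gamma> (G i) (\<kappa> i)" "graph_onto \<Delta> (D i) (\<mu> i)" "is_graph (G i)" "is_graph (D i)" if "i \<in> I" for i
    unfolding G_def D_def using push_graph_onto is_graph_push_graph g comp[OF that] by auto
  have regular: "finite_regular_covering (G i) (D i) (q i) \<and> (\<forall>x\<in>points \<Gamma>. q i (\<kappa> i x) = \<mu> i (f x))" if i: "i \<in> I" for i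
  proof -
    obtain k d r and X :: "'x graph" and Y :: "'y graph"
      where l: "level \<Gamma> \<Delta> f k X d Y r" "fst (snd i) = ker \<Gamma> k" "snd (snd i) = ker \<Delta> d" using IE[OF i] by blast
    note lv = levelD[OF l(1)]
    note gal = galoisD[OF lv(1)]
    have e1: "\<kappa> i x = \<kappa> i y \<longleftrightarrow> k x = k y" if "x \<in> points \<Gamma>" "y \<in> points \<Gamma>" for x y
      using that k1[OF i] l(2) ker_iff[of x y \<Gamma> "\<kappa> i"] ker_iff[of x y \<Gamma> k] by simp
    have e2: "d x = d y \<longleftrightarrow> \<mu> i x = \<mu> i y" if "x \<in> points \<Delta>" "y \<in> points \<Delta>" for x y
      using that k2[OF i] l(3) ker_iff[of x y \<Delta> "\<mu> i"] ker_iff[of x y \<Delta> d] by simp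
    \<comment> \<open>The value does not depend on the chosen preimage: \<open>\<kappa> i\<close>
      has the kernel of \<open>k\<close>, and \<open>d\<close> after \<open>f\<close> factors
      through \<open>k\<close> by means of \<open>r\<close>.\<close>
    have q: "q i (\<kappa> i x) = \<mu> i (f x)" if x: "x \<in> points \<Gamma>" for x
    proof -
      let ?y = "inv_into (points \<Gamma>) (\<kappa> i) (\<kappa> i x)"
      have y: "?y \<in> points \<Gamma>" "\<kappa> i ?y = \<kappa> i x" using x by (auto intro: inv_into_into f_inv_into_f)
      then have "d (f ?y) = d (f x)" using e1[OF y(1) x] lv(6)[OF x] lv(6)[OF y(1)] by simp
      then show ?thesis unfolding q_def using e2 f x y(1) by blast
    qed
    obtain a where a: "graph_iso (G i) X a" "\<And>x. x \<in> points \<Gamma> \<Longrightarrow> a (\<kappa> i x) = k x"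
      using graph_iso_of_same_ker[OF onto(1)[OF i] lv(2) g(1) e1] by blast
    obtain b where b: "graph_iso Y (D i) b" "\<And>x. x \<in> points \<Delta> \<Longrightarrow> b (d x) = \<mu> i x"
      using graph_iso_of_same_ker[OF lv(3) onto(2)[OF i] g(2) e2] by blast
    have "galois (G i) (D i) (\<lambda>x. b (r (a x)))"
      by (rule galois_transport[OF lv(1) a(1) b(1) onto(3,4)[OF i]])
    then have "galois (G i) (D i) (q i)"
    proof (rule galois_cong)
      fix x assume "x \<in> points (G i)"
      then obtain y where "y \<in> points \<Gamma>" "x = \<kappa> i y" using graph_onto_point[OF onto(1)[OF i]] by blast
      then show "q i x = b (r (a x))" using q a(2) b(2) lv(6) f by simp
    qed
    then show ?thesis using galois_imp_regular q by blast
  qed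
  have "inverse_system_of_maps I leq G \<phi> D \<psi> q"
    unfolding inverse_system_of_maps_def
  proof (intro conjI ballI)
    show "inverse_system I leq G \<phi>" by (rule L1(1))
    show "inverse_system I leq D \<psi>" by (rule L2(1))
    show "graph_map (G i) (D i) (q i)" if "i \<in> I" for i
      using regular[OF that] unfolding finite_regular_covering_def finite_covering_def locally_bijective_def by simp
    fix z assume "z \<in> leq"
    then obtain i j where ij: "z = (i, j)" "(i, j) \<in> leq" by (cases z) auto
    have "q i (\<phi> i j x) = \<psi> i j (q j x)" if x: "x \<in> points (G j)" for x
    proof -
      obtain y where y: "y \<in> points \<Gamma>" "x = \<kappa> j y"
        using graph_onto_point[OF onto(1)[OF leqI(2)[OF ij(2)]] x] by blast
      have "\<phi> i j (\<kappa> j y) = \<kappa> i y" by (rule L1(3)[OF ij(2) y(1)])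
      moreover have "\<psi> i j (\<mu> j (f y)) = \<mu> i (f y)" by (rule L2(3)[OF ij(2) f[OF y(1)]])
      ultimately show ?thesis using regular leqI[OF ij(2)] y by simp
    qed
    then show "case z of (i, j) \<Rightarrow> \<forall>x\<in>points (G j). q i (\<phi> i j x) = \<psi> i j (q j x)" using ij by simp
  qed
  moreover have "limit_iso \<Gamma> I leq G \<phi> (\<lambda>x. \<lambda>i\<in>I. \<kappa> i x)" by (rule L1(2))
  moreover have "limit_iso \<Delta> I leq D \<psi> (\<lambda>x. \<lambda>i\<in>I. \<mu> i x)" by (rule L2(2))
  moreover have "\<forall>x\<in>points \<Gamma>. \<forall>i\<in>I. (\<lambda>i\<in>I. \<mu> i (f x)) i = q i ((\<lambda>i\<in>I. \<kappa> i x) i)"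
    using regular by simp
  moreover have "f ` points \<Gamma> \<subseteq> points \<Delta>" using f by auto
  moreover have "\<forall>i\<in>I. finite_regular_covering (G i) (D i) (q i)" using regular by blast
  ultimately show ?thesis
    unfolding regular_profinite_covering_def pro_map_def using \<Gamma> \<Delta> by blast
qed

section \<open>The map underlying a profinite covering\<close>

lemma profinite_coveringE:
  fixes \<Gamma> :: "'a ugraph" and \<Delta> :: "'b ugraph"
  assumes "profinite_covering \<Gamma> \<Delta> f"
  obtains I :: "('a, 'b) sys_index set" and leq and G D :: "('a, 'b) sys_index \<Rightarrow> nat graph" and \<phi> \<psi> q \<alpha> \<beta> where
    "inverse_system I leq G \<phi>" "inverse_system I leq D \<psi>"
    "limit_iso \<Gamma> I leq G \<phi> \<alpha>" "limit_iso \<Delta> I leq D \<psi> \<beta>"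
    "\<And>i. i \<in> I \<Longrightarrow> finite_covering (G i) (D i) (q i)"
    "\<And>i x. i \<in> I \<Longrightarrow> x \<in> points \<Gamma> \<Longrightarrow> q i (\<alpha> x i) = \<beta> (f x) i"
    "\<And>i j x. (i, j) \<in> leq \<Longrightarrow> x \<in> points (G j) \<Longrightarrow> q i (\<phi> i j x) = \<psi> i j (q j x)"
proof -
  have "\<exists>(I :: ('a, 'b) sys_index set) leq (G :: _ \<Rightarrow> nat graph) \<phi> (D :: _ \<Rightarrow> nat graph) \<psi> q \<alpha> \<beta>.
        inverse_system_of_maps I leq G \<phi> D \<psi> q \<and> (\<forall>i\<in>I. finite_covering (G i) (D i) (q i)) \<and>
        limit_iso \<Gamma> I leq G \<phi> \<alpha> \<and> limit_iso \<Delta> I leq D \<psi> \<beta> \<and>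
        (\<forall>x\<in>points \<Gamma>. \<forall>i\<in>I. \<beta> (f x) i = q i (\<alpha> x i)) \<and> f ` points \<Gamma> \<subseteq> points \<Delta>"
    using assms unfolding profinite_covering_def pro_map_def by (elim conjE)
  then obtain I :: "('a, 'b) sys_index set" and leq and G D :: "('a, 'b) sys_index \<Rightarrow> nat graph" and \<phi> \<psi> q \<alpha> \<beta> where
    s: "inverse_system_of_maps I leq G \<phi> D \<psi> q" and
    t: "\<forall>i\<in>I. finite_covering (G i) (D i) (q i)" "limit_iso \<Gamma> I leq G \<phi> \<alpha>" "limit_iso \<Delta> I leq D \<psi> \<beta>"
      "\<forall>x\<in>points \<Gamma>. \<forall>i\<in>I. \<beta> (f x) i = q i (\<alpha> x i)"
    by (elim conjE exE) (rule that)
  have "inverse_system I leq G \<phi>" "inverse_system I leq D \<psi>"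
    and "q i (\<phi> i j x) = \<psi> i j (q j x)" if "(i, j) \<in> leq" "x \<in> points (G j)" for i j x
    using s that unfolding inverse_system_of_maps_def by auto
  note c = this
  show ?thesis
    by (rule that[OF _ _ t(2,3) bspec[OF t(1)] bspec[OF bspec[OF t(4)], symmetric] c(3)])
      (use s in \<open>auto simp: inverse_system_of_maps_def\<close>)
qed

lemma profinite_coveringD:
  assumes "profinite_covering \<Gamma> \<Delta> f"
  shows "profinite_graph \<Gamma>" "profinite_graph \<Delta>" "x \<in> points \<Gamma> \<Longrightarrow> f x \<in> points \<Delta>"
  using assms unfolding profinite_covering_def pro_map_def by auto

lemma finite_coveringD:
  assumes "finite_covering X Y q"
  shows "is_graph X" "is_graph Y" "finite (points X)" "finite (points Y)" "locally_bijective X Y q"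
  using assms unfolding finite_covering_def by auto

text \<open>\<open>pro_map\<close> constrains \<open>f\<close> through the coordinates of the two
  presentations. Each coordinate of \<open>f\<close> is a composite of graph maps, and the
  coordinates separate the points of \<Delta> and tell vertices from edges.\<close>

lemma profinite_covering_map:
  assumes cov: "profinite_covering \<Gamma> \<Delta> f"
  shows "graph_map \<Gamma> \<Delta> f"
proof -
  note \<Gamma> = profinite_coveringD(1)[OF cov] and \<Delta> = profinite_coveringD(2)[OF cov] and f = profinite_coveringD(3)[OF cov]
  note g = profinite_graphD(2)[OF \<Gamma>] profinite_graphD(2)[OF \<Delta>]
  from cov show ?thesis
  proof (rule profinite_coveringE)
    fix I :: "('a, 'b) sys_index set" and leq and G D :: "('a, 'b) sys_index \<Rightarrow> nat graph" and \<phi> \<psi> q \<alpha> \<beta>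
    assume sys: "inverse_system I leq G \<phi>" "inverse_system I leq D \<psi>"
      and iso: "limit_iso \<Gamma> I leq G \<phi> \<alpha>" "limit_iso \<Delta> I leq D \<psi> \<beta>"
      and fc: "\<And>i. i \<in> I \<Longrightarrow> finite_covering (G i) (D i) (q i)"
      and q: "\<And>i x. i \<in> I \<Longrightarrow> x \<in> points \<Gamma> \<Longrightarrow> q i (\<alpha> x i) = \<beta> (f x) i"
    note a = limit_map[OF \<Gamma> sys(1) iso(1)] and b = limit_map[OF \<Delta> sys(2) iso(2)]
    note sep = limit_separated[OF \<Delta> sys(2) iso(2)]
    have m: "graph_map \<Gamma> (D i) (\<lambda>x. \<beta> (f x) i)" if i: "i \<in> I" for i
      by (rule graph_map_cong[OF g(1) graph_map_comp[OF a[OF i] locally_bijective_map[OF finite_coveringD(5)[OF fc[OF i]]]]])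
        (simp add: q i)
    obtain i0 where i0: "i0 \<in> I" using limit_directed[OF \<Gamma> sys(1) iso(1)] unfolding directed_def by auto
    show ?thesis
    proof (rule graph_mapI)
      show "f x \<in> verts \<Delta>" if "x \<in> verts \<Gamma>" for x
        using graph_map_vertex[OF b[OF i0] finite_coveringD(2)[OF fc[OF i0]] f] graph_map_on(1)[OF m[OF i0] that] that
        by (simp add: in_points_iff)
      fix x assume x: "x \<in> edges \<Gamma>"
      show e: "f x \<in> edges \<Delta>"
        using graph_map_edge[OF b[OF i0] finite_coveringD(2)[OF fc[OF i0]] f] graph_map_on(2)[OF m[OF i0] x] x
        by (simp add: in_points_iff)
      note ex = graph_edge[OF g(1) x] and ef = graph_edge[OF g(2) e]
      have p: "source \<Gamma> x \<in> points \<Gamma>" "target \<Gamma> x \<in> points \<Gamma>" "opp \<Gamma> x \<in> points \<Gamma>"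
        "source \<Delta> (f x) \<in> points \<Delta>" "target \<Delta> (f x) \<in> points \<Delta>" "opp \<Delta> (f x) \<in> points \<Delta>"
        using ex ef by (auto simp: in_points_iff)
      show "f (source \<Gamma> x) = source \<Delta> (f x)"
        by (rule sep[OF f[OF p(1)] p(4)]) (use graph_map_on(4)[OF m x] graph_map_on(4)[OF b e] in simp)
      show "f (target \<Gamma> x) = target \<Delta> (f x)"
        by (rule sep[OF f[OF p(2)] p(5)]) (use graph_map_on(5)[OF m x] graph_map_on(5)[OF b e] in simp)
      show "f (opp \<Gamma> x) = opp \<Delta> (f x)"
        by (rule sep[OF f[OF p(3)] p(6)]) (use graph_map_on(6)[OF m x] graph_map_on(6)[OF b e] in simp)
    qed
  qed
qed

text \<open>At a level whose kernel in \<Delta> lies inside \<open>E\<close>, the kernel of the same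
  level in \<Gamma> is small enough, because \<open>q i\<close> maps equal coordinates to equal
  coordinates.\<close>

lemma profinite_covering_uniform:
  assumes cov: "profinite_covering \<Gamma> \<Delta> f" and E: "E \<in> entourages \<Delta>"
  shows "\<exists>S\<in>entourages \<Gamma>. \<forall>x y. (x, y) \<in> S \<longrightarrow> (f x, f y) \<in> E"
proof -
  note \<Gamma> = profinite_coveringD(1)[OF cov] and \<Delta> = profinite_coveringD(2)[OF cov] and f = profinite_coveringD(3)[OF cov]
  from cov show ?thesis
  proof (rule profinite_coveringE)
    fix I :: "('a, 'b) sys_index set" and leq and G D :: "('a, 'b) sys_index \<Rightarrow> nat graph" and \<phi> \<psi> q \<alpha> \<beta>
    assume sys: "inverse_system I leq G \<phi>" "inverse_system I leq D \<psi>"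
      and iso: "limit_iso \<Gamma> I leq G \<phi> \<alpha>" "limit_iso \<Delta> I leq D \<psi> \<beta>"
      and q: "\<And>i x. i \<in> I \<Longrightarrow> x \<in> points \<Gamma> \<Longrightarrow> q i (\<alpha> x i) = \<beta> (f x) i"
    obtain i where i: "i \<in> I" "ker \<Delta> (\<lambda>x. \<beta> x i) \<subseteq> E" using limit_cofinal[OF \<Delta> sys(2) iso(2) E] by blast
    have "(f x, f y) \<in> E" if "(x, y) \<in> ker \<Gamma> (\<lambda>x. \<alpha> x i)" for x y
      using that q[OF i(1), of x] q[OF i(1), of y] f i(2) by (auto simp: ker_iff subset_iff)
    then show ?thesis using limit_ker[OF \<Gamma> sys(1) iso(1) i(1)] by blast
  qed
qed

text \<open>In each coordinate, \<open>h\<close> and \<open>k\<close> become two lifts through the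
  finite covering \<open>q i\<close> that agree at \<open>u\<close>.\<close>

lemma profinite_covering_lifts_agree:
  assumes cov: "profinite_covering \<Gamma> \<Delta> f" and U: "cofinite_graph U" "connected_ugraph U"
    and h: "graph_map U \<Gamma> h" "\<And>E. E \<in> entourages \<Gamma> \<Longrightarrow> \<exists>S\<in>entourages U. \<forall>x y. (x, y) \<in> S \<longrightarrow> (h x, h y) \<in> E"
    and k: "graph_map U \<Gamma> k" "\<And>E. E \<in> entourages \<Gamma> \<Longrightarrow> \<exists>S\<in>entourages U. \<forall>x y. (x, y) \<in> S \<longrightarrow> (k x, k y) \<in> E"
    and eq: "\<And>x. x \<in> points U \<Longrightarrow> f (h x) = f (k x)" and u: "u \<in> verts U" "h u = k u" and x: "x \<in> points U"
  shows "h x = k x"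
proof -
  note \<Gamma> = profinite_coveringD(1)[OF cov]
  from cov show ?thesis
  proof (rule profinite_coveringE)
    fix I :: "('a, 'b) sys_index set" and leq and G D :: "('a, 'b) sys_index \<Rightarrow> nat graph" and \<phi> \<psi> q \<alpha> \<beta>
    assume sys: "inverse_system I leq G \<phi>" and iso: "limit_iso \<Gamma> I leq G \<phi> \<alpha>"
      and fc: "\<And>i. i \<in> I \<Longrightarrow> finite_covering (G i) (D i) (q i)"
      and q: "\<And>i x. i \<in> I \<Longrightarrow> x \<in> points \<Gamma> \<Longrightarrow> q i (\<alpha> x i) = \<beta> (f x) i"
    note a = limit_map[OF \<Gamma> sys iso] and hp = graph_map_on(3)[OF h(1)] and kp = graph_map_on(3)[OF k(1)]
    show ?thesis
    proof (rule limit_separated[OF \<Gamma> sys iso hp[OF x] kp[OF x]])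
      fix i assume i: "i \<in> I"
      note c = finite_coveringD[OF fc[OF i]] and ent = limit_ker[OF \<Gamma> sys iso i]
      show "\<alpha> (h x) i = \<alpha> (k x) i"
      proof (rule profinite_lifts_agree[OF U _ _ _ _ c(5) c(1,3) _ u(1) _ x])
        show "graph_map U (G i) (\<lambda>x. \<alpha> (h x) i)" "graph_map U (G i) (\<lambda>x. \<alpha> (k x) i)"
          using graph_map_comp[OF h(1) a[OF i]] graph_map_comp[OF k(1) a[OF i]] by auto
        show "ker U (\<lambda>x. \<alpha> (h x) i) \<in> entourages U"
          by (rule cofinite_ker_preimage[OF U(1) hp h(2)[OF ent]])
        show "ker U (\<lambda>x. \<alpha> (k x) i) \<in> entourages U"
          by (rule cofinite_ker_preimage[OF U(1) kp k(2)[OF ent]])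
      qed (use q[OF i] hp kp eq u in auto)
    qed
  qed
qed

section \<open>Fibre products of coverings\<close>

text \<open>The maps \<open>q j\<close> may have different base graphs; their pull-backs along the
  maps \<open>u j\<close> are multiplied over \<open>Y\<close>. The component in \<open>Y\<close> is
  kept as part of a point, so that an empty \<open>F\<close> gives a copy of
  \<open>Y\<close>.\<close>

definition fibre_product ::
    "('y, 'm) graph_scheme \<Rightarrow> 'j set \<Rightarrow> ('j \<Rightarrow> ('x, 'n) graph_scheme) \<Rightarrow> ('j \<Rightarrow> 'x \<Rightarrow> 'z) \<Rightarrow> ('j \<Rightarrow> 'y \<Rightarrow> 'z) \<Rightarrow>
     ('y \<times> ('j \<Rightarrow> 'x)) graph" where
  "fibre_product Y F X q u = \<lparr>
     verts = {(y, l). y \<in> verts Y \<and> l \<in> Pi\<^sub>E F (\<lambda>j. verts (X j)) \<and> (\<forall>j\<in>F. q j (l j) = u j y)},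
     edges = {(y, l). y \<in> edges Y \<and> l \<in> Pi\<^sub>E F (\<lambda>j. edges (X j)) \<and> (\<forall>j\<in>F. q j (l j) = u j y)},
     source = (\<lambda>(y, l). (source Y y, \<lambda>j\<in>F. source (X j) (l j))),
     target = (\<lambda>(y, l). (target Y y, \<lambda>j\<in>F. target (X j) (l j))),
     opp = (\<lambda>(y, l). (opp Y y, \<lambda>j\<in>F. opp (X j) (l j)))\<rparr>"

lemma fibre_product_simps [simp]:
  "source (fibre_product Y F X q u) (y, l) = (source Y y, \<lambda>j\<in>F. source (X j) (l j))"
  "target (fibre_product Y F X q u) (y, l) = (target Y y, \<lambda>j\<in>F. target (X j) (l j))"
  "opp (fibre_product Y F X q u) (y, l) = (opp Y y, \<lambda>j\<in>F. opp (X j) (l j))"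
  by (auto simp: fibre_product_def)

lemma fibre_product_vert: "(y, l) \<in> verts (fibre_product Y F X q u) \<longleftrightarrow>
    y \<in> verts Y \<and> l \<in> Pi\<^sub>E F (\<lambda>j. verts (X j)) \<and> (\<forall>j\<in>F. q j (l j) = u j y)"
  by (auto simp: fibre_product_def)

lemma fibre_product_edge: "(y, l) \<in> edges (fibre_product Y F X q u) \<longleftrightarrow>
    y \<in> edges Y \<and> l \<in> Pi\<^sub>E F (\<lambda>j. edges (X j)) \<and> (\<forall>j\<in>F. q j (l j) = u j y)"
  by (auto simp: fibre_product_def)

lemma fibre_product_point:
  assumes "(y, l) \<in> points (fibre_product Y F X q u)"
  shows "y \<in> points Y" "l \<in> Pi\<^sub>E F (\<lambda>j. points (X j))" "j \<in> F \<Longrightarrow> q j (l j) = u j y"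
  using assms by (auto simp: in_points_iff fibre_product_vert fibre_product_edge PiE_iff)

context
  fixes Y :: "('y, 'm) graph_scheme" and F :: "'j set" and X :: "'j \<Rightarrow> ('x, 'n) graph_scheme" and q u
    and Z :: "'j \<Rightarrow> ('z, 'o) graph_scheme"
  assumes Y: "is_graph Y" and X: "\<And>j. j \<in> F \<Longrightarrow> is_graph (X j)"
    and q: "\<And>j. j \<in> F \<Longrightarrow> locally_bijective (X j) (Z j) (q j)"
    and u: "\<And>j. j \<in> F \<Longrightarrow> graph_map Y (Z j) (u j)"
begin

private abbreviation "P \<equiv> fibre_product Y F X q u"

lemma is_graph_fibre_product: "is_graph P"
proof -
  have disj: "verts P \<inter> edges P = {}"
    using graph_disjoint[OF Y] by (auto simp: fibre_product_vert fibre_product_edge)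
  have "source P z \<in> verts P \<and> target P z \<in> verts P \<and> opp P z \<in> edges P \<and> opp P (opp P z) = z \<and> opp P z \<noteq> z \<and>
        source P (opp P z) = target P z \<and> target P (opp P z) = source P z" if z: "z \<in> edges P" for z
  proof -
    obtain y l where yl: "z = (y, l)" by (cases z)
    then have *: "y \<in> edges Y" "l \<in> Pi\<^sub>E F (\<lambda>j. edges (X j))" "\<And>j. j \<in> F \<Longrightarrow> q j (l j) = u j y"
      using z unfolding yl fibre_product_edge by auto
    note ey = graph_edge[OF Y *(1)]
    have l: "l j \<in> edges (X j)" if "j \<in> F" for j using *(2) that by auto
    note el = graph_edge[OF X l]
    note mq = graph_map_on(4-6)[OF locally_bijective_map[OF q] l] and mu = graph_map_on(4-6)[OF u *(1)]
    have "(\<lambda>j\<in>F. opp (X j) ((\<lambda>j\<in>F. opp (X j) (l j)) j)) = l"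
      by (rule extensionalityI[of _ F]) (use *(2)[unfolded PiE_iff] el in auto)
    then show ?thesis
      using ey el mq mu *(3) unfolding yl by (auto simp: fibre_product_vert fibre_product_edge cong: restrict_cong)
  qed
  then show ?thesis using disj unfolding is_graph_def by blast
qed

text \<open>An edge of \<open>Y\<close> has exactly one lift in every coordinate at a given vertex,
  and these lifts together form the edge of the product.\<close>

lemma fibre_product_fst: "locally_bijective P Y fst"
proof (rule locally_bijectiveI)
  show "graph_map P Y fst"
    by (rule graph_mapI) (auto simp: fibre_product_vert fibre_product_edge)
next
  fix e e' assume e: "e \<in> edges P" "e' \<in> edges P" and s: "source P e = source P e'" and f: "fst e = fst e'"
  obtain y l l' where yl: "e = (y, l)" "e' = (y, l')" using f by (cases e, cases e') auto
  then have *: "l \<in> Pi\<^sub>E F (\<lambda>j. edges (X j))" "l' \<in> Pi\<^sub>E F (\<lambda>j. edges (X j))"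
    "\<And>j. j \<in> F \<Longrightarrow> q j (l j) = u j y" "\<And>j. j \<in> F \<Longrightarrow> q j (l' j) = u j y"
    using e unfolding yl fibre_product_edge by auto
  have "l = l'"
  proof (rule PiE_ext[OF *(1,2)])
    fix j assume j: "j \<in> F"
    have "snd (source P e) j = snd (source P e') j" using s by simp
    then have "source (X j) (l j) = source (X j) (l' j)" using j unfolding yl by simp
    moreover have "q j (l j) = q j (l' j)" "l j \<in> edges (X j)" "l' j \<in> edges (X j)" using * j by auto
    ultimately show "l j = l' j" using locally_bijective_inj[OF q[OF j] X[OF j]] by simp
  qed
  then show "e = e'" using yl by simp
next
  fix v e assume v: "v \<in> verts P" and e: "e \<in> edges Y" "source Y e = fst v"
  obtain y l where yl: "v = (y, l)" by (cases v)
  then have *: "l \<in> Pi\<^sub>E F (\<lambda>j. verts (X j))" "\<And>j. j \<in> F \<Longrightarrow> q j (l j) = u j y"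
    using v unfolding yl fibre_product_vert by auto
  have "\<exists>e'\<in>edges (X j). source (X j) e' = l j \<and> q j e' = u j e" if j: "j \<in> F" for j
    using *(1) *(2)[OF j] graph_map_on(2,4)[OF u[OF j] e(1)] e(2) yl j by (intro locally_bijective_ex[OF q]) auto
  then obtain l' where l': "\<And>j. j \<in> F \<Longrightarrow> l' j \<in> edges (X j) \<and> source (X j) (l' j) = l j \<and> q j (l' j) = u j e"
    by metis
  have "(\<lambda>j\<in>F. source (X j) ((\<lambda>j\<in>F. l' j) j)) = l"
    by (rule extensionalityI[of _ F]) (use *(1)[unfolded PiE_iff] l' in auto)
  then show "\<exists>e'\<in>edges P. source P e' = v \<and> fst e' = e"
    using l' e yl by (intro bexI[of _ "(e, \<lambda>j\<in>F. l' j)"]) (auto simp: fibre_product_edge)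
qed

lemma fibre_product_coordinate:
  assumes j: "j \<in> F"
  shows "graph_map P (X j) (\<lambda>z. snd z j)"
  by (rule graph_mapI) (use j in \<open>auto simp: fibre_product_vert fibre_product_edge\<close>)

lemma finite_fibre_product:
  assumes "finite F" "finite (points Y)" "\<And>j. j \<in> F \<Longrightarrow> finite (points (X j))"
  shows "finite (points P)"
proof (rule finite_subset)
  show "points P \<subseteq> points Y \<times> Pi\<^sub>E F (\<lambda>j. points (X j))"
  proof
    fix z assume z: "z \<in> points P"
    obtain y l where yl: "z = (y, l)" by (cases z)
    show "z \<in> points Y \<times> Pi\<^sub>E F (\<lambda>j. points (X j))"
      using fibre_product_point(1,2)[OF z[unfolded yl]] unfolding yl by simp
  qed
  show "finite (points Y \<times> Pi\<^sub>E F (\<lambda>j. points (X j)))" using assms by (intro finite_cartesian_product finite_PiE) auto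
qed

end

lemma quotient_refine:
  assumes R: "compatible_cofinite_entourage G R" and S: "compatible_cofinite_entourage G S" and RS: "R \<subseteq> S"
    and G: "is_graph G"
  shows "x \<in> points G \<Longrightarrow> S `` (R `` {x}) = S `` {x}"
    "graph_map (quotient_graph G R) (quotient_graph G S) (\<lambda>A. S `` A)"
proof -
  note r = cceD[OF R] and s = cceD[OF S]
  show *: "S `` (R `` {x}) = S `` {x}" if x: "x \<in> points G" for x
  proof -
    have "S `` {y} = S `` {x}" if "y \<in> R `` {x}" for y
      using that RS equiv_class_eq[OF s(4), of x y] by auto
    moreover have "x \<in> R `` {x}" using equiv_class_self[OF r(4) x] .
    ultimately show ?thesis by blast
  qed
  show "graph_map (quotient_graph G R) (quotient_graph G S) (\<lambda>A. S `` A)"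
    by (rule graph_onto_factor[OF quotient_graph_onto[OF G r(2)] * graph_onto_map[OF quotient_graph_onto[OF G s(2)]] G])
qed

section \<open>The universal covering graph\<close>

type_synonym 'a cover = "('a \<times> 'a) set \<times> nat graph \<times> (nat \<Rightarrow> 'a set) \<times> nat"

abbreviation crel :: "'a cover \<Rightarrow> ('a \<times> 'a) set" where "crel j \<equiv> fst j"
abbreviation ctot :: "'a cover \<Rightarrow> nat graph" where "ctot j \<equiv> fst (snd j)"
abbreviation cproj :: "'a cover \<Rightarrow> nat \<Rightarrow> 'a set" where "cproj j \<equiv> fst (snd (snd j))"
abbreviation cbase :: "'a cover \<Rightarrow> nat" where "cbase j \<equiv> snd (snd (snd j))"

locale pointed_profinite_graph =
  fixes \<Delta> :: "'a ugraph" and v0 :: 'a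
  assumes profinite: "profinite_graph \<Delta>" and connected: "connected_ugraph \<Delta>" and base_vertex: "v0 \<in> verts \<Delta>"
begin

lemma cofinite: "cofinite_graph \<Delta>" and graph: "is_graph \<Delta>"
  using profinite_graphD[OF profinite] by auto

abbreviation "cce \<equiv> compatible_cofinite_entourage \<Delta>"

abbreviation "Q R \<equiv> quotient_graph \<Delta> R"

lemma Q_facts:
  assumes "cce R"
  shows "is_graph (Q R)" "finite (points (Q R))" "path_connected_graph (Q R)" "graph_onto \<Delta> (Q R) (\<lambda>x. R `` {x})"
    "ker \<Delta> (\<lambda>x. R `` {x}) = R"
proof -
  note r = cceD[OF assms]
  show "is_graph (Q R)" by (rule is_graph_quotient[OF graph r(2)])
  show "finite (points (Q R))" using r(3) by simp
  show "path_connected_graph (Q R)" using connected assms unfolding connected_ugraph_def by blast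
  show "graph_onto \<Delta> (Q R) (\<lambda>x. R `` {x})" by (rule quotient_graph_onto[OF graph r(2)])
  show "ker \<Delta> (\<lambda>x. R `` {x}) = R" by (rule ker_equiv_class[OF r(4)])
qed

lemma cce_below: "E \<in> entourages \<Delta> \<Longrightarrow> F \<in> entourages \<Delta> \<Longrightarrow> \<exists>R. cce R \<and> R \<subseteq> E \<and> R \<subseteq> F"
  using cofinite_graphD(4)[OF cofinite cofinite_entourage(4)[OF cofinite]] by blast

section \<open>Finite levels: fibre products of pointed coverings and their base components\<close>

text \<open>Total graphs may be disconnected; connectedness enters only when the component of the
  base point is taken in a product. A covering occurs once for each of its vertices over the class
  of \<open>v0\<close>.\<close>

definition covers :: "'a cover set" where
  "covers = {j. cce (crel j) \<and> finite_covering (ctot j) (Q (crel j)) (cproj j) \<and>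
     cbase j \<in> verts (ctot j) \<and> cproj j (cbase j) = crel j `` {v0}}"

lemma coversD:
  assumes "j \<in> covers"
  shows "cce (crel j)" "is_graph (ctot j)" "finite (points (ctot j))"
    "locally_bijective (ctot j) (Q (crel j)) (cproj j)"
    "cbase j \<in> verts (ctot j)" "cproj j (cbase j) = crel j `` {v0}"
  using assms unfolding covers_def finite_covering_def by auto

text \<open>\<open>R\<close> refines the relation of every member of \<open>F\<close>, so all these
  coverings can be pulled back to the single quotient \<open>Q R\<close>.\<close>

definition admissible :: "('a \<times> 'a) set \<Rightarrow> 'a cover set \<Rightarrow> bool" where
  "admissible R F \<longleftrightarrow> cce R \<and> finite F \<and> F \<subseteq> covers \<and> (\<forall>j\<in>F. R \<subseteq> crel j)"

lemma admissibleD: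
  assumes "admissible R F"
  shows "cce R" "finite F" "F \<subseteq> covers" "j \<in> F \<Longrightarrow> j \<in> covers" "j \<in> F \<Longrightarrow> R \<subseteq> crel j"
  using assms unfolding admissible_def by auto

lemma admissible_mono: "admissible R F \<Longrightarrow> cce R' \<Longrightarrow> R' \<subseteq> R \<Longrightarrow> admissible R' F"
  unfolding admissible_def by blast

lemma admissible_single: "j \<in> covers \<Longrightarrow> admissible (crel j) {j}"
  unfolding admissible_def using coversD by auto

lemma admissible_common:
  assumes "admissible R1 F1" "admissible R2 F2"
  shows "\<exists>R. admissible R (F1 \<union> F2) \<and> R \<subseteq> R1 \<and> R \<subseteq> R2"
proof -
  obtain R where "cce R" "R \<subseteq> R1" "R \<subseteq> R2"
    using cce_below[OF cceD(1)[OF admissibleD(1)[OF assms(1)]] cceD(1)[OF admissibleD(1)[OF assms(2)]]] by blast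
  then show ?thesis using assms unfolding admissible_def by (intro exI[of _ R]) blast
qed

definition FP :: "('a \<times> 'a) set \<Rightarrow> 'a cover set \<Rightarrow> ('a set \<times> ('a cover \<Rightarrow> nat)) graph" where
  "FP R F = fibre_product (Q R) F ctot cproj (\<lambda>j A. crel j `` A)"

definition base :: "('a \<times> 'a) set \<Rightarrow> 'a cover set \<Rightarrow> 'a set \<times> ('a cover \<Rightarrow> nat)" where
  "base R F = (R `` {v0}, \<lambda>j\<in>F. cbase j)"

abbreviation "C R F \<equiv> component (FP R F) (base R F)"

lemma class_up: "admissible R F \<Longrightarrow> j \<in> F \<Longrightarrow> x \<in> points \<Delta> \<Longrightarrow> crel j `` (R `` {x}) = crel j `` {x}"
  using quotient_refine(1)[OF _ _ _ graph] admissibleD coversD(1) by metis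

text \<open>Writing the base coordinate as the class of a point \<open>x\<close> of \<Delta> removes
  \<open>R\<close> from the conditions on \<open>l\<close>: they refer only to \<open>x\<close>.
  Levels over different \<open>R\<close> can thus be compared with the same family.\<close>

lemma FP_vert_class:
  assumes "admissible R F" "x \<in> points \<Delta>"
  shows "(R `` {x}, l) \<in> verts (FP R F) \<longleftrightarrow>
    x \<in> verts \<Delta> \<and> l \<in> Pi\<^sub>E F (\<lambda>j. verts (ctot j)) \<and> (\<forall>j\<in>F. cproj j (l j) = crel j `` {x})"
proof -
  note o = Q_facts(4)[OF admissibleD(1)[OF assms(1)]] and g = Q_facts(1)[OF admissibleD(1)[OF assms(1)]]
  have "x \<in> verts \<Delta>" if "R `` {x} \<in> verts (Q R)" using graph_map_vertex[OF graph_onto_map[OF o] g assms(2) that] .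
  moreover have "R `` {x} \<in> verts (Q R)" if "x \<in> verts \<Delta>" using graph_map_on(1)[OF graph_onto_map[OF o] that] .
  ultimately show ?thesis
    unfolding FP_def fibre_product_vert using class_up[OF assms(1) _ assms(2)] by auto
qed

lemma FP_edge_class:
  assumes "admissible R F" "x \<in> points \<Delta>"
  shows "(R `` {x}, l) \<in> edges (FP R F) \<longleftrightarrow>
    x \<in> edges \<Delta> \<and> l \<in> Pi\<^sub>E F (\<lambda>j. edges (ctot j)) \<and> (\<forall>j\<in>F. cproj j (l j) = crel j `` {x})"
proof -
  note o = Q_facts(4)[OF admissibleD(1)[OF assms(1)]] and g = Q_facts(1)[OF admissibleD(1)[OF assms(1)]]
  have "x \<in> edges \<Delta>" if "R `` {x} \<in> edges (Q R)" using graph_map_edge[OF graph_onto_map[OF o] g assms(2) that] .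
  moreover have "R `` {x} \<in> edges (Q R)" if "x \<in> edges \<Delta>" using graph_map_on(2)[OF graph_onto_map[OF o] that] .
  ultimately show ?thesis
    unfolding FP_def fibre_product_edge using class_up[OF assms(1) _ assms(2)] by auto
qed

lemma FP_vertE:
  assumes a: "admissible R F" and z: "(A, l) \<in> verts (FP R F)"
  obtains x where "x \<in> verts \<Delta>" "A = R `` {x}" "l \<in> Pi\<^sub>E F (\<lambda>j. verts (ctot j))" "\<forall>j\<in>F. cproj j (l j) = crel j `` {x}"
proof -
  have "A \<in> verts (Q R)" using z unfolding FP_def fibre_product_vert by simp
  then obtain x where x: "x \<in> verts \<Delta>" "A = R `` {x}"
    using graph_onto_vert[OF Q_facts(4)[OF admissibleD(1)[OF a]]] by blast
  then have "x \<in> points \<Delta>" by (simp add: in_points_iff)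
  then show ?thesis using that x z FP_vert_class[OF a] by simp
qed

lemma FP_edgeE:
  assumes a: "admissible R F" and z: "(A, l) \<in> edges (FP R F)"
  obtains x where "x \<in> edges \<Delta>" "A = R `` {x}" "l \<in> Pi\<^sub>E F (\<lambda>j. edges (ctot j))" "\<forall>j\<in>F. cproj j (l j) = crel j `` {x}"
proof -
  have "A \<in> edges (Q R)" using z unfolding FP_def fibre_product_edge by simp
  then obtain x where x: "x \<in> edges \<Delta>" "A = R `` {x}"
    using graph_onto_edge[OF Q_facts(4)[OF admissibleD(1)[OF a]]] by blast
  then have "x \<in> points \<Delta>" by (simp add: in_points_iff)
  then show ?thesis using that x z FP_edge_class[OF a] by simp
qed

lemma FP_hyps:
  assumes "admissible R F"
  shows "is_graph (Q R)" "j \<in> F \<Longrightarrow> is_graph (ctot j)" "j \<in> F \<Longrightarrow> locally_bijective (ctot j) (Q (crel j)) (cproj j)"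
    "j \<in> F \<Longrightarrow> graph_map (Q R) (Q (crel j)) (\<lambda>A. crel j `` A)"
  using Q_facts(1) admissibleD[OF assms] coversD quotient_refine(2)[OF _ _ _ graph] by auto

lemma FP_facts:
  assumes "admissible R F"
  shows "is_graph (FP R F)" "locally_bijective (FP R F) (Q R) fst" "finite (points (FP R F))"
    "j \<in> F \<Longrightarrow> graph_map (FP R F) (ctot j) (\<lambda>z. snd z j)"
proof -
  note h = FP_hyps[OF assms]
  show "is_graph (FP R F)" unfolding FP_def by (rule is_graph_fibre_product[OF h])
  show "locally_bijective (FP R F) (Q R) fst" unfolding FP_def by (rule fibre_product_fst[OF h])
  show "graph_map (FP R F) (ctot j) (\<lambda>z. snd z j)" if "j \<in> F"
    unfolding FP_def by (rule fibre_product_coordinate[OF h that])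
  show "finite (points (FP R F))" unfolding FP_def
    by (rule finite_fibre_product[OF h])
      (use admissibleD[OF assms] Q_facts(2) coversD(3) in auto)
qed

lemma base_vert: "admissible R F \<Longrightarrow> base R F \<in> verts (FP R F)"
  unfolding base_def using base_vertex admissibleD(4) coversD(5,6)
  by (simp add: FP_vert_class in_points_iff)

lemma C_facts:
  assumes "admissible R F"
  shows "is_graph (C R F)" "finite (points (C R F))" "path_connected_graph (C R F)"
    "locally_bijective (C R F) (Q R) fst" "base R F \<in> verts (C R F)"
proof -
  note f = FP_facts[OF assms] and b = base_vert[OF assms]
  show "is_graph (C R F)" by (rule is_graph_component[OF f(1)])
  show "finite (points (C R F))" using component_subset(3)[OF f(1)] f(3) by (rule finite_subset)
  show "path_connected_graph (C R F)" by (rule path_connected_component[OF f(1) b])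
  show "locally_bijective (C R F) (Q R) fst" by (rule locally_bijective_component[OF f(2,1)])
  show "base R F \<in> verts (C R F)" using reach_refl[OF b] by simp
qed

text \<open>The bonding map to the level of \<open>R\<close> and \<open>F\<close> from any finer
  one.\<close>

definition shrink :: "('a \<times> 'a) set \<Rightarrow> 'a cover set \<Rightarrow> 'a set \<times> ('a cover \<Rightarrow> nat) \<Rightarrow> 'a set \<times> ('a cover \<Rightarrow> nat)" where
  "shrink R F z = (R `` fst z, restrict (snd z) F)"

lemma shrink_map:
  assumes a: "admissible R F" and a': "admissible R' F'" and sub: "R' \<subseteq> R" "F \<subseteq> F'"
  shows "graph_map (FP R' F') (FP R F) (shrink R F)" "shrink R F (base R' F') = base R F"
    "x \<in> points \<Delta> \<Longrightarrow> shrink R F (R' `` {x}, l) = (R `` {x}, restrict l F)"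
proof -
  have r: "R `` (R' `` {x}) = R `` {x}" if "x \<in> points \<Delta>" for x
    using quotient_refine(1)[OF admissibleD(1)[OF a'] admissibleD(1)[OF a] sub(1) graph that] .
  show cl: "shrink R F (R' `` {x}, l) = (R `` {x}, restrict l F)" if "x \<in> points \<Delta>" for x l
    using r[OF that] by (simp add: shrink_def)
  show "shrink R F (base R' F') = base R F"
    unfolding base_def using cl base_vertex sub(2) by (auto simp: in_points_iff restrict_def fun_eq_iff)
  note q = quotient_refine(2)[OF admissibleD(1)[OF a'] admissibleD(1)[OF a] sub(1) graph]
  show "graph_map (FP R' F') (FP R F) (shrink R F)"
  proof (rule graph_mapI)
    fix z assume "z \<in> verts (FP R' F')"
    moreover obtain A l where z: "z = (A, l)" by (cases z)
    ultimately obtain x where x: "x \<in> verts \<Delta>" "A = R' `` {x}" "l \<in> Pi\<^sub>E F' (\<lambda>j. verts (ctot j))"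
      "\<forall>j\<in>F'. cproj j (l j) = crel j `` {x}" using FP_vertE[OF a'] by metis
    then have xp: "x \<in> points \<Delta>" by (simp add: in_points_iff)
    show "shrink R F z \<in> verts (FP R F)"
      unfolding z x(2) cl[OF xp] FP_vert_class[OF a xp] using x sub(2) by (auto simp: PiE_iff)
  next
    fix z assume zz: "z \<in> edges (FP R' F')"
    moreover obtain A l where z: "z = (A, l)" by (cases z)
    ultimately obtain x where x: "x \<in> edges \<Delta>" "A = R' `` {x}" "l \<in> Pi\<^sub>E F' (\<lambda>j. edges (ctot j))"
      "\<forall>j\<in>F'. cproj j (l j) = crel j `` {x}" using FP_edgeE[OF a'] by metis
    then have xp: "x \<in> points \<Delta>" by (simp add: in_points_iff)
    show "shrink R F z \<in> edges (FP R F)"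
      unfolding z x(2) cl[OF xp] FP_edge_class[OF a xp] using x sub(2) by (auto simp: PiE_iff)
    have A: "A \<in> edges (Q R')" using zz unfolding z FP_def fibre_product_edge by simp
    show "shrink R F (source (FP R' F') z) = source (FP R F) (shrink R F z)"
      "shrink R F (target (FP R' F') z) = target (FP R F) (shrink R F z)"
      "shrink R F (opp (FP R' F') z) = opp (FP R F) (shrink R F z)"
      using graph_map_on(4-6)[OF q A] sub(2) unfolding z shrink_def FP_def
      by (auto simp: restrict_def fun_eq_iff)
  qed
qed

lemma shrink_C:
  assumes a: "admissible R F" and a': "admissible R' F'" and sub: "R' \<subseteq> R" "F \<subseteq> F'"
  shows "graph_map (C R' F') (C R F) (shrink R F)"
  using graph_map_component[OF shrink_map(1)[OF assms], of "base R' F'"] unfolding shrink_map(2)[OF assms] .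

lemma FP_point:
  assumes "admissible R F" "x \<in> points \<Delta>" "(R `` {x}, l) \<in> points (FP R F)"
  shows "l \<in> Pi\<^sub>E F (\<lambda>j. points (ctot j))" "j \<in> F \<Longrightarrow> cproj j (l j) = crel j `` {x}"
  using fibre_product_point[OF assms(3)[unfolded FP_def]] class_up[OF assms(1) _ assms(2)] by auto

text \<open>Refining \<open>R\<close> leaves the family \<open>l\<close> as it is and only replaces
  the class of \<open>x\<close>; thus connectedness of the pull-back to a finer quotient can be
  expressed point by point.\<close>

definition stable :: "('a \<times> 'a) set \<Rightarrow> 'a cover set \<Rightarrow> bool" where
  "stable R F \<longleftrightarrow> admissible R F \<and> (\<forall>R' x l. cce R' \<and> R' \<subseteq> R \<and> x \<in> points \<Delta> \<and>
     (R `` {x}, l) \<in> points (C R F) \<longrightarrow> (R' `` {x}, l) \<in> points (C R' F))"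

text \<open>
  The base points of \<open>C R F\<close> decrease with \<open>R\<close>. Where their number is smallest, the pull-back of
  \<open>C R F\<close> to a finer quotient of \<open>\<Delta>\<close> is still connected.
\<close>

lemma stable_component:
  assumes a: "admissible R F"
  shows "\<exists>R0. R0 \<subseteq> R \<and> stable R0 F"
proof -
  \<comment> \<open>The families over the class of \<open>v0\<close> that are joined to the base
    point. As families do not mention \<open>R\<close>, these sets can be compared for different
    \<open>R\<close>.\<close>
  define H where "H R = {l. reach (FP R F) (base R F) (R `` {v0}, l)}" for R
  obtain R0 where R0: "admissible R0 F" "R0 \<subseteq> R" and
    least: "\<And>R'. admissible R' F \<Longrightarrow> R' \<subseteq> R \<Longrightarrow> card (H R0) \<le> card (H R')"
    using ex_has_least_nat[of "\<lambda>R0. admissible R0 F \<and> R0 \<subseteq> R" R "\<lambda>R. card (H R)"] a by auto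
  note v0 = base_vertex[THEN in_points_iff[THEN iffD2, OF disjI1]]
  have fin: "finite (H R0)"
  proof (rule finite_subset)
    show "H R0 \<subseteq> snd ` points (FP R0 F)"
    proof
      fix l assume "l \<in> H R0"
      then have "(R0 `` {v0}, l) \<in> points (FP R0 F)"
        unfolding H_def using reach_verts(2)[OF FP_facts(1)[OF R0(1)]] by (simp add: in_points_iff)
      then show "l \<in> snd ` points (FP R0 F)" by (rule rev_image_eqI) simp
    qed
  qed (use FP_facts(3)[OF R0(1)] in simp)
  have *: "(R' `` {x}, l) \<in> points (C R' F)"
    if R': "cce R'" "R' \<subseteq> R0" and x: "x \<in> points \<Delta>" "(R0 `` {x}, l) \<in> points (C R0 F)" for R' x l
  proof -
    note a' = admissible_mono[OF R0(1) R']
    note FP0 = FP_facts[OF R0(1)] and FP' = FP_facts[OF a'] and sh = shrink_map[OF R0(1) a' R'(2) order_refl]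
    have low: "shrink R0 F (R' `` {y}, m) = (R0 `` {y}, m)" if "y \<in> points \<Delta>" "(R' `` {y}, m) \<in> points (FP R' F)" for y m
    proof -
      have "m \<in> extensional F" using FP_point(1)[OF a' that] by (auto simp: PiE_def)
      then show ?thesis using sh(3)[OF that(1)] by (simp add: extensional_restrict)
    qed
    have "H R' \<subseteq> H R0"
    proof
      fix m assume m: "m \<in> H R'"
      then have "(R' `` {v0}, m) \<in> verts (FP R' F)"
        unfolding H_def using reach_verts(2)[OF FP'(1)] by auto
      then show "m \<in> H R0"
        using reach_map[OF sh(1), of "base R' F" "(R' `` {v0}, m)"] m low[OF v0, of m] unfolding H_def sh(2)
        by (auto simp: in_points_iff)
    qed
    moreover have "card (H R0) \<le> card (H R')" using least[OF a'] R'(2) R0(2) by auto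
    \<comment> \<open>\<open>H R'\<close> lies in \<open>H R0\<close>, which is finite and of least
      size.\<close>
    ultimately have H: "H R' = H R0" using card_seteq[OF fin] by auto
    \<comment> \<open>Over the finer quotient, a lifted path joins the vertex to some family
      \<open>m'\<close> over \<open>v0\<close>. Seen over the coarser quotient, \<open>m'\<close>
      belongs to \<open>H R0\<close>, hence to \<open>H R'\<close>, and the lifted path leads back
      from there.\<close>
    have vert: "reach (FP R' F) (base R' F) (R' `` {y}, m)"
      if y: "y \<in> verts \<Delta>" and r: "reach (FP R0 F) (base R0 F) (R0 `` {y}, m)" for y m
    proof -
      have yp: "y \<in> points \<Delta>" using y by (simp add: in_points_iff)
      have z: "(R' `` {y}, m) \<in> verts (FP R' F)"
        using reach_verts(2)[OF FP0(1) r] unfolding FP_vert_class[OF R0(1) yp] FP_vert_class[OF a' yp] by simp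
      have "R' `` {y} \<in> verts (Q R')" "R' `` {v0} \<in> verts (Q R')"
        using graph_map_on(1)[OF graph_onto_map[OF Q_facts(4)[OF R'(1)]]] y base_vertex by auto
      then have "reach (Q R') (fst (R' `` {y}, m)) (R' `` {v0})"
        using path_connected_reach[OF Q_facts(3)[OF R'(1)]] by simp
      from reach_lift[OF FP'(2,1) z this] obtain m' where m': "reach (FP R' F) (R' `` {y}, m) (R' `` {v0}, m')"
        by (metis prod.collapse)
      have "(R' `` {v0}, m') \<in> points (FP R' F)" using reach_verts(2)[OF FP'(1) m'] by (simp add: in_points_iff)
      then have "reach (FP R0 F) (R0 `` {y}, m) (R0 `` {v0}, m')"
        using reach_map[OF sh(1) m'] low[OF v0, of m'] low[OF yp, of m] z by (simp add: in_points_iff)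
      then have "m' \<in> H R0" unfolding H_def using reach_trans[OF FP0(1) r] by simp
      then have "reach (FP R' F) (base R' F) (R' `` {v0}, m')" using H unfolding H_def by auto
      then show ?thesis using reach_trans[OF FP'(1) _ reach_sym[OF FP'(1) m']] by simp
    qed
    show ?thesis
    proof (cases "x \<in> verts \<Delta>")
      case True
      then have "(R0 `` {x}, l) \<in> verts (C R0 F)"
        using x graph_map_edge[OF graph_onto_map[OF Q_facts(4)] Q_facts(1), of R0 x]
          graph_map_on(2)[OF locally_bijective_map[OF C_facts(4)[OF R0(1)]]] admissibleD(1)[OF R0(1)]
          graph_disjoint[OF graph] unfolding in_points_iff[of _ "C R0 F"] by (metis fst_conv)
      then show ?thesis using vert[OF True] by (simp add: in_points_iff)
    next
      case False
      then have e: "x \<in> edges \<Delta>" using x by (simp add: in_points_iff)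
      have "(R0 `` {x}, l) \<notin> verts (FP R0 F)" using FP_vert_class[OF R0(1) x(1)] False by simp
      then have e0: "(R0 `` {x}, l) \<in> edges (FP R0 F)" and r0: "reach (FP R0 F) (base R0 F) (source (FP R0 F) (R0 `` {x}, l))"
        using x(2) reach_verts(2)[OF FP0(1), of "base R0 F" "(R0 `` {x}, l)"] by (auto simp: in_points_iff)
      have e': "(R' `` {x}, l) \<in> edges (FP R' F)"
        using e0 unfolding FP_edge_class[OF R0(1) x(1)] FP_edge_class[OF a' x(1)] .
      \<comment> \<open>An edge lies in the component together with its source, and over both
        quotients that source is the class of \<open>source \<Delta> x\<close> with the same
        family.\<close>
      have src: "source (FP R'' F) (R'' `` {x}, l) = (R'' `` {source \<Delta> x}, \<lambda>j\<in>F. source (ctot j) (l j))" if "cce R''" for R''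
        unfolding FP_def fibre_product_simps using graph_map_on(4)[OF graph_onto_map[OF Q_facts(4)[OF that]] e] by simp
      have "reach (FP R' F) (base R' F) (source (FP R' F) (R' `` {x}, l))"
        using vert[OF graph_edge(1)[OF graph e]] r0 unfolding src[OF R'(1)] src[OF admissibleD(1)[OF R0(1)]] by simp
      then show ?thesis using e' by (simp add: in_points_iff)
    qed
  qed
  have "stable R0 F" unfolding stable_def using R0(1) * by blast
  then show ?thesis using R0(2) by blast
qed

section \<open>Points of the universal covering as families of coordinates\<close>

abbreviation "T \<equiv> product_topology (\<lambda>j. discrete_topology (points (ctot j))) covers"

lemma compact_T: "compact_space T"
  using coversD(3) by (simp add: compact_space_product_topology compact_space_discrete_topology)

text \<open>Near \<open>k\<close>, the finitely many coordinates in \<open>F\<close> can be kept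
  fixed because their spaces are discrete.\<close>

lemma openin_T:
  assumes F: "finite F" "F \<subseteq> covers"
  shows "openin T {k \<in> topspace T. P (restrict k F)}"
proof (subst openin_subopen, intro ballI)
  fix k assume k: "k \<in> {k \<in> topspace T. P (restrict k F)}"
  let ?B = "{k' \<in> topspace T. \<forall>j\<in>F. k' j = k j}"
  have "openin T ?B" using F
  proof (induction F)
    case empty then show ?case using openin_topspace[of T] by simp
  next
    case (insert j F)
    then have "continuous_map T (discrete_topology (points (ctot j))) (\<lambda>k. k j)"
      by (intro continuous_map_product_projection) auto
    moreover have "openin (discrete_topology (points (ctot j))) {k j}" using k insert.prems by auto
    ultimately have "openin T {k' \<in> topspace T. k' j \<in> {k j}}" unfolding continuous_map by blast
    moreover have "{k' \<in> topspace T. \<forall>i\<in>insert j F. k' i = k i} =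
        {k' \<in> topspace T. k' j \<in> {k j}} \<inter> {k' \<in> topspace T. \<forall>j\<in>F. k' j = k j}" by auto
    ultimately show ?case using insert by (auto intro!: openin_Int)
  qed
  moreover have "?B \<subseteq> {k \<in> topspace T. P (restrict k F)}"
  proof
    fix k' assume k': "k' \<in> ?B"
    then have "restrict k' F = restrict k F" by (intro restrict_ext) auto
    then show "k' \<in> {k \<in> topspace T. P (restrict k F)}" using k k' by simp
  qed
  ultimately show "\<exists>B. openin T B \<and> k \<in> B \<and> B \<subseteq> {k \<in> topspace T. P (restrict k F)}" using k by blast
qed

lemma closedin_T:
  assumes F: "finite F" "F \<subseteq> covers"
  shows "closedin T {k \<in> topspace T. P (restrict k F)}"
proof -
  have "topspace T - {k \<in> topspace T. P (restrict k F)} = {k \<in> topspace T. \<not> P (restrict k F)}" by auto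
  then show ?thesis unfolding closedin_def using openin_T[OF F, of "\<lambda>k. \<not> P k"] by auto
qed

text \<open>A relation rather than a component of \<open>k\<close>, because
  \<open>cover_point\<close> has no room for \<open>x\<close>; the trivial coverings make
  \<open>x\<close> unique. Requiring every finite part to lie in a base component is what makes the
  limit connected.\<close>

definition over :: "('a cover \<Rightarrow> nat) \<Rightarrow> 'a \<Rightarrow> bool" where
  "over k x \<longleftrightarrow> x \<in> points \<Delta> \<and> k \<in> topspace T \<and>
     (\<forall>R F. admissible R F \<longrightarrow> (R `` {x}, restrict k F) \<in> points (C R F))"

lemma overD:
  assumes "over k x"
  shows "x \<in> points \<Delta>" "k \<in> Pi\<^sub>E covers (\<lambda>j. points (ctot j))"
    "admissible R F \<Longrightarrow> (R `` {x}, restrict k F) \<in> points (C R F)"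
    "admissible R F \<Longrightarrow> (R `` {x}, restrict k F) \<in> points (FP R F)"
  using assms component_subset(3)[OF FP_facts(1), of R F "base R F"] unfolding over_def by auto

lemma over_class:
  assumes k: "over k x" and j: "j \<in> covers"
  shows "cproj j (k j) = crel j `` {x}"
  using FP_point(2)[OF admissible_single[OF j] overD(1)[OF k] overD(4)[OF k admissible_single[OF j]], of j] by simp

text \<open>The quotient \<open>Q R\<close>, with numbered classes, is a covering of itself. Its
  coordinate in a family records the \<open>R\<close>-class of the point below.\<close>

lemma trivial_cover:
  assumes R: "cce R"
  shows "\<exists>j\<in>covers. crel j = R"
proof -
  let ?k = "label \<Delta> R"
  have c: "compatible \<Delta> (ker \<Delta> ?k)" using ker_label[OF R] cceD(2)[OF R] by simp
  note o = push_graph_onto[OF graph c] and g = is_graph_push_graph[OF graph c] and q = Q_facts[OF R]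
  have "label \<Delta> R x = label \<Delta> R y \<longleftrightarrow> R `` {x} = R `` {y}" if "x \<in> points \<Delta>" "y \<in> points \<Delta>" for x y
    using that ker_label[OF R] q(5) ker_iff[of x y \<Delta> ?k] ker_iff[of x y \<Delta> "\<lambda>x. R `` {x}"] by simp
  from graph_iso_of_same_ker[OF o q(4) graph this] obtain i where
    i: "graph_iso (push_graph \<Delta> ?k) (Q R) i" "\<And>x. x \<in> points \<Delta> \<Longrightarrow> i (?k x) = R `` {x}" by blast
  have "finite_covering (push_graph \<Delta> ?k) (Q R) i"
    unfolding finite_covering_def
    using g q(1,2) locally_bijective_iso[OF i(1) g q(1)] finite_label[OF cceD(3)[OF R]]
    by (simp add: push_graph_verts(3))
  moreover have "?k v0 \<in> verts (push_graph \<Delta> ?k)" using base_vertex by (simp add: push_graph_verts)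
  ultimately have "(R, push_graph \<Delta> ?k, i, ?k v0) \<in> covers"
    unfolding covers_def using R i(2) base_vertex by (simp add: in_points_iff)
  then show ?thesis by (intro bexI[of _ "(R, push_graph \<Delta> ?k, i, ?k v0)"]) auto
qed

lemma over_class_eq:
  assumes k: "over k x" "over l y" and R: "cce R" and j: "j \<in> covers" "crel j = R" "k j = l j"
  shows "(x, y) \<in> R"
  using over_class[OF k(1) j(1)] over_class[OF k(2) j(1)] j(2,3)
    equiv_class_eq_iff_rel[OF cceD(4)[OF R] overD(1)[OF k(1)] overD(1)[OF k(2)]] by simp

text \<open>The coordinates of the trivial coverings determine all classes of the point below, and
  the uniformity of \<Delta> is Hausdorff.\<close>

lemma over_unique:
  assumes "over k x" "over k y"
  shows "x = y"
  using cofinite_separated[OF cofinite overD(1)[OF assms(1)]] over_class_eq[OF assms] trivial_cover by metis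

definition proj :: "('a cover \<Rightarrow> nat) \<Rightarrow> 'a" where
  "proj k = (THE x. over k x)"

lemma proj_eq: "over k x \<Longrightarrow> proj k = x"
  unfolding proj_def using over_unique by blast

lemma over_vert:
  assumes k: "over k x" and x: "x \<in> verts \<Delta>"
  shows "admissible R F \<Longrightarrow> (R `` {x}, restrict k F) \<in> verts (C R F)" "k \<in> Pi\<^sub>E covers (\<lambda>j. verts (ctot j))"
proof -
  show v: "(R `` {x}, restrict k F) \<in> verts (C R F)" if a: "admissible R F" for R F
  proof -
    have "(R `` {x}, restrict k F) \<notin> edges (FP R F)"
      using FP_edge_class[OF a overD(1)[OF k]] graph_disjoint[OF graph x] by auto
    then show ?thesis using overD(3)[OF k a] by (auto simp: in_points_iff)
  qed
  have "k j \<in> verts (ctot j)" if j: "j \<in> covers" for j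
    using reach_verts(2)[OF FP_facts(1)] v[OF admissible_single[OF j]] admissible_single[OF j]
      FP_vert_class[OF admissible_single[OF j] overD(1)[OF k], of "restrict k {j}"] by (auto simp: PiE_iff)
  then show "k \<in> Pi\<^sub>E covers (\<lambda>j. verts (ctot j))" using overD(2)[OF k] by (auto simp: PiE_iff)
qed

lemma over_edge:
  assumes k: "over k x" and x: "x \<in> edges \<Delta>"
  shows "admissible R F \<Longrightarrow> (R `` {x}, restrict k F) \<in> edges (C R F)" "k \<in> Pi\<^sub>E covers (\<lambda>j. edges (ctot j))"
proof -
  have e: "(R `` {x}, restrict k F) \<in> edges (FP R F)" if a: "admissible R F" for R F
  proof -
    have "(R `` {x}, restrict k F) \<notin> verts (FP R F)"
      using FP_vert_class[OF a overD(1)[OF k]] graph_disjoint[OF graph _ x] by auto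
    then show ?thesis using overD(4)[OF k a] by (auto simp: in_points_iff)
  qed
  show "(R `` {x}, restrict k F) \<in> edges (C R F)" if a: "admissible R F" for R F
    using e[OF a] overD(3)[OF k a] graph_disjoint[OF FP_facts(1)[OF a]] component_subset(1)[OF FP_facts(1)[OF a]]
    unfolding in_points_iff by blast
  have "k j \<in> edges (ctot j)" if j: "j \<in> covers" for j
    using e[OF admissible_single[OF j]]
      FP_edge_class[OF admissible_single[OF j] overD(1)[OF k], of "restrict k {j}"] by (auto simp: PiE_iff)
  then show "k \<in> Pi\<^sub>E covers (\<lambda>j. edges (ctot j))" using overD(2)[OF k] by (auto simp: PiE_iff)
qed

section \<open>The universal covering as a compact graph with a uniformity\<close>

definition level_map :: "('a \<times> 'a) set \<Rightarrow> 'a cover set \<Rightarrow> ('a cover \<Rightarrow> nat) \<Rightarrow> 'a set \<times> ('a cover \<Rightarrow> nat)" where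
  "level_map R F k = (R `` {proj k}, restrict k F)"

definition universal :: "'a cover_point ugraph" where
  "universal = \<lparr>verts = {k. \<exists>x\<in>verts \<Delta>. over k x}, edges = {k. \<exists>x\<in>edges \<Delta>. over k x},
     source = (\<lambda>k. \<lambda>j\<in>covers. source (ctot j) (k j)),
     target = (\<lambda>k. \<lambda>j\<in>covers. target (ctot j) (k j)),
     opp = (\<lambda>k. \<lambda>j\<in>covers. opp (ctot j) (k j)),
     entourages = {E. E \<subseteq> {k. \<exists>x. over k x} \<times> {k. \<exists>x. over k x} \<and> (\<exists>R F. admissible R F \<and>
       (\<forall>k l. (\<exists>x. over k x) \<and> (\<exists>x. over l x) \<and> level_map R F k = level_map R F l \<longrightarrow> (k, l) \<in> E))}\<rparr>"

lemma universal_simps [simp]: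
  "verts universal = {k. \<exists>x\<in>verts \<Delta>. over k x}" "edges universal = {k. \<exists>x\<in>edges \<Delta>. over k x}"
  "source universal k = (\<lambda>j\<in>covers. source (ctot j) (k j))"
  "target universal k = (\<lambda>j\<in>covers. target (ctot j) (k j))"
  "opp universal k = (\<lambda>j\<in>covers. opp (ctot j) (k j))"
  by (auto simp: universal_def)

lemma universal_points: "k \<in> points universal \<longleftrightarrow> (\<exists>x. over k x)"
  using overD(1) by (auto simp: in_points_iff)

lemma universal_points_over: "k \<in> points universal \<Longrightarrow> over k (proj k)"
  using proj_eq unfolding universal_points by auto

lemma universal_entourage:
  "E \<in> entourages universal \<longleftrightarrow> E \<subseteq> points universal \<times> points universal \<and>
     (\<exists>R F. admissible R F \<and> ker universal (level_map R F) \<subseteq> E)"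
proof -
  have "points universal = {k. \<exists>x. over k x}" using universal_points by blast
  moreover have "ker universal (level_map R F) \<subseteq> E \<longleftrightarrow>
      (\<forall>k l. (\<exists>x. over k x) \<and> (\<exists>x. over l x) \<and> level_map R F k = level_map R F l \<longrightarrow> (k, l) \<in> E)" for R F
    by (simp only: subset_iff split_paired_All ker_iff universal_points)
  ultimately show ?thesis by (simp add: universal_def)
qed

text \<open>Components are closed under sources, targets and opposites of their edges, so all finite
  parts of the new families again lie in the base components.\<close>

lemma over_steps:
  assumes k: "over k x" and x: "x \<in> edges \<Delta>"
  shows "over (source universal k) (source \<Delta> x)" "over (target universal k) (target \<Delta> x)"
    "over (opp universal k) (opp \<Delta> x)"
    "admissible R F \<Longrightarrow> level_map R F (source universal k) = source (FP R F) (level_map R F k)"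
    "admissible R F \<Longrightarrow> level_map R F (target universal k) = target (FP R F) (level_map R F k)"
    "admissible R F \<Longrightarrow> level_map R F (opp universal k) = opp (FP R F) (level_map R F k)"
proof -
  note ex = graph_edge[OF graph x] and kE = over_edge[OF k x]
  have ek: "k j \<in> edges (ctot j)" if "j \<in> covers" for j using kE(2) that by auto
  have e: "source (FP R F) (R `` {x}, restrict k F) = (R `` {source \<Delta> x}, restrict (source universal k) F)"
    "target (FP R F) (R `` {x}, restrict k F) = (R `` {target \<Delta> x}, restrict (target universal k) F)"
    "opp (FP R F) (R `` {x}, restrict k F) = (R `` {opp \<Delta> x}, restrict (opp universal k) F)"
    if a: "admissible R F" for R F
    using graph_map_on(4-6)[OF graph_onto_map[OF Q_facts(4)[OF admissibleD(1)[OF a]]] x] admissibleD(4)[OF a]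
    unfolding FP_def by (auto simp: restrict_def fun_eq_iff)
  have step: "source (FP R F) (R `` {x}, restrict k F) \<in> points (C R F)"
    "target (FP R F) (R `` {x}, restrict k F) \<in> points (C R F)"
    "opp (FP R F) (R `` {x}, restrict k F) \<in> points (C R F)" if a: "admissible R F" for R F
    using graph_edge(1-3)[OF C_facts(1)[OF a] kE(1)[OF a]] unfolding in_points_iff by simp_all
  show s: "over (source universal k) (source \<Delta> x)" unfolding over_def
    using ex step(1) e(1) graph_edge(1)[OF coversD(2) ek] by (auto simp: in_points_iff PiE_iff)
  show t: "over (target universal k) (target \<Delta> x)" unfolding over_def
    using ex step(2) e(2) graph_edge(2)[OF coversD(2) ek] by (auto simp: in_points_iff PiE_iff)
  show o: "over (opp universal k) (opp \<Delta> x)" unfolding over_def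
    using ex step(3) e(3) graph_edge(3)[OF coversD(2) ek] by (auto simp: in_points_iff PiE_iff)
  show "level_map R F (source universal k) = source (FP R F) (level_map R F k)"
    "level_map R F (target universal k) = target (FP R F) (level_map R F k)"
    "level_map R F (opp universal k) = opp (FP R F) (level_map R F k)" if a: "admissible R F"
    unfolding level_map_def proj_eq[OF k] proj_eq[OF s] proj_eq[OF t] proj_eq[OF o] e[OF a] by simp_all
qed

lemma is_graph_universal: "is_graph universal"
proof -
  \<comment> \<open>A coordinate has to exist, since \<open>opp universal k\<close> is told from
    \<open>k\<close> in a coordinate.\<close>
  obtain R where "cce R" using cce_below cofinite_entourage(1)[OF cofinite] by blast
  then obtain j0 where j0: "j0 \<in> covers" using trivial_cover by blast
  have "verts universal \<inter> edges universal = {}" using over_unique graph_disjoint[OF graph] by auto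
  moreover have "source universal k \<in> verts universal \<and> target universal k \<in> verts universal \<and> opp universal k \<in> edges universal \<and>
        opp universal (opp universal k) = k \<and> opp universal k \<noteq> k \<and>
        source universal (opp universal k) = target universal k \<and> target universal (opp universal k) = source universal k"
    if kU: "k \<in> edges universal" for k
  proof -
    obtain x where x: "x \<in> edges \<Delta>" and k: "over k x" using kU by auto
    note s = over_steps[OF k x] and ex = graph_edge[OF graph x]
    have ek: "k j \<in> edges (ctot j)" if "j \<in> covers" for j using over_edge(2)[OF k x] that by auto
    note el = graph_edge[OF coversD(2) ek]
    have "opp universal (opp universal k) = k"
      by (rule extensionalityI[of _ covers]) (use overD(2)[OF k, unfolded PiE_iff] el in auto)
    moreover have "opp universal k j0 \<noteq> k j0" using el(5)[OF j0 j0] j0 by simp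
    then have "opp universal k \<noteq> k" by metis
    moreover have "source universal (opp universal k) = target universal k" "target universal (opp universal k) = source universal k"
      using el by (auto simp: fun_eq_iff restrict_def)
    moreover have "source universal k \<in> verts universal" "target universal k \<in> verts universal" "opp universal k \<in> edges universal"
      using s(1-3) ex unfolding universal_simps(1,2) by blast+
    ultimately show ?thesis by blast
  qed
  ultimately show ?thesis unfolding is_graph_def by blast
qed

lemma proj_map: "graph_map universal \<Delta> proj"
proof (rule graph_mapI)
  fix k assume "k \<in> edges universal"
  then obtain x where x: "x \<in> edges \<Delta>" and k: "over k x" by auto
  note s = over_steps[OF k x]
  show "proj k \<in> edges \<Delta>" "proj (source universal k) = source \<Delta> (proj k)"
    "proj (target universal k) = target \<Delta> (proj k)" "proj (opp universal k) = opp \<Delta> (proj k)"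
    using proj_eq[OF k] x s(1-3)[THEN proj_eq] by auto
qed (use proj_eq in auto)

lemma level_map_map:
  assumes a: "admissible R F"
  shows "graph_map universal (C R F) (level_map R F)"
proof (rule graph_mapI)
  fix k assume "k \<in> edges universal"
  then obtain x where x: "x \<in> edges \<Delta>" and k: "over k x" by auto
  show "level_map R F k \<in> edges (C R F)" unfolding level_map_def proj_eq[OF k] by (rule over_edge(1)[OF k x a])
  show "level_map R F (source universal k) = source (C R F) (level_map R F k)"
    "level_map R F (target universal k) = target (C R F) (level_map R F k)"
    "level_map R F (opp universal k) = opp (C R F) (level_map R F k)"
    using over_steps(4-6)[OF k x a] by simp_all
next
  fix k assume "k \<in> verts universal"
  then obtain x where x: "x \<in> verts \<Delta>" and k: "over k x" by auto
  show "level_map R F k \<in> verts (C R F)" unfolding level_map_def proj_eq[OF k] by (rule over_vert(1)[OF k x a])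
qed

lemma level_map_entourage: "admissible R F \<Longrightarrow> ker universal (level_map R F) \<in> entourages universal"
  unfolding universal_entourage by (auto simp: ker_iff)

lemma ker_level_map_mono:
  assumes "admissible R1 F1" "admissible R2 F2" "R2 \<subseteq> R1" "F1 \<subseteq> F2"
  shows "ker universal (level_map R2 F2) \<subseteq> ker universal (level_map R1 F1)"
proof (rule subrelI)
  fix k l assume kl: "(k, l) \<in> ker universal (level_map R2 F2)"
  then have p: "proj k \<in> points \<Delta>" "proj l \<in> points \<Delta>"
    using graph_map_on(3)[OF proj_map] by (auto simp: ker_iff)
  have "R2 `` {proj k} = R2 `` {proj l}" "restrict k F2 = restrict l F2" using kl by (auto simp: ker_iff level_map_def)
  moreover have "restrict k F1 = restrict l F1"
    using calculation(2) assms(4) by (metis inf.absorb_iff2 restrict_restrict)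
  moreover have "R1 `` {proj k} = R1 `` {proj l}"
    using calculation(1) quotient_refine(1)[OF admissibleD(1)[OF assms(2)] admissibleD(1)[OF assms(1)] assms(3) graph] p by metis
  ultimately show "(k, l) \<in> ker universal (level_map R1 F1)" using kl by (auto simp: ker_iff level_map_def)
qed

text \<open>Kernels of level maps form a base of the uniformity: any two contain a third, taken for
  the union of the sets of coverings over a common refinement. Single coordinates separate points,
  and each quotient embeds in a finite graph.\<close>

lemma cofinite_universal: "cofinite_graph universal"
proof -
  obtain R0 where R0: "cce R0" using cce_below cofinite_entourage(1)[OF cofinite] by blast
  have a0: "admissible R0 {}" using R0 unfolding admissible_def by simp
  let ?P = "points universal" and ?k = "\<lambda>R F. ker universal (level_map R F)"
  have "uniformity_on ?P (entourages universal)"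
    unfolding uniformity_on_def
  proof (intro conjI ballI allI impI)
    show "entourages universal \<noteq> {}" using level_map_entourage[OF a0] by blast
    fix E assume "E \<in> entourages universal"
    then obtain R F where E: "E \<subseteq> ?P \<times> ?P" "admissible R F" "?k R F \<subseteq> E" unfolding universal_entourage by blast
    show "Id_on ?P \<subseteq> E" using E(3) by (auto simp: ker_iff)
    show "E \<subseteq> ?P \<times> ?P" using E(1) .
    have "?k R F \<subseteq> E\<inverse>" using E(3) by (auto simp: ker_iff)
    then show "E\<inverse> \<in> entourages universal" unfolding universal_entourage using E(1,2) by blast
    have "?k R F O ?k R F \<subseteq> E" using E(3) by (auto simp: ker_iff)
    then show "\<exists>F\<in>entourages universal. F O F \<subseteq> E" using level_map_entourage[OF E(2)] by blast
    show "F \<in> entourages universal" if "E \<subseteq> F \<and> F \<subseteq> ?P \<times> ?P" for F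
      unfolding universal_entourage using that E(2,3) by blast
    fix E' assume "E' \<in> entourages universal"
    then obtain R' F' where E': "E' \<subseteq> ?P \<times> ?P" "admissible R' F'" "?k R' F' \<subseteq> E'" unfolding universal_entourage by blast
    obtain R'' where R'': "admissible R'' (F \<union> F')" "R'' \<subseteq> R" "R'' \<subseteq> R'" using admissible_common[OF E(2) E'(2)] by blast
    have "?k R'' (F \<union> F') \<subseteq> E \<inter> E'"
      using ker_level_map_mono[OF E(2) R''(1,2)] ker_level_map_mono[OF E'(2) R''(1,3)] E(3) E'(3) by blast
    then show "E \<inter> E' \<in> entourages universal" unfolding universal_entourage using E(1) R''(1) by blast
  qed
  moreover have "\<Inter>(entourages universal) = Id_on ?P"
  proof (intro equalityI subrelI)
    fix k l assume kl: "(k, l) \<in> \<Inter>(entourages universal)"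
    then have p: "k \<in> ?P" "l \<in> ?P" using level_map_entourage[OF a0] by (auto simp: ker_iff)
    have "k = l"
    proof (rule extensionalityI)
      show "k \<in> extensional covers" "l \<in> extensional covers"
        using p[THEN universal_points_over, THEN overD(2)] by (auto simp: PiE_iff)
      fix j assume j: "j \<in> covers"
      have "level_map (crel j) {j} k = level_map (crel j) {j} l"
        using kl level_map_entourage[OF admissible_single[OF j]] by (auto simp: ker_iff)
      then have "restrict k {j} j = restrict l {j} j" unfolding level_map_def by simp
      then show "k j = l j" by simp
    qed
    then show "(k, l) \<in> Id_on ?P" using p by auto
  next
    fix k l assume "(k, l) \<in> Id_on ?P"
    moreover have "(k, k) \<in> E" if "k \<in> ?P" "E \<in> entourages universal" for E
      using that unfolding universal_entourage by (auto simp: ker_iff subset_iff)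
    ultimately show "(k, l) \<in> \<Inter>(entourages universal)" by auto
  qed
  moreover have "\<exists>R. R \<subseteq> E \<and> compatible_cofinite_entourage universal R" if E: "E \<in> entourages universal" for E
  proof -
    obtain R F where "admissible R F" "?k R F \<subseteq> E" using E unfolding universal_entourage by blast
    then show ?thesis
      using cce_ker[OF level_map_map is_graph_universal C_facts(1,2) level_map_entourage] by blast
  qed
  ultimately show ?thesis unfolding cofinite_graph_def using is_graph_universal by blast
qed

text \<open>The pairs of a point of \<Delta> and a family over it form a closed set in a compact
  product, since every failure is detected by finitely many coordinates and one class. The
  projection of this set to the families is compact, and the uniform topology has no more open sets
  than the product topology.\<close>

lemma compact_universal: "compact_space (gtop universal)"
proof -
  let ?X = "prod_topology (gtop \<Delta>) T" and ?Z = "{(x, k). over k x}" and ?P = "points universal"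
  have top: "topspace ?X = points \<Delta> \<times> topspace T" using topspace_gtop[OF cofinite] by simp
  have "compact_space ?X"
    using compact_T profinite_graphD(3)[OF profinite] by (simp add: compact_space_prod_topology)
  moreover have "closedin ?X ?Z"
    unfolding closedin_def
  proof (intro conjI)
    show "?Z \<subseteq> topspace ?X" unfolding top over_def by auto
    show "openin ?X (topspace ?X - ?Z)"
      unfolding openin_prod_topology_alt
    proof (intro allI impI)
      fix x k assume xk: "(x, k) \<in> topspace ?X - ?Z"
      then have x: "x \<in> points \<Delta>" "k \<in> topspace T" unfolding top by auto
      then obtain R F where RF: "admissible R F" "(R `` {x}, restrict k F) \<notin> points (C R F)"
        using xk unfolding over_def by auto
      let ?V = "{y \<in> points \<Delta>. R `` {y} = R `` {x}}" and ?W = "{l \<in> topspace T. restrict l F = restrict k F}"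
      have "openin (gtop \<Delta>) ?V"
        using openin_fibres[OF cofinite, of "\<lambda>y. R `` {y}" "\<lambda>A. A = R `` {x}"]
          Q_facts(5)[OF admissibleD(1)[OF RF(1)]] cceD(1)[OF admissibleD(1)[OF RF(1)]] by simp
      moreover have "openin T ?W" by (rule openin_T[OF admissibleD(2,3)[OF RF(1)]])
      moreover have "?V \<times> ?W \<subseteq> topspace ?X - ?Z"
      proof
        fix z assume "z \<in> ?V \<times> ?W"
        then obtain y l where z: "z = (y, l)" "y \<in> ?V" "l \<in> ?W" by blast
        then have "(R `` {y}, restrict l F) \<notin> points (C R F)" using RF(2) by simp
        then have "\<not> over l y" using RF(1) unfolding over_def by metis
        then show "z \<in> topspace ?X - ?Z" using z unfolding top by auto
      qed
      ultimately show "\<exists>V W. openin (gtop \<Delta>) V \<and> openin T W \<and> x \<in> V \<and> k \<in> W \<and> V \<times> W \<subseteq> topspace ?X - ?Z"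
        using x by (intro exI[of _ ?V] exI[of _ ?W]) auto
    qed
  qed
  ultimately have "compactin ?X ?Z" by (rule closedin_compact_space)
  then have "compactin T (snd ` ?Z)" by (rule image_compactin) (rule continuous_map_snd)
  moreover have "snd ` ?Z = ?P" by (auto simp: universal_points image_iff)
  ultimately have "compactin T ?P" by simp
  then have "compactin (subtopology T ?P) ?P" by (simp add: compactin_subtopology)
  moreover have "topspace (subtopology T ?P) = topspace (gtop universal)"
    unfolding topspace_gtop[OF cofinite_universal] using universal_points_over[THEN overD(2)] by auto
  moreover have "openin (subtopology T ?P) W" if W: "openin (gtop universal) W" for W
  proof (subst openin_subopen, intro ballI)
    fix k assume k: "k \<in> W"
    then obtain E where E: "E \<in> entourages universal" "E `` {k} \<subseteq> W" and WP: "W \<subseteq> ?P"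
      using W unfolding openin_gtop[OF cofinite_universal] by blast
    obtain R F where RF: "admissible R F" "ker universal (level_map R F) \<subseteq> E" using E(1) unfolding universal_entourage by blast
    \<comment> \<open>The level map also depends on the class of \<open>proj k\<close>; the trivial
      covering \<open>j\<close> is added so that this class is fixed by a coordinate.\<close>
    obtain j where j: "j \<in> covers" "crel j = R" using trivial_cover[OF admissibleD(1)[OF RF(1)]] by blast
    let ?V = "{l \<in> topspace T. restrict l (insert j F) = restrict k (insert j F)}"
    have "openin T ?V" by (rule openin_T) (use j admissibleD(2,3)[OF RF(1)] in auto)
    moreover have "?V \<inter> ?P \<subseteq> W"
    proof
      fix l assume l: "l \<in> ?V \<inter> ?P"
      then have eq: "l i = k i" if "i \<in> insert j F" for i using that by (metis (mono_tags, lifting) IntD1 mem_Collect_eq restrict_apply')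
      have o: "over k (proj k)" "over l (proj l)" using universal_points_over k l WP by auto
      have "(proj k, proj l) \<in> R"
        using over_class_eq[OF o admissibleD(1)[OF RF(1)] j] eq by simp
      then have "R `` {proj k} = R `` {proj l}" using equiv_class_eq[OF cceD(4)[OF admissibleD(1)[OF RF(1)]]] by simp
      moreover have "restrict k F = restrict l F" using eq by (intro restrict_ext) auto
      ultimately have "(k, l) \<in> ker universal (level_map R F)" using k l WP by (auto simp: ker_iff level_map_def)
      then show "l \<in> W" using RF(2) E(2) by blast
    qed
    moreover have "k \<in> ?V \<inter> ?P" using k WP universal_points_over[THEN overD(2)] by auto
    ultimately show "\<exists>B. openin (subtopology T ?P) B \<and> k \<in> B \<and> B \<subseteq> W"
      by (intro exI[of _ "?V \<inter> ?P"]) (auto intro: openin_subtopology_Int)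
  qed
  ultimately have "compactin (gtop universal) ?P" by (rule compactin_contractive)
  then show ?thesis unfolding compact_space_def topspace_gtop[OF cofinite_universal] .
qed

lemma profinite_universal: "profinite_graph universal"
  unfolding profinite_graph_def using cofinite_universal compact_universal by simp

section \<open>Lifting from finite levels to the limit, and Galois levels\<close>

text \<open>Compactness extends \<open>l\<close> to all coordinates: \<open>K\<close> collects, for
  each larger finite level, the families that extend \<open>l\<close> and lie in the base component
  over \<open>x\<close>. These sets are nonempty because over one fixed quotient the map that
  forgets the added coordinates is locally bijective and so maps the base component onto the base
  component.\<close>

lemma lift_to_universal:
  assumes a: "admissible R F" and x: "x \<in> points \<Delta>"
    and l: "\<And>R'. cce R' \<Longrightarrow> R' \<subseteq> R \<Longrightarrow> (R' `` {x}, l) \<in> points (C R' F)"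
  shows "\<exists>k. over k x \<and> restrict k F = l"
proof -
  define I where "I = {(R', F'). admissible R' F' \<and> R' \<subseteq> R \<and> F \<subseteq> F'}"
  \<comment> \<open>The repeated \<open>restrict\<close> presents the condition as one on the
    restriction to \<open>F'\<close>, as \<open>closedin_T\<close> requires; \<open>KI\<close>
    removes it.\<close>
  define K where "K = (\<lambda>(R', F'). {k \<in> topspace T. (R' `` {x}, restrict (restrict k F') F') \<in> points (C R' F') \<and> restrict (restrict k F') F = l})"
  have KI: "K (R', F') = {k \<in> topspace T. (R' `` {x}, restrict k F') \<in> points (C R' F') \<and> restrict k F = l}"
    if "(R', F') \<in> I" for R' F'
  proof -
    have "F' \<inter> F = F" using that unfolding I_def by auto
    then show ?thesis unfolding K_def by (simp add: restrict_restrict)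
  qed
  have "\<exists>k. \<forall>i\<in>I. k \<in> K i"
  proof (rule directed_fip[OF compact_T])
    show "I \<noteq> {}" using a unfolding I_def by blast
    fix i assume i: "i \<in> I"
    then obtain R' F' where RF: "i = (R', F')" "admissible R' F'" "R' \<subseteq> R" "F \<subseteq> F'" unfolding I_def by auto
    note c = admissibleD(1)[OF RF(2)]
    have aF: "admissible R' F" by (rule admissible_mono[OF a c RF(3)])
    show "closedin T (K i)" unfolding RF(1) K_def
      using closedin_T[OF admissibleD(2,3)[OF RF(2)], of "\<lambda>k. (R' `` {x}, restrict k F') \<in> points (C R' F') \<and> restrict k F = l"]
      by simp
    note sh = shrink_map[OF aF RF(2) order_refl RF(4)]
    \<comment> \<open>Both products are coverings of the same \<open>Q R'\<close>, so a map between
      them over \<open>Q R'\<close> is locally bijective.\<close>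
    have lb: "locally_bijective (FP R' F') (FP R' F) (shrink R' F)"
    proof (rule locally_bijective_factor[OF sh(1) FP_facts(2)[OF RF(2)] FP_facts(2)[OF aF] _ FP_facts(1)[OF RF(2)] FP_facts(1)[OF aF]])
      fix z assume "z \<in> points (FP R' F')"
      then have "fst z \<in> points (Q R')"
        using graph_map_on(3)[OF locally_bijective_map[OF FP_facts(2)[OF RF(2)]]] by blast
      then obtain y where "y \<in> points \<Delta>" "fst z = R' `` {y}" using graph_onto_point[OF Q_facts(4)[OF c]] by blast
      then show "fst (shrink R' F z) = fst z" using sh(3) by (metis fst_conv prod.collapse)
    qed
    have "(R' `` {x}, l) \<in> points (component (FP R' F) (shrink R' F (base R' F')))"
      unfolding sh(2) by (rule l[OF c RF(3)])
    from component_lift[OF lb FP_facts(1)[OF RF(2)] FP_facts(1)[OF aF] base_vert[OF RF(2)] this]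
    obtain z where z: "z \<in> points (C R' F')" "shrink R' F z = (R' `` {x}, l)" by blast
    obtain A m where Am: "z = (A, m)" by (cases z)
    have zF: "z \<in> points (FP R' F')" using z(1) component_subset(3)[OF FP_facts(1)[OF RF(2)]] by blast
    then have "A \<in> points (Q R')"
      using graph_map_on(3)[OF locally_bijective_map[OF FP_facts(2)[OF RF(2)]]] Am by fastforce
    then obtain y where y: "y \<in> points \<Delta>" "A = R' `` {y}" using graph_onto_point[OF Q_facts(4)[OF c]] by blast
    then have A: "A = R' `` {x}" and m: "restrict m F = l" using z(2) sh(3)[OF y(1)] Am by auto
    have mF: "m \<in> Pi\<^sub>E F' (\<lambda>j. points (ctot j))" using FP_point(1)[OF RF(2) y(1)] zF Am y(2) by simp
    \<comment> \<open>Coordinates outside \<open>F'\<close> are free at this level; base points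
      serve as default values in the product space.\<close>
    let ?k = "\<lambda>j\<in>covers. if j \<in> F' then m j else cbase j"
    have "?k \<in> topspace T"
      using mF coversD(5) by (auto simp: in_points_iff PiE_iff)
    moreover have "restrict ?k F' = m"
      using mF admissibleD(3)[OF RF(2)] by (intro extensionalityI[of _ F']) (auto simp: PiE_iff)
    moreover have "restrict ?k F = restrict (restrict ?k F') F" using RF(4) by (auto simp: fun_eq_iff restrict_def)
    ultimately have "?k \<in> K i" using z(1) m unfolding RF(1) KI[OF i[unfolded RF(1)]] Am A by simp
    then show "K i \<noteq> {}" by blast
    fix i' assume i': "i' \<in> I"
    then obtain R2 F2 where RF2: "i' = (R2, F2)" "admissible R2 F2" "R2 \<subseteq> R" "F \<subseteq> F2" unfolding I_def by auto
    obtain R3 where R3: "admissible R3 (F' \<union> F2)" "R3 \<subseteq> R'" "R3 \<subseteq> R2" using admissible_common[OF RF(2) RF2(2)] by blast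
    have I3: "(R3, F' \<union> F2) \<in> I" using R3 RF(3,4) unfolding I_def by auto
    have "K (R3, F' \<union> F2) \<subseteq> K i \<inter> K i'"
    proof
      fix k assume "k \<in> K (R3, F' \<union> F2)"
      then have k: "k \<in> topspace T" "(R3 `` {x}, restrict k (F' \<union> F2)) \<in> points (C R3 (F' \<union> F2))" "restrict k F = l"
        unfolding KI[OF I3] by auto
      have "(F' \<union> F2) \<inter> F' = F'" "(F' \<union> F2) \<inter> F2 = F2" by auto
      then have "(R' `` {x}, restrict k F') \<in> points (C R' F')" "(R2 `` {x}, restrict k F2) \<in> points (C R2 F2)"
        using graph_map_on(3)[OF shrink_C[OF RF(2) R3(1,2)] k(2)] shrink_map(3)[OF RF(2) R3(1,2) _ x]
          graph_map_on(3)[OF shrink_C[OF RF2(2) R3(1,3)] k(2)] shrink_map(3)[OF RF2(2) R3(1,3) _ x]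
        by (auto simp: restrict_restrict)
      then show "k \<in> K i \<inter> K i'"
        unfolding RF(1) RF2(1) KI[OF i[unfolded RF(1)]] KI[OF i'[unfolded RF2(1)]] using k by simp
    qed
    then show "\<exists>k\<in>I. K k \<subseteq> K i \<inter> K i'" using I3 by blast
  qed
  then obtain k where k: "\<And>i. i \<in> I \<Longrightarrow> k \<in> K i" by blast
  have RI: "(R, F) \<in> I" using a unfolding I_def by simp
  have kT: "k \<in> topspace T" and kl: "restrict k F = l" using k[OF RI] unfolding KI[OF RI] by auto
  have "(R1 `` {x}, restrict k F1) \<in> points (C R1 F1)" if a1: "admissible R1 F1" for R1 F1
  proof -
    obtain R3 where R3: "admissible R3 (F \<union> F1)" "R3 \<subseteq> R" "R3 \<subseteq> R1" using admissible_common[OF a a1] by blast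
    have I3: "(R3, F \<union> F1) \<in> I" using R3 unfolding I_def by auto
    have "(R3 `` {x}, restrict k (F \<union> F1)) \<in> points (C R3 (F \<union> F1))" using k[OF I3] unfolding KI[OF I3] by simp
    moreover have "(F \<union> F1) \<inter> F1 = F1" by auto
    ultimately show ?thesis
      using graph_map_on(3)[OF shrink_C[OF a1 R3(1,3)], of "(R3 `` {x}, restrict k (F \<union> F1))"]
        shrink_map(3)[OF a1 R3(1,3) _ x, of "restrict k (F \<union> F1)"]
      by (simp add: restrict_restrict)
  qed
  then show ?thesis using x kT kl unfolding over_def by blast
qed

text \<open>Stability provides the points over all finer quotients from which the compactness
  argument starts.\<close>

lemma stable_lift:
  assumes s: "stable R F" and x: "x \<in> points \<Delta>" and z: "(R `` {x}, l) \<in> points (C R F)"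
  shows "\<exists>k. over k x \<and> level_map R F k = (R `` {x}, l)"
proof -
  have "admissible R F" "\<And>R'. cce R' \<Longrightarrow> R' \<subseteq> R \<Longrightarrow> (R' `` {x}, l) \<in> points (C R' F)"
    using s x z unfolding stable_def by blast+
  from lift_to_universal[OF this(1) x this(2)] show ?thesis unfolding level_map_def using proj_eq by blast
qed

lemma level_map_onto:
  assumes s: "stable R F"
  shows "graph_onto universal (C R F) (level_map R F)"
proof (rule graph_ontoI)
  have a: "admissible R F" using s unfolding stable_def by simp
  show "graph_map universal (C R F) (level_map R F)" by (rule level_map_map[OF a])
  show "\<exists>k\<in>verts universal. z = level_map R F k" if z: "z \<in> verts (C R F)" for z
  proof -
    obtain A l where Al: "z = (A, l)" by (cases z)
    then have "(A, l) \<in> verts (FP R F)" using z component_subset(1)[OF FP_facts(1)[OF a]] by blast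
    then obtain x where x: "x \<in> verts \<Delta>" "A = R `` {x}" using FP_vertE[OF a] by metis
    then obtain k where "over k x" "level_map R F k = z"
      using stable_lift[OF s, of x l] z Al by (auto simp: in_points_iff)
    then show ?thesis using x by auto
  qed
  show "\<exists>k\<in>edges universal. z = level_map R F k" if z: "z \<in> edges (C R F)" for z
  proof -
    obtain A l where Al: "z = (A, l)" by (cases z)
    then have "(A, l) \<in> edges (FP R F)" using z component_subset(2)[OF FP_facts(1)[OF a]] by blast
    then obtain x where x: "x \<in> edges \<Delta>" "A = R `` {x}" using FP_edgeE[OF a] by metis
    then obtain k where "over k x" "level_map R F k = z"
      using stable_lift[OF s, of x l] z Al by (auto simp: in_points_iff)
    then show ?thesis using x by auto
  qed
qed

text \<open>The level with no coverings maps onto a quotient of \<Delta> by path lifting, and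
  stability lifts a vertex over the class of \<open>x\<close> to one over \<open>x\<close>
  itself.\<close>

lemma proj_surj:
  assumes x: "x \<in> verts \<Delta>"
  shows "\<exists>k\<in>verts universal. proj k = x"
proof -
  obtain R where "cce R" using cce_below cofinite_entourage(1)[OF cofinite] by blast
  then have "admissible R {}" unfolding admissible_def by simp
  then obtain R0 where s: "stable R0 {}" using stable_component by blast
  then have a: "admissible R0 {}" unfolding stable_def by simp
  note c = C_facts[OF a] and q = Q_facts[OF admissibleD(1)[OF a]]
  have o: "graph_onto (C R0 {}) (Q R0) fst" by (rule covering_onto[OF c(4,1) _ q(1,3)]) (use c(5) in blast)
  obtain z where "z \<in> verts (C R0 {})" "R0 `` {x} = fst z"
    using graph_onto_vert[OF o graph_map_on(1)[OF graph_onto_map[OF q(4)] x]] by blast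
  then have "(R0 `` {x}, snd z) \<in> points (C R0 {})" by (simp add: in_points_iff)
  then obtain k where "over k x" using stable_lift[OF s, of x] x by (auto simp: in_points_iff)
  then show ?thesis using x proj_eq by auto
qed

text \<open>
  If \<open>F\<close> contains with a covering also its copies with all other base points over \<open>v0\<close>, then changing
  base points permutes the coordinates, and this gives deck transformations.
\<close>

lemma galois_component:
  assumes a: "admissible R F"
    and sat: "\<And>R' X q b b'. (R', X, q, b) \<in> F \<Longrightarrow> b' \<in> verts X \<Longrightarrow> q b' = R' `` {v0} \<Longrightarrow> (R', X, q, b') \<in> F"
  shows "galois (C R F) (Q R) fst"
proof -
  note c = C_facts[OF a] and q = Q_facts[OF admissibleD(1)[OF a]] and f = FP_facts[OF a]
  have v0: "v0 \<in> points \<Delta>" using base_vertex by (simp add: in_points_iff)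
  have "\<exists>\<tau>. graph_map (C R F) (C R F) \<tau> \<and> (\<forall>z\<in>points (C R F). fst (\<tau> z) = fst z) \<and> \<tau> (base R F) = z'"
    if z': "z' \<in> verts (C R F)" "fst z' = fst (base R F)" for z'
  proof -
    obtain l' where l': "z' = (R `` {v0}, l')" using z'(2) unfolding base_def by (cases z') auto
    have r': "reach (FP R F) (base R F) z'" using z'(1) by simp
    have "(R `` {v0}, l') \<in> verts (FP R F)" using reach_verts(2)[OF f(1) r'] l' by simp
    then have lv: "l' \<in> Pi\<^sub>E F (\<lambda>j. verts (ctot j))" "\<And>j. j \<in> F \<Longrightarrow> cproj j (l' j) = crel j `` {v0}"
      unfolding FP_vert_class[OF a v0] by auto
    \<comment> \<open>The same covering as \<open>j\<close>, based at the coordinate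
      \<open>l' j\<close>. When coordinate \<open>\<sigma> j\<close> is read in place of
      \<open>j\<close>, the family of base points turns into \<open>l'\<close>.\<close>
    define \<sigma> where "\<sigma> j = (crel j, ctot j, cproj j, l' j)" for j
    have \<sigma>: "\<sigma> j \<in> F" "crel (\<sigma> j) = crel j" "ctot (\<sigma> j) = ctot j" "cproj (\<sigma> j) = cproj j" "cbase (\<sigma> j) = l' j"
      if j: "j \<in> F" for j
      using sat[of "crel j" "ctot j" "cproj j" "cbase j" "l' j"] lv j unfolding \<sigma>_def by auto
    define \<tau> where "\<tau> z = (fst z, \<lambda>j\<in>F. snd z (\<sigma> j))" for z :: "'a set \<times> ('a cover \<Rightarrow> nat)"
    have base': "\<tau> (base R F) = z'"
      unfolding \<tau>_def base_def l' using \<sigma>(1,5) lv(1) by (auto simp: PiE_iff intro!: extensionalityI[of _ F])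
    have "graph_map (FP R F) (FP R F) \<tau>"
    proof (rule graph_mapI)
      fix z assume "z \<in> verts (FP R F)"
      moreover obtain A l where Al: "z = (A, l)" by (cases z)
      ultimately have A: "A \<in> verts (Q R)" "\<And>j. j \<in> F \<Longrightarrow> l j \<in> verts (ctot j)" "\<And>j. j \<in> F \<Longrightarrow> cproj j (l j) = crel j `` A"
        unfolding FP_def by (auto simp: fibre_product_vert)
      have "l (\<sigma> j) \<in> verts (ctot j) \<and> cproj j (l (\<sigma> j)) = crel j `` A" if j: "j \<in> F" for j
        using A(2,3)[OF \<sigma>(1)[OF j]] \<sigma>(2-4)[OF j] by simp
      then show "\<tau> z \<in> verts (FP R F)"
        unfolding FP_def \<tau>_def Al using A(1) by (simp add: fibre_product_vert)
    next
      fix z assume z: "z \<in> edges (FP R F)"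
      moreover obtain A l where Al: "z = (A, l)" by (cases z)
      ultimately have A: "A \<in> edges (Q R)" "\<And>j. j \<in> F \<Longrightarrow> l j \<in> edges (ctot j)" "\<And>j. j \<in> F \<Longrightarrow> cproj j (l j) = crel j `` A"
        unfolding FP_def by (auto simp: fibre_product_edge)
      have "l (\<sigma> j) \<in> edges (ctot j) \<and> cproj j (l (\<sigma> j)) = crel j `` A" if j: "j \<in> F" for j
        using A(2,3)[OF \<sigma>(1)[OF j]] \<sigma>(2-4)[OF j] by simp
      then show "\<tau> z \<in> edges (FP R F)"
        unfolding FP_def \<tau>_def Al using A(1) by (simp add: fibre_product_edge)
      show "\<tau> (source (FP R F) z) = source (FP R F) (\<tau> z)" "\<tau> (target (FP R F) z) = target (FP R F) (\<tau> z)"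
        "\<tau> (opp (FP R F) z) = opp (FP R F) (\<tau> z)"
        unfolding FP_def \<tau>_def Al using \<sigma> by (auto simp: restrict_def fun_eq_iff)
    qed
    from graph_map_component[OF this, of "base R F"]
    have m: "graph_map (C R F) (component (FP R F) z') \<tau>" unfolding base' .
    \<comment> \<open>The component of \<open>z'\<close> is the base component, because
      \<open>z'\<close> is reachable from the base point.\<close>
    have "graph_map (C R F) (C R F) \<tau>"
      using graph_map_on[OF m] reach_trans[OF f(1) r'] by (intro graph_mapI) auto
    then show ?thesis using base' by (intro exI[of _ \<tau>]) (simp add: \<tau>_def)
  qed
  moreover have "finite_covering (C R F) (Q R) fst" using c q unfolding finite_covering_def by blast
  ultimately show ?thesis unfolding galois_def using c(3,5) q(3) by blast
qed

text \<open>Each total graph is finite, so adding all base points over \<open>v0\<close> keeps the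
  set finite. The added members cover the same quotients, so \<open>R\<close> still refines their
  relations.\<close>

lemma saturation:
  assumes a: "admissible R F"
  shows "\<exists>F'. admissible R F' \<and> F \<subseteq> F' \<and>
    (\<forall>R' X q b b'. (R', X, q, b) \<in> F' \<longrightarrow> b' \<in> verts X \<longrightarrow> q b' = R' `` {v0} \<longrightarrow> (R', X, q, b') \<in> F')"
proof -
  define F' where "F' = (\<Union>j\<in>F. (\<lambda>b. (crel j, ctot j, cproj j, b)) ` {b \<in> verts (ctot j). cproj j b = crel j `` {v0}})"
  have "finite {b \<in> verts (ctot j). cproj j b = crel j `` {v0}}" if "j \<in> F" for j
    using coversD(3)[OF admissibleD(4)[OF a that]] unfolding points_def by simp
  then have "finite F'" unfolding F'_def using admissibleD(2)[OF a] by blast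
  moreover have "F' \<subseteq> covers" using admissibleD(4)[OF a] unfolding F'_def covers_def by auto
  moreover have "\<forall>j\<in>F'. R \<subseteq> crel j" using admissibleD(5)[OF a] unfolding F'_def by auto
  moreover have "F \<subseteq> F'"
  proof
    fix j assume j: "j \<in> F"
    note c = coversD(5,6)[OF admissibleD(4)[OF a j]]
    have "j = (crel j, ctot j, cproj j, cbase j)" by simp
    then show "j \<in> F'" unfolding F'_def using j c by blast
  qed
  moreover have "(R', X, q, b') \<in> F'" if "(R', X, q, b) \<in> F'" "b' \<in> verts X" "q b' = R' `` {v0}" for R' X q b b'
    using that unfolding F'_def by auto
  ultimately show ?thesis unfolding admissible_def using admissibleD(1)[OF a] by blast
qed

text \<open>Saturation precedes stabilisation: shrinking \<open>R\<close> leaves \<open>F\<close>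
  saturated, whereas stability refers to the final \<open>F\<close>.\<close>

lemma universal_levels:
  assumes S: "S \<in> entourages universal" and R: "R \<in> entourages \<Delta>"
  shows "\<exists>R0 F. level universal \<Delta> proj (level_map R0 F) (C R0 F) (\<lambda>x. R0 `` {x}) (Q R0) fst \<and>
    ker universal (level_map R0 F) \<subseteq> S \<and> ker \<Delta> (\<lambda>x. R0 `` {x}) \<subseteq> R"
proof -
  obtain R1 F1 where 1: "admissible R1 F1" "ker universal (level_map R1 F1) \<subseteq> S" using S unfolding universal_entourage by blast
  obtain R2 where R2: "cce R2" "R2 \<subseteq> R1" "R2 \<subseteq> R" using cce_below[OF cceD(1)[OF admissibleD(1)[OF 1(1)]] R] by blast
  obtain F where F: "admissible R2 F" "F1 \<subseteq> F"
    "\<And>R' X q b b'. (R', X, q, b) \<in> F \<Longrightarrow> b' \<in> verts X \<Longrightarrow> q b' = R' `` {v0} \<Longrightarrow> (R', X, q, b') \<in> F"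
    using saturation[OF admissible_mono[OF 1(1) R2(1,2)]] by blast
  obtain R0 where R0: "R0 \<subseteq> R2" "stable R0 F" using stable_component[OF F(1)] by blast
  then have a: "admissible R0 F" unfolding stable_def by simp
  note q = Q_facts[OF admissibleD(1)[OF a]]
  have "level universal \<Delta> proj (level_map R0 F) (C R0 F) (\<lambda>x. R0 `` {x}) (Q R0) fst"
    unfolding level_def using galois_component[OF a F(3)] level_map_onto[OF R0(2)] q(4,5) level_map_entourage[OF a]
      cceD(1)[OF admissibleD(1)[OF a]] by (simp add: level_map_def)
  moreover have "ker universal (level_map R0 F) \<subseteq> S"
    using ker_level_map_mono[OF 1(1) a _ F(2)] R0(1) R2(2) 1(2) by blast
  moreover have "ker \<Delta> (\<lambda>x. R0 `` {x}) \<subseteq> R" using q(5) R0(1) R2(3) by simp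
  ultimately show ?thesis by blast
qed

lemma regular_universal: "regular_profinite_covering universal \<Delta> proj"
proof (rule regular_profinite_coveringI[OF profinite_universal profinite])
  show "proj k \<in> points \<Delta>" if "k \<in> points universal" for k using graph_map_on(3)[OF proj_map that] .
  show "\<exists>k (X :: ('a set \<times> ('a cover \<Rightarrow> nat)) graph) d (Y :: 'a set graph) r.
      level universal \<Delta> proj k X d Y r \<and> ker universal k \<subseteq> S \<and> ker \<Delta> d \<subseteq> R"
    if "S \<in> entourages universal" "R \<in> entourages \<Delta>" for S R
    using universal_levels[OF that] by blast
qed

lemma connected_universal: "connected_ugraph universal"
proof (rule connected_ugraphI[OF cofinite_universal])
  fix S assume S: "S \<in> entourages universal"
  obtain R where "R \<in> entourages \<Delta>" using cofinite_entourage(1)[OF cofinite] by blast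
  from universal_levels[OF S this] obtain R F where
    l: "level universal \<Delta> proj (level_map R F) (C R F) (\<lambda>x. R `` {x}) (Q R) fst" "ker universal (level_map R F) \<subseteq> S"
    by blast
  show "\<exists>k (X :: ('a set \<times> ('a cover \<Rightarrow> nat)) graph).
      graph_onto universal X k \<and> is_graph X \<and> path_connected_graph X \<and> ker universal k \<subseteq> S"
    using levelD(2)[OF l(1)] galoisD(1,6)[OF levelD(1)[OF l(1)]] l(2) by blast
qed

section \<open>The universal property\<close>

text \<open>The map sought is one coordinate of the universal covering. The part of \<open>G\<close>
  over the image of \<open>b\<close> becomes a covering of the quotient of \<Delta> by
  \<open>ker \<Delta> b\<close>; what remains is to find the base point \<open>g\<close> for which
  the coordinate of \<open>c\<close> is \<open>a\<close>.\<close>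

lemma lift_to_finite_covering:
  fixes G :: "nat graph"
  assumes fc: "finite_covering G D q" and b: "graph_map \<Delta> D b" "ker \<Delta> b \<in> entourages \<Delta>"
    and c: "c \<in> verts universal" and a: "a \<in> verts G" "q a = b (proj c)"
  shows "\<exists>h. graph_map universal G h \<and> ker universal h \<in> entourages universal \<and>
    (\<forall>k\<in>points universal. q (h k) = b (proj k)) \<and> h c = a"
proof -
  note f = finite_coveringD[OF fc]
  let ?R = "ker \<Delta> b"
  have R: "cce ?R" by (rule cce_ker[OF b(1) graph f(2,4) b(2)])
  note Q = Q_facts[OF R]
  \<comment> \<open>\<open>b\<close> need not be onto \<open>D\<close>; only the part of
    \<open>G\<close> over its image can cover the quotient.\<close>
  define G' where "G' = \<lparr>verts = {g \<in> verts G. q g \<in> b ` verts \<Delta>}, edges = {g \<in> edges G. q g \<in> b ` edges \<Delta>},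
    source = source G, target = target G, opp = opp G\<rparr>"
  \<comment> \<open>The fibre of \<open>b\<close> over \<open>q g\<close>, which on
    \<open>G'\<close> is a class of \<open>ker \<Delta> b\<close>.\<close>
  define q' where "q' g = {x \<in> points \<Delta>. b x = q g}" for g
  have G's [simp]: "verts G' = {g \<in> verts G. q g \<in> b ` verts \<Delta>}" "edges G' = {g \<in> edges G. q g \<in> b ` edges \<Delta>}"
    "source G' = source G" "target G' = target G" "opp G' = opp G" unfolding G'_def by simp_all
  note mb = graph_map_on[OF b(1)] and mq = graph_map_on[OF locally_bijective_map[OF f(5)]]
  have q': "q' g = ?R `` {x}" if "x \<in> points \<Delta>" "q g = b x" for g x
    unfolding equiv_class_ker[OF that(1)] q'_def using that(2) by simp
  have q'D: "q g = b x" if "x \<in> points \<Delta>" "q' g = ?R `` {x}" for g x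
  proof -
    have "x \<in> q' g" unfolding that(2) using that(1) by (simp add: ker_iff)
    then show ?thesis by (simp add: q'_def)
  qed
  have eG: "source G e \<in> verts G' \<and> target G e \<in> verts G' \<and> opp G e \<in> edges G' \<and>
      q' (source G e) = ?R `` {source \<Delta> x} \<and> q' (target G e) = ?R `` {target \<Delta> x} \<and> q' (opp G e) = ?R `` {opp \<Delta> x}"
    if e: "e \<in> edges G" "x \<in> edges \<Delta>" "q e = b x" for e x
  proof -
    note ge = graph_edge[OF f(1) e(1)] and gx = graph_edge[OF graph e(2)]
    have "q (source G e) = b (source \<Delta> x)" "q (target G e) = b (target \<Delta> x)" "q (opp G e) = b (opp \<Delta> x)"
      using mq(4-6)[OF e(1)] mb(4-6)[OF e(2)] e(3) by simp_all
    then show ?thesis using ge gx q' by (simp add: in_points_iff)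
  qed
  have gG': "is_graph G'"
    unfolding is_graph_def
  proof (intro conjI ballI)
    show "verts G' \<inter> edges G' = {}" using graph_disjoint[OF f(1)] by auto
    fix e assume "e \<in> edges G'"
    then obtain x where e: "e \<in> edges G" "x \<in> edges \<Delta>" "q e = b x" by auto
    show "source G' e \<in> verts G'" "target G' e \<in> verts G'" "opp G' e \<in> edges G'" "opp G' (opp G' e) = e"
      "opp G' e \<noteq> e" "source G' (opp G' e) = target G' e" "target G' (opp G' e) = source G' e"
      using eG[OF e] graph_edge[OF f(1) e(1)] unfolding G's(3-5) by blast+
  qed
  have lb: "locally_bijective G' (Q ?R) q'"
  proof (rule locally_bijectiveI)
    note mQ = graph_map_on[OF graph_onto_map[OF Q(4)]]
    show "graph_map G' (Q ?R) q'"
    proof (rule graph_mapI)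
      fix v assume "v \<in> verts G'"
      then obtain x where "x \<in> verts \<Delta>" "q v = b x" by auto
      then show "q' v \<in> verts (Q ?R)" using q'[of x v] mQ(1) by (simp add: in_points_iff)
    next
      fix e assume "e \<in> edges G'"
      then obtain x where e: "e \<in> edges G" "x \<in> edges \<Delta>" "q e = b x" by auto
      have qe: "q' e = ?R `` {x}" using q' e by (simp add: in_points_iff)
      then show "q' e \<in> edges (Q ?R)" using mQ(2)[OF e(2)] by simp
      show "q' (source G' e) = source (Q ?R) (q' e)" "q' (target G' e) = target (Q ?R) (q' e)"
        "q' (opp G' e) = opp (Q ?R) (q' e)"
        using eG[OF e] mQ(4-6)[OF e(2)] unfolding qe G's(3-5) by simp_all
    qed
    fix e e' assume e: "e \<in> edges G'" "e' \<in> edges G'" "source G' e = source G' e'" "q' e = q' e'"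
    then obtain x where "x \<in> edges \<Delta>" "q e = b x" by auto
    then have qe: "q e = q e'" using q'D[of x e'] q'[of x e] e(4) by (simp add: in_points_iff)
    have "e \<in> edges G" "e' \<in> edges G" "source G e = source G e'" using e(1-3) unfolding G's by blast+
    from locally_bijective_inj[OF f(5,1) this qe] show "e = e'" .
  next
    fix v e assume v: "v \<in> verts G'" and e: "e \<in> edges (Q ?R)" "source (Q ?R) e = q' v"
    obtain y where y: "y \<in> verts \<Delta>" "q v = b y" "v \<in> verts G" using v by auto
    obtain x where x: "x \<in> edges \<Delta>" "e = ?R `` {x}" using graph_onto_edge[OF Q(4) e(1)] by blast
    have "q' v = ?R `` {source \<Delta> x}"
      using e(2) graph_map_on(4)[OF graph_onto_map[OF Q(4)] x(1)] x(2) by simp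
    then have "q v = b (source \<Delta> x)" using q'D graph_edge(1)[OF graph x(1)] by (simp add: in_points_iff)
    then obtain e' where e': "e' \<in> edges G" "source G e' = v" "q e' = b x"
      using locally_bijective_ex[OF f(5) y(3) mb(2)[OF x(1)]] mb(4)[OF x(1)] by metis
    moreover have "q' e' = e" using q'[of x e'] x e'(3) by (simp add: in_points_iff)
    ultimately show "\<exists>e'\<in>edges G'. source G' e' = v \<and> q' e' = e" using x(1) by (intro bexI[of _ e']) auto
  qed
  have fin: "finite (points G')" by (rule finite_subset[OF _ f(3)]) (auto simp: points_def)
  define B where "B = {g \<in> verts G'. q' g = ?R `` {v0}}"
  \<comment> \<open>All possible base points are taken at once, because the right one is the end of
    a lifted path, and the path comes from the product over all of them.\<close>
  define F where "F = (\<lambda>g. (?R, G', q', g)) ` B"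
  have "finite B" unfolding B_def by (rule finite_subset[OF _ fin]) (auto simp: points_def)
  moreover have "F \<subseteq> covers"
    unfolding F_def covers_def finite_covering_def B_def using R gG' fin lb Q(1,2) by auto
  ultimately have aF: "admissible ?R F" unfolding admissible_def using R unfolding F_def by auto
  obtain x where oc: "over c x" and x: "x \<in> verts \<Delta>" using c by auto
  have pc: "proj c = x" using proj_eq[OF oc] .
  have xp: "x \<in> points \<Delta>" using x by (simp add: in_points_iff)
  obtain es where "edge_path (FP ?R F) (base ?R F) es (?R `` {x}, restrict c F)"
    using over_vert(1)[OF oc x aF] unfolding component_simps mem_Collect_eq reach_def by blast
  from edge_path_inv[OF FP_facts(1)[OF aF] this]
  obtain es where es: "edge_path (FP ?R F) (?R `` {x}, restrict c F) es (base ?R F)" by blast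
  have ag: "a \<in> verts G'" using a x pc by auto
  have qa: "q' a = ?R `` {x}" using q' xp a(2) pc by simp
  \<comment> \<open>The projection of the path from \<open>c\<close> to the base point is lifted to
    \<open>G'\<close> with start \<open>a\<close>; the end \<open>g\<close> of the lift is the base
    point to use.\<close>
  have "edge_path (Q ?R) (q' a) (map fst es) (?R `` {v0})"
    using edge_path_map[OF locally_bijective_map[OF FP_facts(2)[OF aF]] es] unfolding qa base_def by simp
  from edge_path_lift[OF lb gG' ag this] obtain es' g where
    es': "edge_path G' a es' g" "map q' es' = map fst es" "q' g = ?R `` {v0}" by blast
  let ?j = "(?R, G', q', g)"
  have jF: "?j \<in> F" unfolding F_def B_def using es'(3) edge_path_verts(2)[OF gG' es'(1)] by blast
  have jc: "?j \<in> covers" using admissibleD(4)[OF aF jF] .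
  have coord: "graph_map (FP ?R F) G' (\<lambda>z. snd z ?j)" using FP_facts(4)[OF aF jF] by simp
  have es2: "edge_path G' (c ?j) (map (\<lambda>z. snd z ?j) es) g"
    using edge_path_map[OF coord es] jF unfolding base_def by simp
  have "q' (snd z ?j) = fst z" if z: "z \<in> set es" for z
  proof -
    obtain A l where Al: "z = (A, l)" by (cases z)
    have "(A, l) \<in> edges (FP ?R F)" using edge_path_edges[OF es] z Al by blast
    then obtain y where y: "A = ?R `` {y}" "\<forall>j\<in>F. cproj j (l j) = crel j `` {y}" using FP_edgeE[OF aF] by metis
    then show ?thesis using jF Al by auto
  qed
  then have "map q' (map (\<lambda>z. snd z ?j) es) = map q' es'" unfolding es'(2) by simp
  \<comment> \<open>In the coordinate \<open>?j\<close> the path also ends in its base point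
    \<open>g\<close> and has the same projection, so both lifts have the same start.\<close>
  from edge_path_lift_unique_end[OF lb gG' es2 es'(1) this] have ca: "c ?j = a" .
  have ov: "q (k ?j) = b (proj k)" if "k \<in> points universal" for k
    using over_class[OF universal_points_over[OF that] jc] q'D[OF overD(1)[OF universal_points_over[OF that]]] by simp
  have "graph_map universal G (\<lambda>k. k ?j)"
  proof (rule graph_mapI)
    fix k assume "k \<in> verts universal"
    then obtain y where "y \<in> verts \<Delta>" "over k y" by auto
    from over_vert(2)[OF this(2,1)] have "k ?j \<in> verts G'" using jc by (auto simp: PiE_iff)
    then show "k ?j \<in> verts G" by simp
  next
    fix k assume "k \<in> edges universal"
    then obtain y where "y \<in> edges \<Delta>" "over k y" by auto
    from over_edge(2)[OF this(2,1)] have "k ?j \<in> edges G'" using jc by (auto simp: PiE_iff)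
    then show "k ?j \<in> edges G" by simp
    show "source universal k ?j = source G (k ?j)" "target universal k ?j = target G (k ?j)" "opp universal k ?j = opp G (k ?j)"
      using jc by simp_all
  qed
  moreover have "ker universal (\<lambda>k. k ?j) \<in> entourages universal"
  proof (rule cofinite_ker_comp[OF cofinite_universal level_map_entourage[OF admissible_single[OF jc]]])
    fix k l assume "level_map (crel ?j) {?j} k = level_map (crel ?j) {?j} l"
    then have "restrict k {?j} ?j = restrict l {?j} ?j" unfolding level_map_def by simp
    then show "k ?j = l ?j" by simp
  qed
  ultimately show ?thesis using ov ca by (intro exI[of _ "\<lambda>k. k ?j"]) blast
qed

text \<open>Lifts to the finite coverings with value \<open>\<alpha> a i\<close> at \<open>c\<close>
  are unique because \<open>universal\<close> is connected; hence they are coherent and define a map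
  into the limit.\<close>

lemma universal_lift:
  fixes \<Gamma> :: "'b ugraph"
  assumes cov: "profinite_covering \<Gamma> \<Delta> f" and c: "c \<in> verts universal" and a: "a \<in> verts \<Gamma>" and ca: "proj c = f a"
  shows "\<exists>h. covering_hom universal proj \<Gamma> f h \<and> h c = a"
proof -
  note \<Gamma> = profinite_coveringD(1)[OF cov] and f = profinite_coveringD(3)[OF cov]
  from cov show ?thesis
  proof (rule profinite_coveringE)
    fix I :: "('b, 'a) sys_index set" and leq and G D :: "('b, 'a) sys_index \<Rightarrow> nat graph" and \<phi> \<psi> q \<alpha> \<beta>
    assume sys: "inverse_system I leq G \<phi>" "inverse_system I leq D \<psi>"
      and iso: "limit_iso \<Gamma> I leq G \<phi> \<alpha>" "limit_iso \<Delta> I leq D \<psi> \<beta>"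
      and fc: "\<And>i. i \<in> I \<Longrightarrow> finite_covering (G i) (D i) (q i)"
      and q: "\<And>i x. i \<in> I \<Longrightarrow> x \<in> points \<Gamma> \<Longrightarrow> q i (\<alpha> x i) = \<beta> (f x) i"
      and comm: "\<And>i j x. (i, j) \<in> leq \<Longrightarrow> x \<in> points (G j) \<Longrightarrow> q i (\<phi> i j x) = \<psi> i j (q j x)"
    have ap: "a \<in> points \<Gamma>" using a by (simp add: in_points_iff)
    have cp: "c \<in> points universal" unfolding in_points_iff using c by (rule disjI1)
    note mb = limit_map[OF profinite sys(2) iso(2)] and kb = limit_ker[OF profinite sys(2) iso(2)]
    note ma = limit_map[OF \<Gamma> sys(1) iso(1)]
    define L where "L i h \<longleftrightarrow> graph_map universal (G i) h \<and> ker universal h \<in> entourages universal \<and>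
      (\<forall>k\<in>points universal. q i (h k) = \<beta> (proj k) i) \<and> h c = \<alpha> a i" for i h
    have "\<exists>h. L i h" if i: "i \<in> I" for i
      unfolding L_def by (rule lift_to_finite_covering[OF fc[OF i] mb[OF i] kb[OF i] c graph_map_on(1)[OF ma[OF i] a]])
        (use q[OF i ap] ca in simp)
    then obtain h where hL: "\<And>i. i \<in> I \<Longrightarrow> L i (h i)" by metis
    have h: "\<And>i. i \<in> I \<Longrightarrow> graph_map universal (G i) (h i)"
      "\<And>i. i \<in> I \<Longrightarrow> ker universal (h i) \<in> entourages universal"
      "\<And>i k. i \<in> I \<Longrightarrow> k \<in> points universal \<Longrightarrow> q i (h i k) = \<beta> (proj k) i"
      "\<And>i. i \<in> I \<Longrightarrow> h i c = \<alpha> a i"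
      using hL unfolding L_def by simp_all
    have "\<phi> i j (h j k) = h i k" if ij: "(i, j) \<in> leq" and k: "k \<in> points universal" for i j k
    proof -
      have i: "i \<in> I" "j \<in> I" using ij limit_directed[OF \<Gamma> sys(1) iso(1)] unfolding directed_def preorder_on_def by auto
      have m: "graph_map (G j) (G i) (\<phi> i j)" using sys(1) ij unfolding inverse_system_def by auto
      note fi = finite_coveringD[OF fc[OF i(1)]]
      show ?thesis
      proof (rule profinite_lifts_agree[OF cofinite_universal connected_universal graph_map_comp[OF h(1)[OF i(2)] m] _
            h(1)[OF i(1)] h(2)[OF i(1)] fi(5,1,3) _ c _ k])
        show "ker universal (\<lambda>x. \<phi> i j (h j x)) \<in> entourages universal"
          by (rule cofinite_ker_comp[OF cofinite_universal h(2)[OF i(2)]]) simp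
        show "q i (\<phi> i j (h j x)) = q i (h i x)" if x: "x \<in> points universal" for x
          using comm[OF ij graph_map_on(3)[OF h(1)[OF i(2)] x]] h(3)[OF i(2) x] h(3)[OF i(1) x]
            limit_coherent[OF profinite sys(2) iso(2) graph_map_on(3)[OF proj_map x] ij] by simp
        show "\<phi> i j (h j c) = h i c"
          using h(4)[OF i(1)] h(4)[OF i(2)] limit_coherent[OF \<Gamma> sys(1) iso(1) ap ij] by simp
      qed
    qed
    from limit_lift[OF \<Gamma> sys(1) iso(1) cofinite_universal h(1,2) this] obtain k where
      k: "graph_map universal \<Gamma> k" "continuous_map (gtop universal) (gtop \<Gamma>) k"
      "\<And>x i. x \<in> points universal \<Longrightarrow> i \<in> I \<Longrightarrow> \<alpha> (k x) i = h i x" by metis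
    note kp = graph_map_on(3)[OF k(1)]
    have "f (k x) = proj x" if x: "x \<in> points universal" for x
    proof (rule limit_separated[OF profinite sys(2) iso(2) f[OF kp[OF x]] graph_map_on(3)[OF proj_map x]])
      fix i assume i: "i \<in> I"
      show "\<beta> (f (k x)) i = \<beta> (proj x) i" using q[OF i kp[OF x]] k(3)[OF x i] h(3)[OF i x] by simp
    qed
    moreover have "k c = a"
      by (rule limit_separated[OF \<Gamma> sys(1) iso(1) kp[OF cp] ap]) (use k(3)[OF cp] h(4) in simp)
    ultimately show ?thesis unfolding covering_hom_def using k(1,2) by blast
  qed
qed

theorem universal_profinite_covering_universal: "universal_profinite_covering TYPE('b) universal \<Delta> proj"
  unfolding universal_profinite_covering_def
proof (intro conjI allI impI ballI)
  show "profinite_covering universal \<Delta> proj" by (rule regular_imp_profinite_covering[OF regular_universal])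
  show "connected_ugraph universal" by (rule connected_universal)
  fix \<Gamma> :: "'b ugraph" and f c a
  assume "profinite_covering \<Gamma> \<Delta> f \<and> connected_ugraph \<Gamma>"
    and "c \<in> verts universal" "a \<in> verts \<Gamma>" "proj c = f a"
  then show "\<exists>h. covering_hom universal proj \<Gamma> f h \<and> h c = a" by (rule universal_lift[OF conjunct1])
qed

end

section \<open>Images of the universal covering graph\<close>

text \<open>Levels pull back along a uniformly continuous surjection over \<Delta>: only the map to
  \<open>X\<close> changes.\<close>

lemma level_comp:
  assumes lev: "level V \<Delta> p k X d Y r" and U: "cofinite_graph U" and \<theta>: "graph_onto U V \<theta>"
    and uc: "\<And>E. E \<in> entourages V \<Longrightarrow> \<exists>S\<in>entourages U. \<forall>x y. (x, y) \<in> S \<longrightarrow> (\<theta> x, \<theta> y) \<in> E"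
    and p: "\<And>x. x \<in> points U \<Longrightarrow> p (\<theta> x) = p' x"
  shows "level U \<Delta> p' (\<lambda>x. k (\<theta> x)) X d Y r"
proof -
  note l = levelD[OF lev] and m = graph_map_on(3)[OF graph_onto_map[OF \<theta>]]
  have "ker U (\<lambda>x. k (\<theta> x)) \<in> entourages U" by (rule cofinite_ker_preimage[OF U m uc[OF l(4)]])
  then show ?thesis
    unfolding level_def using l(1,3,5) graph_onto_comp[OF \<theta> l(2)] l(6)[OF m] p by simp
qed

text \<open>The two type arguments fix the types of the finite graphs, over which a formula cannot
  quantify.\<close>

definition has_levels :: "'x itself \<Rightarrow> 'y itself \<Rightarrow> 'u ugraph \<Rightarrow> 'a ugraph \<Rightarrow> ('u \<Rightarrow> 'a) \<Rightarrow> bool" where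
  "has_levels _ _ U \<Delta> p \<longleftrightarrow> (\<forall>S\<in>entourages U. \<forall>R\<in>entourages \<Delta>. \<exists>k (X :: 'x graph) d (Y :: 'y graph) r.
     level U \<Delta> p k X d Y r \<and> ker U k \<subseteq> S \<and> ker \<Delta> d \<subseteq> R)"

lemma has_levelsD:
  assumes "has_levels TYPE('x) TYPE('y) U \<Delta> p" "S \<in> entourages U" "R \<in> entourages \<Delta>"
  shows "\<exists>k (X :: 'x graph) d (Y :: 'y graph) r. level U \<Delta> p k X d Y r \<and> ker U k \<subseteq> S \<and> ker \<Delta> d \<subseteq> R"
  using assms unfolding has_levels_def by blast

lemma covering_homD:
  assumes "covering_hom U p \<Sigma> g h"
  shows "graph_map U \<Sigma> h" "continuous_map (gtop U) (gtop \<Sigma>) h" "x \<in> points U \<Longrightarrow> g (h x) = p x"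
  using assms unfolding covering_hom_def by auto

text \<open>\<open>U\<close> maps to the constructed covering by its own universal property, and
  back by \<open>universal_lift\<close>, with matching base vertices. Both composites fix a vertex
  and lie over \<Delta>, so they are identities; hence the levels and the lifting into any type
  carry over to \<open>U\<close>.\<close>

lemma universal_covering_levels:
  fixes U :: "'u ugraph" and \<Delta> :: "'a ugraph"
  assumes pro: "profinite_graph \<Delta>" and conn: "connected_ugraph \<Delta>"
    and univ: "universal_profinite_covering TYPE('a cover_point) U \<Delta> p"
  shows "has_levels TYPE('a set \<times> ('a cover \<Rightarrow> nat)) TYPE('a set) U \<Delta> p"
    and "universal_profinite_covering TYPE('b) U \<Delta> p"
proof -
  have cov: "profinite_covering U \<Delta> p" and cU: "connected_ugraph U"
    and lift: "\<And>(\<Gamma> :: 'a cover_point ugraph) f c a. profinite_covering \<Gamma> \<Delta> f \<Longrightarrow> connected_ugraph \<Gamma> \<Longrightarrow>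
      c \<in> verts U \<Longrightarrow> a \<in> verts \<Gamma> \<Longrightarrow> p c = f a \<Longrightarrow> \<exists>h. covering_hom U p \<Gamma> f h \<and> h c = a"
    using univ unfolding universal_profinite_covering_def by auto
  note U = profinite_coveringD(1)[OF cov]
  note cofU = profinite_graphD(1)[OF U]
  obtain R where "compatible_cofinite_entourage U R"
    using cofinite_graphD(4)[OF cofU] cofinite_entourage(1)[OF cofU] by blast
  then have "verts (quotient_graph U R) \<noteq> {}" using cU unfolding connected_ugraph_def path_connected_graph_def by blast
  then obtain c where c: "c \<in> verts U" by (auto simp: quotient_def)
  note pm = profinite_covering_map[OF cov]
  \<comment> \<open>The base vertex is placed under a vertex \<open>c\<close> of \<open>U\<close>;
    the two maps are then chosen to exchange \<open>c\<close> with a vertex \<open>c0\<close> over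
    the same point.\<close>
  interpret pointed_profinite_graph \<Delta> "p c"
    by unfold_locales (use pro conn graph_map_on(1)[OF pm c] in auto)
  note regV = regular_imp_profinite_covering[OF regular_universal]
  obtain c0 where c0: "c0 \<in> verts universal" "proj c0 = p c" using proj_surj[OF base_vertex] by blast
  obtain \<theta> where \<theta>: "covering_hom U p universal proj \<theta>" "\<theta> c = c0"
    using lift[OF regV connected_universal c c0(1)] c0(2) by auto
  obtain \<xi> where \<xi>: "covering_hom universal proj U p \<xi>" "\<xi> c0 = c"
    using universal_lift[OF cov c0(1) c c0(2)] by blast
  note t = covering_homD[OF \<theta>(1)] and x = covering_homD[OF \<xi>(1)]
  note tu = uniformly_continuous_gtop[OF U cofinite_universal t(2)]
    and xu = uniformly_continuous_gtop[OF profinite_universal cofU x(2)]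
  note tp = graph_map_on(3)[OF t(1)] and xp = graph_map_on(3)[OF x(1)]
  have \<xi>\<theta>: "\<xi> (\<theta> u) = u" if u: "u \<in> points U" for u
  proof (rule profinite_covering_lifts_agree[OF cov cofU cU graph_map_comp[OF t(1) x(1)] _ _ _ _ c _ u])
    show "\<exists>S\<in>entourages U. \<forall>x y. (x, y) \<in> S \<longrightarrow> (\<xi> (\<theta> x), \<xi> (\<theta> y)) \<in> E" if "E \<in> entourages U" for E
      using xu[OF that] tu by meson
  qed (use \<theta>(2) \<xi>(2) x(3) t(3) tp in \<open>auto simp: graph_map_def\<close>)
  have \<theta>\<xi>: "\<theta> (\<xi> k) = k" if k: "k \<in> points universal" for k
  proof (rule profinite_covering_lifts_agree[OF regV cofinite_universal connected_universal graph_map_comp[OF x(1) t(1)] _ _ _ _ c0(1) _ k])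
    show "\<exists>S\<in>entourages universal. \<forall>x y. (x, y) \<in> S \<longrightarrow> (\<theta> (\<xi> x), \<theta> (\<xi> y)) \<in> E" if "E \<in> entourages universal" for E
      using tu[OF that] xu by meson
    show "graph_map universal universal (\<lambda>x. x)" unfolding graph_map_def by blast
    show "proj (\<theta> (\<xi> k)) = proj k" if "k \<in> points universal" for k using t(3)[OF xp[OF that]] x(3)[OF that] by simp
  qed (use \<theta>(2) \<xi>(2) in auto)
  have onto: "graph_onto U universal \<theta>"
  proof (rule graph_ontoI[OF t(1)])
    show "\<exists>u\<in>verts U. k = \<theta> u" if "k \<in> verts universal" for k
      using \<theta>\<xi>[of k] graph_map_on(1)[OF x(1) that] that by (metis in_points_iff)
    show "\<exists>u\<in>edges U. k = \<theta> u" if "k \<in> edges universal" for k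
      using \<theta>\<xi>[of k] graph_map_on(2)[OF x(1) that] that by (metis in_points_iff)
  qed
  show "has_levels TYPE('a set \<times> ('a cover \<Rightarrow> nat)) TYPE('a set) U \<Delta> p"
    unfolding has_levels_def
  proof (intro ballI)
    fix S R assume S: "S \<in> entourages U" and R: "R \<in> entourages \<Delta>"
    obtain S' where S': "S' \<in> entourages universal" "\<And>k l. (k, l) \<in> S' \<Longrightarrow> (\<xi> k, \<xi> l) \<in> S" using xu[OF S] by blast
    from universal_levels[OF S'(1) R] obtain R0 F where
      l: "level universal \<Delta> proj (level_map R0 F) (C R0 F) (\<lambda>x. R0 `` {x}) (Q R0) fst"
      "ker universal (level_map R0 F) \<subseteq> S'" "ker \<Delta> (\<lambda>x. R0 `` {x}) \<subseteq> R" by blast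
    have "level U \<Delta> p (\<lambda>u. level_map R0 F (\<theta> u)) (C R0 F) (\<lambda>x. R0 `` {x}) (Q R0) fst"
      by (rule level_comp[OF l(1) cofU onto], rule tu, assumption, rule t(3), assumption)
    \<comment> \<open>Points of \<open>U\<close> are close when their images under
      \<open>\<theta>\<close> are, since \<open>\<xi>\<close> is uniformly continuous and inverse to
      \<open>\<theta>\<close>.\<close>
    moreover have "ker U (\<lambda>u. level_map R0 F (\<theta> u)) \<subseteq> S"
    proof (rule subrelI)
      fix u v assume "(u, v) \<in> ker U (\<lambda>u. level_map R0 F (\<theta> u))"
      then have uv: "u \<in> points U" "v \<in> points U" "(\<theta> u, \<theta> v) \<in> ker universal (level_map R0 F)"
        using tp unfolding ker_iff by blast+
      then have "(\<xi> (\<theta> u), \<xi> (\<theta> v)) \<in> S" using l(2) S'(2) by blast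
      then show "(u, v) \<in> S" using \<xi>\<theta> uv by simp
    qed
    ultimately show "\<exists>k (X :: ('a set \<times> ('a cover \<Rightarrow> nat)) graph) d (Y :: 'a set graph) r.
        level U \<Delta> p k X d Y r \<and> ker U k \<subseteq> S \<and> ker \<Delta> d \<subseteq> R" using l(3) by blast
  qed
  show "universal_profinite_covering TYPE('b) U \<Delta> p"
    unfolding universal_profinite_covering_def
  proof (intro conjI allI impI ballI cov cU)
    fix \<Gamma> :: "'b ugraph" and f c' a
    assume \<Gamma>: "profinite_covering \<Gamma> \<Delta> f \<and> connected_ugraph \<Gamma>" and c': "c' \<in> verts U" and a: "a \<in> verts \<Gamma>" "p c' = f a"
    have c'p: "c' \<in> points U" using c' by (simp add: in_points_iff)
    have "proj (\<theta> c') = f a" using t(3)[OF c'p] a(2) by simp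
    from universal_lift[OF conjunct1[OF \<Gamma>] graph_map_on(1)[OF t(1) c'] a(1) this]
    obtain h where h: "covering_hom universal proj \<Gamma> f h" "h (\<theta> c') = a" by blast
    note hh = covering_homD[OF h(1)]
    have "covering_hom U p \<Gamma> f (\<lambda>u. h (\<theta> u))"
      unfolding covering_hom_def
    proof (intro conjI ballI)
      show "graph_map U \<Gamma> (\<lambda>u. h (\<theta> u))" by (rule graph_map_comp[OF t(1) hh(1)])
      show "continuous_map (gtop U) (gtop \<Gamma>) (\<lambda>u. h (\<theta> u))"
        using continuous_map_compose[OF t(2) hh(2)] by (simp add: comp_def)
      show "f (h (\<theta> u)) = p u" if "u \<in> points U" for u using hh(3)[OF tp[OF that]] t(3)[OF that] by simp
    qed
    then show "\<exists>h. covering_hom U p \<Gamma> f h \<and> h c' = a" using h(2) by blast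
  qed
qed

lemma has_levels_regular:
  assumes "has_levels TYPE('x) TYPE('y) U \<Delta> p" "profinite_graph U" "profinite_graph \<Delta>"
    "\<And>x. x \<in> points U \<Longrightarrow> p x \<in> points \<Delta>"
  shows "regular_profinite_covering U \<Delta> p"
proof (rule regular_profinite_coveringI[OF assms(2-4)])
  show "\<exists>k (X :: 'x graph) d (Y :: 'y graph) r. level U \<Delta> p k X d Y r \<and> ker U k \<subseteq> S \<and> ker \<Delta> d \<subseteq> R"
    if "S \<in> entourages U" "R \<in> entourages \<Delta>" for S R
    using assms(1) that unfolding has_levels_def by blast
qed

text \<open>
  With \<open>m\<close> the factor of \<open>h\<close> through \<open>X\<close>, the image of \<open>x \<mapsto> (m x, r x)\<close> in the fibre product of
  \<open>G\<^sub>i\<close> and \<open>Y\<close> is a quotient of \<open>h(U)\<close> that is Galois covered by \<open>X\<close>. It is closed under adjacency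
  in the fibre product, so it is everything when \<open>\<Sigma>\<close> is connected.
\<close>

lemma hom_level:
  fixes U :: "'u ugraph" and \<Sigma> :: "'s ugraph" and \<Delta> :: "'a ugraph"
  assumes lev: "has_levels TYPE('x) TYPE('y) U \<Delta> p" and U: "profinite_graph U"
    and cov: "profinite_covering \<Sigma> \<Delta> g" and h: "covering_hom U p \<Sigma> g h"
    and S: "S \<in> entourages U" and E: "E \<in> entourages \<Sigma>"
  shows "\<exists>k (X :: 'x graph) z (Z :: (nat \<times> 'y) graph) r. galois X Z r \<and> graph_onto U X k \<and> ker U k \<in> entourages U \<and>
    ker U k \<subseteq> S \<and> ker \<Sigma> z \<in> entourages \<Sigma> \<and> ker \<Sigma> z \<subseteq> E \<and> (\<forall>u\<in>points U. r (k u) = z (h u)) \<and>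
    (connected_ugraph \<Sigma> \<longrightarrow> z ` points \<Sigma> \<subseteq> points Z)"
proof -
  note \<Sigma> = profinite_coveringD(1)[OF cov] and \<Delta> = profinite_coveringD(2)[OF cov] and gp = profinite_coveringD(3)[OF cov]
  note gm = profinite_covering_map[OF cov] and hh = covering_homD[OF h]
  note cof = profinite_graphD(1)[OF U] profinite_graphD(1)[OF \<Sigma>] and gr = profinite_graphD(2)[OF U] profinite_graphD(2)[OF \<Sigma>]
  note hp = graph_map_on(3)[OF hh(1)]
  from cov show ?thesis
  proof (rule profinite_coveringE)
    fix I :: "('s, 'a) sys_index set" and leq and G D :: "('s, 'a) sys_index \<Rightarrow> nat graph" and \<phi> \<psi> q \<alpha> \<beta>
    assume sys: "inverse_system I leq G \<phi>" "inverse_system I leq D \<psi>"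
      and iso: "limit_iso \<Sigma> I leq G \<phi> \<alpha>" "limit_iso \<Delta> I leq D \<psi> \<beta>"
      and fc: "\<And>i. i \<in> I \<Longrightarrow> finite_covering (G i) (D i) (q i)"
      and qi: "\<And>i x. i \<in> I \<Longrightarrow> x \<in> points \<Sigma> \<Longrightarrow> q i (\<alpha> x i) = \<beta> (g x) i"
    obtain i where i: "i \<in> I" "ker \<Sigma> (\<lambda>x. \<alpha> x i) \<subseteq> E" using limit_cofinal[OF \<Sigma> sys(1) iso(1) E] by blast
    define a where "a = (\<lambda>x. \<alpha> x i)"
    define b where "b = (\<lambda>x. \<beta> x i)"
    note f = finite_coveringD[OF fc[OF i(1)]]
    have a: "graph_map \<Sigma> (G i) a" "ker \<Sigma> a \<in> entourages \<Sigma>" "ker \<Sigma> a \<subseteq> E"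
      using limit_map[OF \<Sigma> sys(1) iso(1) i(1)] limit_ker[OF \<Sigma> sys(1) iso(1) i(1)] i(2) unfolding a_def by auto
    have b: "graph_map \<Delta> (D i) b" "ker \<Delta> b \<in> entourages \<Delta>"
      using limit_map[OF \<Delta> sys(2) iso(2) i(1)] limit_ker[OF \<Delta> sys(2) iso(2) i(1)] unfolding b_def by auto
    have q: "q i (a x) = b (g x)" if "x \<in> points \<Sigma>" for x using qi[OF i(1) that] unfolding a_def b_def .
    have kah: "ker U (\<lambda>u. a (h u)) \<in> entourages U"
      by (rule cofinite_ker_preimage[OF cof(1) hp uniformly_continuous_gtop[OF U cof(2) hh(2) a(2)]])
    \<comment> \<open>The level of \<open>U\<close> is chosen so fine that \<open>a\<close> after
      \<open>h\<close> factors through \<open>X\<close> and \<open>b\<close> through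
      \<open>Y\<close>.\<close>
    from has_levelsD[OF lev cofinite_entourage(4)[OF cof(1) S kah] b(2)]
    obtain k d r and X :: "'x graph" and Y :: "'y graph" where
      l: "level U \<Delta> p k X d Y r" "ker U k \<subseteq> S \<inter> ker U (\<lambda>u. a (h u))" "ker \<Delta> d \<subseteq> ker \<Delta> b"
      by (elim exE conjE) (rule that)
    note lv = levelD[OF l(1)]
    note gal = galoisD[OF lv(1)]
    note dm = graph_onto_map[OF lv(3)] and rm = locally_bijective_map[OF gal(5)]
    define m where "m x = a (h (inv_into (points U) k x))" for x
    have mk: "m (k u) = a (h u)" if u: "u \<in> points U" for u
    proof -
      have v: "inv_into (points U) k (k u) \<in> points U" "k (inv_into (points U) k (k u)) = k u"
        using u by (auto intro: inv_into_into f_inv_into_f)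
      then have "(inv_into (points U) k (k u), u) \<in> ker U k" using u by (simp add: ker_iff)
      then have "(inv_into (points U) k (k u), u) \<in> ker U (\<lambda>u. a (h u))" using l(2) by blast
      then show ?thesis unfolding m_def by (simp add: ker_iff)
    qed
    define n where "n y = b (inv_into (points \<Delta>) d y)" for y
    have nd: "n (d y) = b y" if y: "y \<in> points \<Delta>" for y
    proof -
      have v: "inv_into (points \<Delta>) d (d y) \<in> points \<Delta>" "d (inv_into (points \<Delta>) d (d y)) = d y"
        using y by (auto intro: inv_into_into f_inv_into_f)
      then have "(inv_into (points \<Delta>) d (d y), y) \<in> ker \<Delta> d" using y by (simp add: ker_iff)
      then have "(inv_into (points \<Delta>) d (d y), y) \<in> ker \<Delta> b" using l(3) by blast
      then show ?thesis unfolding n_def by (simp add: ker_iff)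
    qed
    have mm: "graph_map X (G i) m"
      by (rule graph_onto_factor[OF lv(2) mk graph_map_comp[OF hh(1) a(1)] gr(1)])
    have qm: "q i (m x) = n (r x)" if x: "x \<in> points X" for x
    proof -
      obtain u where u: "u \<in> points U" "x = k u" using graph_onto_point[OF lv(2) x] by blast
      have "q i (m x) = b (g (h u))" using q[OF hp[OF u(1)]] mk u by simp
      moreover have "n (r x) = b (p u)"
        using lv(6)[OF u(1)] u nd[of "p u"] gp[OF hp[OF u(1)]] hh(3)[OF u(1)] by simp
      ultimately show ?thesis using hh(3)[OF u(1)] by simp
    qed
    \<comment> \<open>\<open>r2\<close> pairs the images in \<open>G i\<close> and in
      \<open>Y\<close>, and \<open>z\<close> does the same on \<Sigma>. They agree along
      \<open>h\<close>, so the image of \<open>r2\<close> is also the image of \<open>h\<close>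
      under \<open>z\<close>.\<close>
    define r2 where "r2 = (\<lambda>x. (m x, r x))"
    define z where "z = (\<lambda>s. (a s, d (g s)))"
    let ?Z = "push_graph X r2"
    have cX: "compatible X (ker X r2)"
      unfolding r2_def by (rule compatible_ker_pair[OF compatible_ker[OF mm gal(1) f(1)] compatible_ker[OF rm gal(1,2)]])
    note Zo = push_graph_onto[OF gal(1) cX] and Zg = is_graph_push_graph[OF gal(1) cX]
    note Zm = graph_map_on[OF graph_onto_map[OF Zo]]
    \<comment> \<open>An edge of the product at \<open>r2 x\<close> comes from \<open>X\<close>: its
      part in \<open>Y\<close> lifts at \<open>x\<close>, and injectivity of \<open>q i\<close> on
      stars forces the other coordinate.\<close>
    have star: "\<exists>e'\<in>edges X. source X e' = x \<and> r2 e' = (w, y)"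
      if x: "x \<in> verts X" and w: "w \<in> edges (G i)" "source (G i) w = m x" and y: "y \<in> edges Y" "source Y y = r x"
        and wy: "q i w = n y" for x w y
    proof -
      obtain e' where e': "e' \<in> edges X" "source X e' = x" "r e' = y"
        using locally_bijective_ex[OF gal(5) x y] by blast
      have "source (G i) (m e') = source (G i) w" using graph_map_on(4)[OF mm e'(1)] e'(2) w(2) by simp
      moreover have "q i (m e') = q i w" using qm[of e'] e' wy by (simp add: in_points_iff)
      ultimately have "m e' = w" using locally_bijective_inj[OF f(5,1) graph_map_on(2)[OF mm e'(1)] w(1)] by simp
      then show ?thesis using e' unfolding r2_def by auto
    qed
    have lb: "locally_bijective X ?Z r2"
    proof (rule locally_bijectiveI[OF graph_onto_map[OF Zo]])
      show "e = e'" if "e \<in> edges X" "e' \<in> edges X" "source X e = source X e'" "r2 e = r2 e'" for e e'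
        using locally_bijective_inj[OF gal(5,1) that(1-3)] that(4) unfolding r2_def by simp
      fix v e assume v: "v \<in> verts X" and e: "e \<in> edges ?Z" "source ?Z e = r2 v"
      obtain e0 where e0: "e0 \<in> edges X" "e = r2 e0" using graph_onto_edge[OF Zo e(1)] by blast
      have "r2 (source X e0) = r2 v" using Zm(4)[OF e0(1)] e(2) e0(2) by simp
      then have "m (source X e0) = m v" "r (source X e0) = r v" unfolding r2_def by simp_all
      then have "source (G i) (m e0) = m v" "source Y (r e0) = r v"
        using graph_map_on(4)[OF mm e0(1)] graph_map_on(4)[OF rm e0(1)] by simp_all
      from star[OF v graph_map_on(2)[OF mm e0(1)] this(1) graph_map_on(2)[OF rm e0(1)] this(2) qm]
      show "\<exists>e'\<in>edges X. source X e' = v \<and> r2 e' = e" using e0 unfolding r2_def by (simp add: in_points_iff)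
    qed
    have galZ: "galois X ?Z r2"
    proof -
      have "finite_covering X ?Z r2"
        unfolding finite_covering_def using gal(1,3) Zg lb by (simp add: push_graph_verts)
      moreover have "path_connected_graph ?Z" by (rule path_connected_onto[OF Zo gal(6,1)])
      moreover obtain x where x: "x \<in> verts X" and deck: "\<And>x'. x' \<in> verts X \<Longrightarrow> r x' = r x \<Longrightarrow>
          \<exists>\<tau>. graph_map X X \<tau> \<and> (\<forall>z\<in>points X. r (\<tau> z) = r z) \<and> \<tau> x = x'"
        using lv(1) unfolding galois_def by auto
      moreover have "\<exists>\<tau>. graph_map X X \<tau> \<and> (\<forall>z\<in>points X. r2 (\<tau> z) = r2 z) \<and> \<tau> x = x'"
        if x': "x' \<in> verts X" "r2 x' = r2 x" for x'
      proof -
        have mr: "m x' = m x" "r x' = r x" using x'(2) unfolding r2_def by simp_all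
        obtain \<tau> where \<tau>: "graph_map X X \<tau>" "\<And>z. z \<in> points X \<Longrightarrow> r (\<tau> z) = r z" "\<tau> x = x'"
          using deck[OF x'(1) mr(2)] by blast
        \<comment> \<open>\<open>m\<close> and \<open>m\<close> after \<open>\<tau>\<close> are
          lifts of one map through \<open>q i\<close> and agree at \<open>x\<close>. Hence a deck
          transformation over \<open>Y\<close> that keeps the value of \<open>r2\<close> at
          \<open>x\<close> keeps it everywhere.\<close>
        have "m (\<tau> z) = m z" if z: "z \<in> points X" for z
        proof (rule lifts_agree[OF graph_map_comp[OF \<tau>(1) mm] mm f(5,1) _ _ gal(1,6) x z])
          show "q i (m (\<tau> y)) = q i (m y)" if "y \<in> points X" for y
            using qm[OF that] qm[OF graph_map_on(3)[OF \<tau>(1) that]] \<tau>(2)[OF that] by simp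
          show "m (\<tau> x) = m x" using \<tau>(3) mr(1) by simp
        qed
        then show ?thesis using \<tau> unfolding r2_def by (intro exI[of _ \<tau>]) simp
      qed
      ultimately show ?thesis unfolding galois_def using gal(6) by blast
    qed
    have rz: "r2 (k u) = z (h u)" if "u \<in> points U" for u
      unfolding r2_def z_def using mk[OF that] lv(6)[OF that] hh(3)[OF that] by simp
    have kdg: "ker \<Sigma> (\<lambda>s. d (g s)) \<in> entourages \<Sigma>"
      by (rule cofinite_ker_preimage[OF cof(2) gp profinite_covering_uniform[OF cov lv(5)]])
    have kz: "ker \<Sigma> z \<in> entourages \<Sigma>" unfolding z_def by (rule cofinite_ker_pair[OF cof(2) a(2) kdg])
    have kzE: "ker \<Sigma> z \<subseteq> E" using a(3) unfolding z_def by (auto simp: ker_iff subset_iff)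
    have full: "z ` points \<Sigma> \<subseteq> points ?Z" if conn: "connected_ugraph \<Sigma>"
    proof -
      note dgm = graph_map_comp[OF gm dm]
      let ?V = "push_graph \<Sigma> z"
      have cV: "compatible \<Sigma> (ker \<Sigma> z)"
        unfolding z_def by (rule compatible_ker_pair[OF compatible_ker[OF a(1) gr(2) f(1)] compatible_ker[OF dgm gr(2) gal(2)]])
      note Vo = push_graph_onto[OF gr(2) cV] and Vg = is_graph_push_graph[OF gr(2) cV]
      note Vm = graph_map_on[OF graph_onto_map[OF Vo]]
      have "z ` points \<Sigma> \<subseteq> points (G i) \<times> points Y"
        using graph_map_on(3)[OF a(1)] graph_map_on(3)[OF dgm] unfolding z_def by auto
      then have fin: "finite (points ?V)"
        unfolding push_graph_verts by (rule finite_subset) (intro finite_cartesian_product f(3) gal(4))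
      have pc: "path_connected_graph ?V"
        by (rule connected_imp_path_connected[OF conn Vo gr(2) Vg fin kz])
      \<comment> \<open>Closure under adjacency; path connectedness of the image of \<Sigma> spreads
        it from the image of one vertex of \<open>U\<close> to all vertices.\<close>
      have step: "z s \<in> edges ?Z \<and> z (target \<Sigma> s) \<in> verts ?Z" if s: "s \<in> edges \<Sigma>" and zs: "z (source \<Sigma> s) \<in> verts ?Z" for s
      proof -
        obtain x where x: "x \<in> verts X" "z (source \<Sigma> s) = r2 x" using graph_onto_vert[OF Zo zs] by blast
        then have "a (source \<Sigma> s) = m x" "d (g (source \<Sigma> s)) = r x" unfolding z_def r2_def by simp_all
        then have sx: "source (G i) (a s) = m x" "source Y (d (g s)) = r x"
          using graph_map_on(4)[OF a(1) s] graph_map_on(4)[OF dgm s] by simp_all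
        have sp: "s \<in> points \<Sigma>" using s by (simp add: in_points_iff)
        have "q i (a s) = n (d (g s))" using q[OF sp] nd[OF gp[OF sp]] by simp
        from star[OF x(1) graph_map_on(2)[OF a(1) s] sx(1) graph_map_on(2)[OF dgm s] sx(2) this]
        obtain e' where e': "e' \<in> edges X" "source X e' = x" "r2 e' = z s" unfolding z_def by auto
        then have "m e' = a s" "r e' = d (g s)" unfolding r2_def z_def by simp_all
        then have "r2 (target X e') = z (target \<Sigma> s)"
          unfolding r2_def z_def using graph_map_on(5)[OF mm e'(1)] graph_map_on(5)[OF rm e'(1)]
            graph_map_on(5)[OF a(1) s] graph_map_on(5)[OF dgm s] by simp
        then show ?thesis using Zm(2)[OF e'(1)] Zm(1)[OF graph_edge(2)[OF gal(1) e'(1)]] e'(3) by simp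
      qed
      obtain x0 where x0: "x0 \<in> verts X" using gal(6) unfolding path_connected_graph_def by blast
      obtain u0 where u0: "u0 \<in> verts U" "x0 = k u0" using graph_onto_vert[OF lv(2) x0] by blast
      have z0: "z (h u0) = r2 x0" using rz[of u0] u0 by (simp add: in_points_iff)
      have z0V: "z (h u0) \<in> verts ?V" using Vm(1) graph_map_on(1)[OF hh(1) u0(1)] by blast
      have vert: "v \<in> verts ?Z" if v: "v \<in> verts ?V" for v
      proof (rule reach_invariant[of ?V "z (h u0)" v "\<lambda>v. v \<in> verts ?Z"])
        show "reach ?V (z (h u0)) v" by (rule path_connected_reach[OF pc z0V v])
        show "z (h u0) \<in> verts ?Z" unfolding z0 by (rule Zm(1)[OF x0])
        fix e assume e: "e \<in> edges ?V" "source ?V e \<in> verts ?Z"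
        obtain s where s: "s \<in> edges \<Sigma>" "e = z s" using graph_onto_edge[OF Vo e(1)] by blast
        show "target ?V e \<in> verts ?Z" using step[OF s(1)] e(2) Vm(4,5)[OF s(1)] s(2) by simp
      qed
      show ?thesis
      proof
        fix w assume "w \<in> z ` points \<Sigma>"
        then obtain s where s: "s \<in> points \<Sigma>" "w = z s" by blast
        show "w \<in> points ?Z"
        proof (cases "s \<in> verts \<Sigma>")
          case True
          then show ?thesis using vert[OF Vm(1)[OF True]] s(2) by (simp add: in_points_iff)
        next
          case False
          then have e: "s \<in> edges \<Sigma>" using s(1) by (simp add: in_points_iff)
          show ?thesis using step[OF e vert[OF Vm(1)[OF graph_edge(1)[OF gr(2) e]]]] s(2) by (simp add: in_points_iff)
        qed
      qed
    qed
    show ?thesis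
      using galZ lv(2,4) l(2) kz kzE rz full by (intro exI[of _ k] exI[of _ X] exI[of _ z] exI[of _ ?Z] exI[of _ r2]) blast
  qed
qed

section \<open>Induced subgraphs and images of homomorphisms\<close>

lemma induced_subgraph_simps [simp]:
  "verts (induced_subgraph G S) = verts G \<inter> S" "edges (induced_subgraph G S) = edges G \<inter> S"
  "source (induced_subgraph G S) = source G" "target (induced_subgraph G S) = target G"
  "opp (induced_subgraph G S) = opp G" "points (induced_subgraph G S) = points G \<inter> S"
  "entourages (induced_subgraph G S) = (\<lambda>E. E \<inter> S \<times> S) ` entourages G"
  by (auto simp: induced_subgraph_def points_def)

lemma cofinite_induced_subgraph:
  assumes G: "cofinite_graph G" and S: "S \<subseteq> points G"
    and closed: "\<And>e. e \<in> edges G \<Longrightarrow> e \<in> S \<Longrightarrow> source G e \<in> S \<and> target G e \<in> S \<and> opp G e \<in> S"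
  shows "cofinite_graph (induced_subgraph G S)"
proof -
  let ?H = "induced_subgraph G S"
  note g = cofinite_graphD(1)[OF G] and ent = cofinite_entourage[OF G]
  have pH: "points ?H = S" using S by auto
  have gH: "is_graph ?H"
    using g closed unfolding is_graph_def by auto
  have u: "E \<in> entourages G \<Longrightarrow> E\<inverse> \<in> entourages G" "E \<in> entourages G \<Longrightarrow> \<exists>F\<in>entourages G. F O F \<subseteq> E" for E
    using bspec[OF cofinite_graphD(2)[OF G, unfolded uniformity_on_def, THEN conjunct2, THEN conjunct1], of E] by simp_all
  have "uniformity_on S (entourages ?H)"
    unfolding uniformity_on_def
  proof (intro conjI ballI allI impI)
    show "entourages ?H \<noteq> {}" using ent(1) by simp
    fix E assume "E \<in> entourages ?H"
    then obtain E0 where E0: "E0 \<in> entourages G" "E = E0 \<inter> S \<times> S" by auto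
    show "Id_on S \<subseteq> E" using ent(3)[OF E0(1)] S E0(2) by auto
    show "E \<subseteq> S \<times> S" using E0(2) by auto
    have "E\<inverse> = E0\<inverse> \<inter> S \<times> S" using E0(2) by auto
    then show "E\<inverse> \<in> entourages ?H" using u(1)[OF E0(1)] by simp
    obtain F0 where "F0 \<in> entourages G" "F0 O F0 \<subseteq> E0" using u(2)[OF E0(1)] by blast
    then show "\<exists>F\<in>entourages ?H. F O F \<subseteq> E" using E0(2) by (intro bexI[of _ "F0 \<inter> S \<times> S"]) auto
    show "F \<in> entourages ?H" if F: "E \<subseteq> F \<and> F \<subseteq> S \<times> S" for F
    proof -
      \<comment> \<open>A larger relation \<open>F\<close> on \<open>S\<close> is the trace of its
        union with \<open>E0\<close>, since the trace of \<open>E0\<close> is \<open>E\<close>,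
        which lies in \<open>F\<close>.\<close>
      have "E0 \<union> F \<in> entourages G" using ent(5)[OF E0(1), of "E0 \<union> F"] ent(2)[OF E0(1)] F S by blast
      moreover have "F = (E0 \<union> F) \<inter> S \<times> S" using F E0(2) by auto
      ultimately show ?thesis by auto
    qed
    fix E' assume "E' \<in> entourages ?H"
    then obtain E1 where E1: "E1 \<in> entourages G" "E' = E1 \<inter> S \<times> S" by auto
    have "E \<inter> E' = (E0 \<inter> E1) \<inter> S \<times> S" using E0 E1 by auto
    then show "E \<inter> E' \<in> entourages ?H" using ent(4)[OF E0(1) E1(1)] by simp
  qed
  moreover have "\<Inter>(entourages ?H) = Id_on S"
  proof -
    have "\<Inter>(entourages ?H) = \<Inter>(entourages G) \<inter> S \<times> S" using ent(1) by auto
    then show ?thesis using cofinite_graphD(3)[OF G] S by auto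
  qed
  moreover have "\<exists>R. R \<subseteq> E \<and> compatible_cofinite_entourage ?H R" if E: "E \<in> entourages ?H" for E
  proof -
    obtain E0 where E0: "E0 \<in> entourages G" "E = E0 \<inter> S \<times> S" using E by auto
    obtain R where R: "R \<subseteq> E0" "compatible_cofinite_entourage G R" using cofinite_graphD(4)[OF G E0(1)] by blast
    note r = cceD[OF R(2)]
    let ?R = "R \<inter> S \<times> S"
    \<comment> \<open>As the kernel of the class map, the trace is an equivalence relation with
      finitely many classes.\<close>
    have k: "?R = ker ?H (\<lambda>s. R `` {s})"
      using S by (auto simp: ker_iff equiv_class_eq_iff_rel[OF r(4)] subset_iff)
    have "finite ((\<lambda>s. R `` {s}) ` points ?H)"
      by (rule finite_subset[OF _ r(3)]) (auto intro: quotientI)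
    then have "finite (points ?H // ?R)" unfolding k by (rule finite_quotient_ker)
    moreover have "equiv (points ?H) ?R" unfolding k by (rule equiv_ker)
    then have "compatible ?H ?R"
      unfolding compatible_def using compatibleD(2-6)[OF r(2)] closed by auto
    ultimately have "compatible_cofinite_entourage ?H ?R"
      unfolding compatible_cofinite_entourage_def using r(1) by simp
    then show ?thesis using R(1) E0(2) by (intro exI[of _ ?R]) auto
  qed
  ultimately show ?thesis unfolding cofinite_graph_def pH using gH by blast
qed

text \<open>The image is closed under the graph operations because an edge in it comes from an edge
  of \<open>U\<close>; it is compact because \<open>h\<close> is also continuous for the trace
  uniformity.\<close>

lemma profinite_image:
  assumes U: "profinite_graph U" and G: "cofinite_graph G" and h: "graph_map U G h" "continuous_map (gtop U) (gtop G) h"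
  shows "profinite_graph (induced_subgraph G (h ` points U))" (is "profinite_graph ?H")
proof -
  note hp = graph_map_on(3)[OF h(1)] and gU = profinite_graphD(2)[OF U] and gG = cofinite_graphD(1)[OF G]
  have closed: "source G e \<in> h ` points U \<and> target G e \<in> h ` points U \<and> opp G e \<in> h ` points U"
    if e: "e \<in> edges G" "e \<in> h ` points U" for e
  proof -
    obtain u where u: "u \<in> points U" "e = h u" using e(2) by blast
    then have "u \<in> edges U" using graph_map_edge[OF h(1) gG] e(1) by blast
    then show ?thesis using graph_map_on(4-6)[OF h(1)] graph_edge(1-3)[OF gU] u(2)
      by (metis image_eqI in_points_iff)
  qed
  have H: "cofinite_graph ?H" by (rule cofinite_induced_subgraph[OF G _ closed]) (use hp in auto)
  have pH: "points ?H = h ` points U" using hp by auto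
  have "continuous_map (gtop U) (gtop ?H) h"
  proof (rule continuous_gtopI[OF profinite_graphD(1)[OF U] H])
    show "h x \<in> points ?H" if "x \<in> points U" for x using that unfolding pH by simp
    fix E assume "E \<in> entourages ?H"
    then obtain E0 where E0: "E0 \<in> entourages G" "E = E0 \<inter> h ` points U \<times> h ` points U" by auto
    obtain S where S: "S \<in> entourages U" "\<And>x y. (x, y) \<in> S \<Longrightarrow> (h x, h y) \<in> E0"
      using uniformly_continuous_gtop[OF U G h(2) E0(1)] by blast
    have "(h x, h y) \<in> E" if xy: "(x, y) \<in> S" for x y
      using S(2)[OF xy] cofinite_entourage(2)[OF profinite_graphD(1)[OF U] S(1)] xy unfolding E0(2) by auto
    then show "\<exists>S\<in>entourages U. \<forall>x y. (x, y) \<in> S \<longrightarrow> (h x, h y) \<in> E" using S(1) by blast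
  qed
  moreover have "compactin (gtop U) (points U)"
    using profinite_graphD(3)[OF U] topspace_gtop[OF profinite_graphD(1)[OF U]] unfolding compact_space_def by simp
  ultimately have "compactin (gtop ?H) (points ?H)" unfolding pH by (metis image_compactin)
  then show ?thesis
    unfolding profinite_graph_def compact_space_def topspace_gtop[OF H] using H by simp
qed

text \<open>The levels found for the homomorphism are restricted to the image of \<open>h\<close>;
  there \<open>z\<close> maps onto \<open>Z\<close> because \<open>r\<close> after \<open>k\<close>
  does.\<close>

lemma hom_image_regular:
  fixes U :: "'u ugraph" and \<Sigma> :: "'s ugraph" and \<Delta> :: "'a ugraph"
  assumes lev: "has_levels TYPE('x) TYPE('y) U \<Delta> p" and U: "profinite_graph U"
    and cov: "profinite_covering \<Sigma> \<Delta> g" and h: "covering_hom U p \<Sigma> g h"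
  shows "regular_profinite_covering U (induced_subgraph \<Sigma> (h ` points U)) h" (is "regular_profinite_covering U ?H h")
proof (rule regular_profinite_coveringI[OF U])
  note \<Sigma> = profinite_coveringD(1)[OF cov] and hh = covering_homD[OF h]
  note cof = profinite_graphD(1)[OF \<Sigma>] and gU = profinite_graphD(2)[OF U] and g\<Sigma> = profinite_graphD(2)[OF \<Sigma>]
  note hm = graph_map_on[OF hh(1)]
  show H: "profinite_graph ?H" by (rule profinite_image[OF U cof hh(1,2)])
  show "h x \<in> points ?H" if "x \<in> points U" for x using hm(3)[OF that] that by simp
  fix S T assume S: "S \<in> entourages U" and T: "T \<in> entourages ?H"
  obtain E where E: "E \<in> entourages \<Sigma>" "T = E \<inter> h ` points U \<times> h ` points U" using T by auto
  from hom_level[OF lev U cov h S E(1)] obtain k z r and X :: "'x graph" and Z :: "(nat \<times> 'y) graph" where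
    l: "galois X Z r" "graph_onto U X k" "ker U k \<in> entourages U" "ker U k \<subseteq> S"
      "ker \<Sigma> z \<in> entourages \<Sigma>" "ker \<Sigma> z \<subseteq> E" "\<forall>u\<in>points U. r (k u) = z (h u)"
    by (elim exE conjE) (rule that)
  note gal = galoisD[OF l(1)]
  have ro: "graph_onto X Z r"
    by (rule covering_onto[OF gal(5,1) _ gal(2,7)]) (use gal(6) in \<open>auto simp: path_connected_graph_def\<close>)
  note rko = graph_onto_comp[OF l(2) ro]
  have ho: "graph_onto U ?H h"
  proof (rule graph_ontoI)
    have img: "x \<in> points U \<Longrightarrow> h x \<in> h ` points U" for x by simp
    show "graph_map U ?H h" by (rule graph_mapI) (use hm img in \<open>auto simp: in_points_iff\<close>)
    show "\<exists>x\<in>verts U. y = h x" if "y \<in> verts ?H" for y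
      using that graph_map_vertex[OF hh(1) g\<Sigma>] by auto
    show "\<exists>x\<in>edges U. y = h x" if "y \<in> edges ?H" for y
      using that graph_map_edge[OF hh(1) g\<Sigma>] by auto
  qed
  have zm: "graph_map ?H Z z"
    by (rule graph_onto_factor[OF ho _ graph_onto_map[OF rko] gU]) (use l(7) in simp)
  have "graph_onto ?H Z z"
  proof (rule graph_ontoI[OF zm])
    show "\<exists>x\<in>verts ?H. y = z x" if "y \<in> verts Z" for y
      using graph_onto_vert[OF rko that] l(7) graph_map_on(1)[OF graph_onto_map[OF ho]] by (metis in_points_iff)
    show "\<exists>x\<in>edges ?H. y = z x" if "y \<in> edges Z" for y
      using graph_onto_edge[OF rko that] l(7) graph_map_on(2)[OF graph_onto_map[OF ho]] by (metis in_points_iff)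
  qed
  moreover have kz: "ker ?H z = ker \<Sigma> z \<inter> h ` points U \<times> h ` points U" by (auto simp: ker_iff)
  moreover have "ker ?H z \<in> entourages ?H" unfolding kz using l(5) by simp
  ultimately have "level U ?H h k X z Z r" unfolding level_def using l by simp
  moreover have "ker ?H z \<subseteq> T" unfolding kz E(2) using l(6) by auto
  ultimately show "\<exists>k (X :: 'x graph) d (Z :: (nat \<times> 'y) graph) r. level U ?H h k X d Z r \<and> ker U k \<subseteq> S \<and> ker ?H d \<subseteq> T"
    using l(4) by blast
qed

text \<open>At each level, \<open>z s\<close> is in the image of \<open>r\<close> after
  \<open>k\<close>, so the image of \<open>h\<close> meets every class of \<open>s\<close>.
  Compactness of \<open>U\<close> turns these approximations into a preimage of
  \<open>s\<close>.\<close>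

lemma hom_onto_connected:
  fixes U :: "'u ugraph" and \<Sigma> :: "'s ugraph" and \<Delta> :: "'a ugraph"
  assumes lev: "has_levels TYPE('x) TYPE('y) U \<Delta> p" and U: "profinite_graph U"
    and cov: "profinite_covering \<Sigma> \<Delta> g" and h: "covering_hom U p \<Sigma> g h" and conn: "connected_ugraph \<Sigma>"
  shows "h ` points U = points \<Sigma>"
proof
  note \<Sigma> = profinite_coveringD(1)[OF cov] and hh = covering_homD[OF h]
  note cof = profinite_graphD(1)[OF \<Sigma>] and cofU = profinite_graphD(1)[OF U]
  note hp = graph_map_on(3)[OF hh(1)]
  show "h ` points U \<subseteq> points \<Sigma>" using hp by auto
  show "points \<Sigma> \<subseteq> h ` points U"
  proof
    fix s assume s: "s \<in> points \<Sigma>"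
    define K where "K R = {u \<in> points U. R `` {h u} = R `` {s}}" for R :: "('s \<times> 's) set"
    define I where "I = {R. compatible_cofinite_entourage \<Sigma> R}"
    obtain S0 where S0: "S0 \<in> entourages U" using cofinite_entourage(1)[OF cofU] by blast
    have "\<exists>u. \<forall>R\<in>I. u \<in> K R"
    proof (rule directed_fip[OF profinite_graphD(3)[OF U]])
      show "I \<noteq> {}" unfolding I_def using cofinite_graphD(4)[OF cof] cofinite_entourage(1)[OF cof] by blast
      fix R assume "R \<in> I"
      then have cR: "compatible_cofinite_entourage \<Sigma> R" unfolding I_def by simp
      note R = cceD[OF cR]
      have kR: "ker \<Sigma> (\<lambda>x. R `` {x}) \<in> entourages \<Sigma>" using ker_equiv_class[OF R(4)] R(1) by simp
      have "ker U (\<lambda>u. R `` {h u}) \<in> entourages U"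
        by (rule cofinite_ker_preimage[OF cofU hp uniformly_continuous_gtop[OF U cof hh(2) kR]])
      then show "closedin (gtop U) (K R)"
        unfolding K_def using closedin_fibres[OF cofU, of "\<lambda>u. R `` {h u}" "\<lambda>A. A = R `` {s}"] by simp
      from hom_level[OF lev U cov h S0 R(1)] obtain k z r and X :: "'x graph" and Z :: "(nat \<times> 'y) graph" where
        l: "galois X Z r" "graph_onto U X k" "ker \<Sigma> z \<subseteq> R" "\<forall>u\<in>points U. r (k u) = z (h u)"
          "connected_ugraph \<Sigma> \<longrightarrow> z ` points \<Sigma> \<subseteq> points Z"
        by (elim exE conjE) (rule that)
      note gal = galoisD[OF l(1)]
      have ro: "graph_onto X Z r"
        by (rule covering_onto[OF gal(5,1) _ gal(2,7)]) (use gal(6) in \<open>auto simp: path_connected_graph_def\<close>)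
      have "z s \<in> points Z" using l(5) conn s by blast
      then obtain u where u: "u \<in> points U" "z s = r (k u)" using graph_onto_point[OF graph_onto_comp[OF l(2) ro]] by blast
      then have "(h u, s) \<in> ker \<Sigma> z" using l(4) s hp by (simp add: ker_iff)
      then have "R `` {h u} = R `` {s}" using l(3) equiv_class_eq[OF R(4)] by blast
      then have "u \<in> K R" using u unfolding K_def by simp
      then show "K R \<noteq> {}" by blast
      fix R' assume "R' \<in> I"
      then have cR': "compatible_cofinite_entourage \<Sigma> R'" unfolding I_def by simp
      note R' = cceD[OF cR']
      obtain R'' where R'': "compatible_cofinite_entourage \<Sigma> R''" "R'' \<subseteq> R \<inter> R'"
        using cofinite_graphD(4)[OF cof cofinite_entourage(4)[OF cof R(1) R'(1)]] by blast
      have "K R'' \<subseteq> K R \<inter> K R'"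
      proof
        fix u assume "u \<in> K R''"
        then have u: "u \<in> points U" "(h u, s) \<in> R''"
          unfolding K_def using equiv_class_eq_iff_rel[OF cceD(4)[OF R''(1)]] hp s by auto
        then have "(h u, s) \<in> R" "(h u, s) \<in> R'" using R''(2) by auto
        then show "u \<in> K R \<inter> K R'"
          unfolding K_def using u(1) equiv_class_eq[OF R(4)] equiv_class_eq[OF R'(4)] by blast
      qed
      show "\<exists>k\<in>I. K k \<subseteq> K R \<inter> K R'" using \<open>K R'' \<subseteq> K R \<inter> K R'\<close> R''(1) unfolding I_def by blast
    qed
    then obtain u where u: "\<And>R. compatible_cofinite_entourage \<Sigma> R \<Longrightarrow> u \<in> K R" unfolding I_def by blast
    obtain R where "compatible_cofinite_entourage \<Sigma> R" using cofinite_graphD(4)[OF cof] cofinite_entourage(1)[OF cof] by blast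
    then have up: "u \<in> points U" using u unfolding K_def by blast
    have "h u = s"
    proof (rule cofinite_separated[OF cof hp[OF up]])
      fix R assume R: "compatible_cofinite_entourage \<Sigma> R"
      then show "(h u, s) \<in> R"
        using u[OF R] equiv_class_eq_iff_rel[OF cceD(4)[OF R] hp[OF up] s] unfolding K_def by simp
    qed
    then show "s \<in> h ` points U" using up by blast
  qed
qed

text \<open>An entourage lies in the square of the set of points, so its trace is itself. The
  equality is literal, which lets a statement about the image be rewritten into one about the whole
  graph.\<close>

lemma induced_subgraph_points:
  assumes "cofinite_graph G"
  shows "induced_subgraph G (points G) = G"
proof -
  have "(\<lambda>E. E \<inter> points G \<times> points G) ` entourages G = (\<lambda>E. E) ` entourages G"
    by (rule image_cong) (use cofinite_entourage(2)[OF assms] in auto)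
  then show ?thesis by (intro ugraph.equality) (auto simp: points_def)
qed

text \<open>The induced subgraph gives the form that also suits a disconnected \<Sigma>, since
  \<open>h\<close> cannot leave the part of \<Sigma> joined to its image; for a connected \<Sigma>
  the image is everything.\<close>

theorem theorem34:
  fixes \<Delta> :: "'a ugraph"
  assumes "profinite_graph \<Delta>" and "connected_ugraph \<Delta>"
  shows
    "(\<exists>(U :: 'a cover_point ugraph) p.
        universal_profinite_covering TYPE('a cover_point) U \<Delta> p) \<and>
     (\<forall>(U :: 'u ugraph) p.
        universal_profinite_covering TYPE('a cover_point) U \<Delta> p \<longrightarrow>
          universal_profinite_covering TYPE('b) U \<Delta> p \<and>
          regular_profinite_covering U \<Delta> p \<and>
          (\<forall>(\<Sigma> :: 's ugraph) g h.
             profinite_covering \<Sigma> \<Delta> g \<and> covering_hom U p \<Sigma> g h \<longrightarrow>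
               (connected_ugraph \<Sigma> \<longrightarrow> regular_profinite_covering U \<Sigma> h) \<and>
               regular_profinite_covering U (induced_subgraph \<Sigma> (h ` points U)) h))"
proof (intro conjI allI impI)
  note cof = profinite_graphD(1)[OF assms(1)]
  \<comment> \<open>A base vertex exists because the finite quotients of a connected graph have
    vertices.\<close>
  obtain R where "compatible_cofinite_entourage \<Delta> R"
    using cofinite_graphD(4)[OF cof] cofinite_entourage(1)[OF cof] by blast
  then have "verts (quotient_graph \<Delta> R) \<noteq> {}"
    using assms(2) unfolding connected_ugraph_def path_connected_graph_def by blast
  then obtain v0 where v0: "v0 \<in> verts \<Delta>" by (auto simp: quotient_def)
  interpret pointed_profinite_graph \<Delta> v0 by unfold_locales (use assms v0 in auto)
  show "\<exists>(U :: 'a cover_point ugraph) p. universal_profinite_covering TYPE('a cover_point) U \<Delta> p"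
    using universal_profinite_covering_universal by blast
next
  fix U :: "'u ugraph" and p
  assume univ: "universal_profinite_covering TYPE('a cover_point) U \<Delta> p"
  show "universal_profinite_covering TYPE('b) U \<Delta> p" by (rule universal_covering_levels(2)[OF assms univ])
  note lev = universal_covering_levels(1)[OF assms univ]
  have cov: "profinite_covering U \<Delta> p" using univ unfolding universal_profinite_covering_def by simp
  note U = profinite_coveringD(1)[OF cov]
  show "regular_profinite_covering U \<Delta> p"
    by (rule has_levels_regular[OF lev U assms(1) profinite_coveringD(3)[OF cov]])
  fix \<Sigma> :: "'s ugraph" and g h
  assume gh: "profinite_covering \<Sigma> \<Delta> g \<and> covering_hom U p \<Sigma> g h"
  show reg: "regular_profinite_covering U (induced_subgraph \<Sigma> (h ` points U)) h"
    by (rule hom_image_regular[OF lev U conjunct1[OF gh] conjunct2[OF gh]])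
  assume conn: "connected_ugraph \<Sigma>"
  show "regular_profinite_covering U \<Sigma> h"
    using reg hom_onto_connected[OF lev U conjunct1[OF gh] conjunct2[OF gh] conn]
      induced_subgraph_points[OF profinite_graphD(1)[OF profinite_coveringD(1)[OF conjunct1[OF gh]]]] by simp
qed

end
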